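(* Fix $b^->0$. Then $$\lim_{b^+\to\infty}u_{b^-,b^+}(x,t)=\overline u(x,t)$$ locally uniformly for $(x,t)\in\overline\Omega\times(0,+\infty)$, with $\overline u$ the viscosity solution to $$\begin{cases}b^-\partial_t\overline u=\min\{\Delta\overline u,0\}&\text{in }\Omega\times(0,+\infty),\\ \overline u=0&\text{on }\partial\Omega\times(0,+\infty),\\ \overline u(\cdot,0)=u_0&\text{in }\Omega.\end{cases}$$ Moreover, $\lim_{t\to\infty}\overline u(\cdot,t)=\widetilde u_0$ uniformly in $\overline\Omega$.
   Context: $\Omega\subset\mathbb{R}^N$, $N\ge1$, is a bounded smooth domain, $u_0$ is continuous on $\overline\Omega$ with $u_0|_{\partial\Omega}=0$. For $b^+>b^->0$ let $b(s)=b^-$ if $s<0$ and $b(s)=b^+$ if $s\ge0$. $u_{b^-,b^+}$ denotes the unique viscosity solution of $$b(\partial_tu)\partial_tu=\Delta u\ \text{ in }\Omega\times(0,+\infty),\quad u=0\ \text{ on }\partial\Omega\times(0,+\infty),\quad u(\cdot,0)=u_0\ \text{ in }\Omega,$$ that is, the continuous function $u:\overline\Omega\times[0,\infty)\to\mathbb{R}$ satisfying the boundary and initial conditions and such that, for every smooth $\phi$, $b(\partial_t\phi)\partial_t\phi-\Delta\phi\le0$ (resp. $\ge0$) at every local maximum (resp. minimum) point $(x_0,t_0)\in\Omega\times(0,\infty)$ of $u-\phi$. Viscosity solutions of $b^-\partial_t\overline u=\min\{\Delta\overline u,0\}$ are defined in the same way, with the inequality $b^-\partial_t\phi-\min\{\Delta\phi,0\}\le0$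 (resp. $\ge0$). The projected initial datum is $$\widetilde u_0(x)=\sup\{v(x):\ v\le u_0,\ -\Delta v\le0\text{ in }\Omega\text{ in the viscosity sense, and } v|_{\partial\Omega}\le0\},$$ where viscosity subsolutions $v$ are bounded and upper semicontinuous on $\overline\Omega$. *)

theory Defs
  imports "HOL-Analysis.Analysis"
begin

section \<open>Smooth functions and smooth domains\<close>

text \<open>
  For an open set S in finite dimension, the following recursion is the usual class of k times
  continuously differentiable functions on S: directional derivatives in every direction v are
  required to be of class k - 1, and the derivative is linear in v.
\<close>

primrec Ck_on :: "nat \<Rightarrow> 'a::real_normed_vector set \<Rightarrow> ('a \<Rightarrow> 'b::real_normed_vector) \<Rightarrow> bool" where
  "Ck_on 0 S f \<longleftrightarrow> continuous_on S f"
| "Ck_on (Suc k) S f \<longleftrightarrow>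
     (\<forall>x\<in>S. f differentiable (at x)) \<and> (\<forall>v. Ck_on k S (\<lambda>x. frechet_derivative f (at x) v))"

definition smooth_on :: "'a::real_normed_vector set \<Rightarrow> ('a \<Rightarrow> 'b::real_normed_vector) \<Rightarrow> bool" where
  "smooth_on S f \<longleftrightarrow> (\<forall>k. Ck_on k S f)"

text \<open>
  The boundary is smooth if near each of its points the domain is the negativity set of a smooth
  function with nonvanishing derivative; by the implicit function theorem, the domain then lies
  locally on one side of a smooth hypersurface.
\<close>

definition smooth_bounded_domain :: "'a::euclidean_space set \<Rightarrow> bool" where
  "smooth_bounded_domain \<Omega> \<longleftrightarrow>
     open \<Omega> \<and> connected \<Omega> \<and> \<Omega> \<noteq> {} \<and> bounded \<Omega> \<and>
     (\<forall>p\<in>frontier \<Omega>. \<exists>U (g :: 'a \<Rightarrow> real).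
        open U \<and> p \<in> U \<and> smooth_on U g \<and>
        (\<forall>x\<in>U. frechet_derivative g (at x) \<noteq> (\<lambda>_. 0)) \<and>
        \<Omega> \<inter> U = {x\<in>U. g x < 0})"


section \<open>Viscosity solutions\<close>

definition laplacian :: "('a::euclidean_space \<Rightarrow> real) \<Rightarrow> 'a \<Rightarrow> real" where
  "laplacian f x = (\<Sum>i\<in>Basis. (deriv ^^ 2) (\<lambda>s. f (x + s *\<^sub>R i)) 0)"

definition time_deriv :: "('a \<times> real \<Rightarrow> real) \<Rightarrow> 'a \<times> real \<Rightarrow> real" where
  "time_deriv f z = deriv (\<lambda>s. f (fst z, s)) (snd z)"

definition space_laplacian :: "('a::euclidean_space \<times> real \<Rightarrow> real) \<Rightarrow> 'a \<times> real \<Rightarrow> real" where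
  "space_laplacian f z = laplacian (\<lambda>y. f (y, snd z)) (fst z)"

definition local_max_on :: "'a::topological_space set \<Rightarrow> ('a \<Rightarrow> real) \<Rightarrow> 'a \<Rightarrow> bool" where
  "local_max_on S f z \<longleftrightarrow> z \<in> S \<and> (\<forall>\<^sub>F y in at z within S. f y \<le> f z)"

definition local_min_on :: "'a::topological_space set \<Rightarrow> ('a \<Rightarrow> real) \<Rightarrow> 'a \<Rightarrow> bool" where
  "local_min_on S f z \<longleftrightarrow> z \<in> S \<and> (\<forall>\<^sub>F y in at z within S. f z \<le> f y)"

text \<open>
  Viscosity solutions of F (\<open>\<partial>\<^sub>t\<close>u) (\<open>\<Delta>\<close>u) = 0 in \<open>\<Omega> \<times> (0,\<infinity>)\<close>, where F is nondecreasing in the first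
  and nonincreasing in the second argument.
\<close>

definition parabolic_viscosity ::
    "(real \<Rightarrow> real \<Rightarrow> real) \<Rightarrow> 'a::euclidean_space set \<Rightarrow> ('a \<times> real \<Rightarrow> real) \<Rightarrow> bool" where
  "parabolic_viscosity F \<Omega> u \<longleftrightarrow>
     (\<forall>\<phi> z. smooth_on (\<Omega> \<times> {0<..}) \<phi> \<longrightarrow>
        (local_max_on (\<Omega> \<times> {0<..}) (\<lambda>y. u y - \<phi> y) z \<longrightarrow>
           F (time_deriv \<phi> z) (space_laplacian \<phi> z) \<le> 0) \<and>
        (local_min_on (\<Omega> \<times> {0<..}) (\<lambda>y. u y - \<phi> y) z \<longrightarrow>
           F (time_deriv \<phi> z) (space_laplacian \<phi> z) \<ge> 0))"

definition dirichlet_viscosity_solution ::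
    "(real \<Rightarrow> real \<Rightarrow> real) \<Rightarrow> 'a::euclidean_space set \<Rightarrow> ('a \<Rightarrow> real) \<Rightarrow> ('a \<times> real \<Rightarrow> real) \<Rightarrow> bool"
  where
  "dirichlet_viscosity_solution F \<Omega> u\<^sub>0 u \<longleftrightarrow>
     continuous_on (closure \<Omega> \<times> {0..}) u \<and>
     parabolic_viscosity F \<Omega> u \<and>
     (\<forall>x\<in>frontier \<Omega>. \<forall>t>0. u (x, t) = 0) \<and>
     (\<forall>x\<in>\<Omega>. u (x, 0) = u\<^sub>0 x)"

definition b_coeff :: "real \<Rightarrow> real \<Rightarrow> real \<Rightarrow> real" where
  "b_coeff bm bp s = (if s < 0 then bm else bp)"

definition F_two_speed :: "real \<Rightarrow> real \<Rightarrow> real \<Rightarrow> real \<Rightarrow> real" where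
  "F_two_speed bm bp p l = b_coeff bm bp p * p - l"

definition F_limit :: "real \<Rightarrow> real \<Rightarrow> real \<Rightarrow> real" where
  "F_limit bm p l = bm * p - min l 0"


section \<open>The projected initial datum\<close>

definition upper_semicontinuous_on :: "'a::topological_space set \<Rightarrow> ('a \<Rightarrow> real) \<Rightarrow> bool" where
  "upper_semicontinuous_on S v \<longleftrightarrow> (\<forall>x\<in>S. \<forall>a>v x. \<forall>\<^sub>F y in at x within S. v y < a)"

definition viscosity_subharmonic :: "'a::euclidean_space set \<Rightarrow> ('a \<Rightarrow> real) \<Rightarrow> bool" where
  "viscosity_subharmonic \<Omega> v \<longleftrightarrow>
     bounded (v ` closure \<Omega>) \<and> upper_semicontinuous_on (closure \<Omega>) v \<and>
     (\<forall>\<phi> x. smooth_on \<Omega> \<phi> \<longrightarrow> local_max_on \<Omega> (\<lambda>y. v y - \<phi> y) x \<longrightarrow> - laplacian \<phi> x \<le> 0)"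

text \<open>
  For x in \<open>closure \<Omega>\<close> the set below is bounded above by \<open>u\<^sub>0 x\<close>, and it is nonempty when \<open>u\<^sub>0\<close> is
  continuous on \<open>closure \<Omega>\<close> with \<open>\<Omega>\<close> bounded, so the real supremum is genuine there.
\<close>

definition projected_datum :: "'a::euclidean_space set \<Rightarrow> ('a \<Rightarrow> real) \<Rightarrow> 'a \<Rightarrow> real" where
  "projected_datum \<Omega> u\<^sub>0 x =
     Sup {v x | v. (\<forall>y\<in>closure \<Omega>. v y \<le> u\<^sub>0 y) \<and> viscosity_subharmonic \<Omega> v \<and>
                   (\<forall>y\<in>frontier \<Omega>. v y \<le> 0)}"

end

theory Submission
  imports Defs
begin

text \<open>
  The operators are concave: both equations read \<open>\<partial>\<^sub>t u = min (\<Delta>u / b\<^sup>-) (\<Delta>u / b\<^sup>+)\<close>, with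
  \<open>b\<^sup>+ = \<infinity>\<close> in the limit. Hence a function is a subsolution of the limit equation if and only if
  it is nonincreasing in time and a subsolution of the heat equation. Both properties survive
  mollification, so the comparison principle needs no theorem on sums: a semicontinuous subsolution is
  regularized by sup-convolution and mollification to a classical one, which is then used as a test
  function for the supersolution. That mollification preserves viscosity subsolutions of the heat
  equation follows from comparing, on small cylinders, with potentials of the heat kernel; this
  bounds a subsolution by its heat average one small time step \<open>h\<close> earlier, up to \<open>O(h\<^sup>2)\<close>.

  Barriers that do not depend on \<open>b\<^sup>+\<close> control the half-relaxed limits of \<open>u\<close> as \<open>b\<^sup>+ \<rightarrow> \<infinity>\<close> at the
  parabolic boundary, and comparison shows that the two limits coincide. For large times the limit
  decreases, equicontinuously in space by comparison of translates, to a function that is admissible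
  in the definition of the projected datum; it dominates every admissible function because such a
  function is a stationary subsolution.
\<close>

section \<open>Superjets\<close>

text \<open>The two-speed operators do not converge locally uniformly: they blow up where the time
  derivative is positive. Stability therefore rests on a qualitative property: where the limit
  operator is positive, the approximating ones are positive nearby, from some index on. Existence of
  the limit solution comes out of the same argument, since the two half-relaxed limits agree and are
  then continuous. The comparison principle treats its two functions asymmetrically. Being a
  subsolution of the limit equation is a conjunction of linear inequalities, which averages inherit;
  being a supersolution is an alternative between two, which they do not. So only the subsolution is
  regularized, and the supersolution stays semicontinuous. Superjets are preferred to test functions
  because the latter must be smooth on the whole cylinder, while jets are local, can be added,
  translated and restricted to slices, and enter the operators only through a time slope and a
  spatial trace. Quadratic polynomials, smooth everywhere, translate between the two
  languages.\<close>

definition superjet ::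
    "('b::real_inner \<Rightarrow> real) \<Rightarrow> 'b \<Rightarrow> 'b \<Rightarrow> ('b \<Rightarrow> 'b) \<Rightarrow> bool" where
  "superjet v z a A \<longleftrightarrow> linear A \<and>
     (\<forall>\<eta>>0. \<forall>\<^sub>F h in nhds 0. v (z + h) \<le> v z + a \<bullet> h + (A h \<bullet> h) / 2 + \<eta> * (h \<bullet> h))"

text \<open>Asks for a second-order expansion at \<open>z\<close> alone. It is built from two
  superjets so that changing the sign of \<open>f\<close> costs nothing.\<close>

definition jet2 ::
    "('b::real_inner \<Rightarrow> real) \<Rightarrow> 'b \<Rightarrow> 'b \<Rightarrow> ('b \<Rightarrow> 'b) \<Rightarrow> bool" where
  "jet2 f z a A \<longleftrightarrow> superjet f z a A \<and> superjet (\<lambda>y. - f y) z (- a) (\<lambda>h. - A h)"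

lemma superjetD:
  "superjet v z a A \<Longrightarrow> \<eta> > 0 \<Longrightarrow>
    \<forall>\<^sub>F h in nhds 0. v (z + h) \<le> v z + a \<bullet> h + (A h \<bullet> h) / 2 + \<eta> * (h \<bullet> h)"
  by (simp add: superjet_def)

lemma superjet_linear: "superjet v z a A \<Longrightarrow> linear A"
  by (simp add: superjet_def)

lemma superjet_add:
  assumes "superjet u z a A" "superjet v z c C"
  shows "superjet (\<lambda>y. u y + v y) z (a + c) (\<lambda>h. A h + C h)"
  unfolding superjet_def
proof (intro conjI allI impI)
  show "linear (\<lambda>h. A h + C h)"
    using assms by (intro linear_compose_add) (auto simp: superjet_def)
  fix \<eta> :: real assume "\<eta> > 0"
  then have e: "\<eta> / 2 > 0" by simp
  show "\<forall>\<^sub>F h in nhds 0. u (z + h) + v (z + h) \<le> u z + v z + (a + c) \<bullet> h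
      + ((A h + C h) \<bullet> h) / 2 + \<eta> * (h \<bullet> h)"
    using superjetD[OF assms(1) e] superjetD[OF assms(2) e]
    by eventually_elim (simp add: inner_add_left field_simps)
qed

text \<open>A function touching \<open>v\<close> from above passes its superjets on to
  \<open>v\<close>. In this form test functions and barriers enter everywhere below: a one-sided
  expansion of \<open>S\<close> stands in for smoothness.\<close>

lemma superjet_touch:
  assumes "superjet S z a A" "\<forall>\<^sub>F h in nhds 0. v (z + h) - S (z + h) \<le> v z - S z"
  shows "superjet v z a A"
  unfolding superjet_def
proof (intro conjI allI impI)
  show "linear A" using assms(1) by (rule superjet_linear)
  fix \<eta> :: real assume "\<eta> > 0"
  show "\<forall>\<^sub>F h in nhds 0. v (z + h) \<le> v z + a \<bullet> h + (A h \<bullet> h) / 2 + \<eta> * (h \<bullet> h)"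
    using superjetD[OF assms(1) \<open>\<eta> > 0\<close>] assms(2) by eventually_elim simp
qed

lemma jet2_superjet: "jet2 f z a A \<Longrightarrow> superjet f z a A"
  by (simp add: jet2_def)

lemma jet2_minus: "jet2 f z a A \<Longrightarrow> jet2 (\<lambda>y. - f y) z (- a) (\<lambda>h. - A h)"
  by (simp add: jet2_def)

lemma jet2_add:
  "jet2 f z a A \<Longrightarrow> jet2 g z c C \<Longrightarrow> jet2 (\<lambda>y. f y + g y) z (a + c) (\<lambda>h. A h + C h)"
  using superjet_add[of f z a A g c C]
    superjet_add[of "\<lambda>y. - f y" z "- a" "\<lambda>h. - A h" "\<lambda>y. - g y" "- c" "\<lambda>h. - C h"]
  by (simp add: jet2_def)

lemma jet2_const: "jet2 (\<lambda>y. c) z 0 (\<lambda>h. 0)"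
  by (auto simp: jet2_def superjet_def intro!: linear_zero always_eventually)

text \<open>Testing along a ray \<open>t *\<^sub>R h\<close>: dividing by \<open>t\<close> isolates
  the slope, and once the slope is zero, dividing by \<open>t\<^sup>2\<close> isolates the quadratic
  form.\<close>

lemma superjet_const_nonneg:
  assumes "superjet (\<lambda>y. k) z c C"
  shows "c = 0" "C h \<bullet> h \<ge> 0"
proof -
  have lin: "linear C" using assms by (rule superjet_linear)
  have *: "\<forall>\<^sub>F t in at_right 0. 0 \<le> t * (c \<bullet> h) + t\<^sup>2 * ((C h \<bullet> h) / 2 + \<eta> * (h \<bullet> h))"
    if "\<eta> > 0" for h \<eta>
  proof -
    have "filterlim (\<lambda>t. t *\<^sub>R h) (nhds 0) (at_right 0)"
      by (rule tendsto_eq_intros | simp)+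
    from filterlim_compose[OF _ this, unfolded filterlim_def] 
    have "\<forall>\<^sub>F t in at_right 0. k \<le> k + c \<bullet> (t *\<^sub>R h) + (C (t *\<^sub>R h) \<bullet> (t *\<^sub>R h)) / 2
        + \<eta> * ((t *\<^sub>R h) \<bullet> (t *\<^sub>R h))"
      using eventually_compose_filterlim[OF superjetD[OF assms that] \<open>filterlim (\<lambda>t. t *\<^sub>R h) (nhds 0) (at_right 0)\<close>]
      by simp
    then show ?thesis
      by eventually_elim (simp add: linear_cmul[OF lin] power2_eq_square algebra_simps)
  qed
  have pos: "\<forall>\<^sub>F t in at_right 0. (0::real) < t"
    by (simp add: eventually_at_filter)
  have **: "c \<bullet> h \<ge> 0" for h
  proof (rule tendsto_lowerbound)
    show "((\<lambda>t. c \<bullet> h + t * ((C h \<bullet> h) / 2 + 1 * (h \<bullet> h))) \<longlongrightarrow> c \<bullet> h) (at_right 0)"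
      by (rule tendsto_eq_intros | simp)+
    show "\<forall>\<^sub>F t in at_right 0. 0 \<le> c \<bullet> h + t * (C h \<bullet> h / 2 + 1 * (h \<bullet> h))"
      using *[OF zero_less_one, of h] pos
    proof eventually_elim
      case (elim t)
      then have "0 \<le> t * (c \<bullet> h + t * (C h \<bullet> h / 2 + 1 * (h \<bullet> h)))"
        by (simp add: algebra_simps power2_eq_square)
      then show ?case using elim(2) by (simp add: zero_le_mult_iff)
    qed
  qed simp
  from **[of "-c"] show c0: "c = 0"
    by (metis inner_ge_zero inner_minus_right inner_eq_zero_iff neg_0_le_iff_le order_antisym)
  show "C h \<bullet> h \<ge> 0"
  proof (rule field_le_epsilon)
    fix e :: real assume "e > 0"
    define \<eta> where "\<eta> = e / (2 * (h \<bullet> h + 1))"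
    have hp: "h \<bullet> h + 1 > 0" using inner_ge_zero[of h] by linarith
    then have \<eta>: "\<eta> > 0" using \<open>e > 0\<close> by (simp add: \<eta>_def)
    from eventually_happens[OF eventually_conj[OF *[OF \<eta>, of h] pos]]
    obtain t where t: "t > 0" "0 \<le> t\<^sup>2 * ((C h \<bullet> h) / 2 + \<eta> * (h \<bullet> h))" by (auto simp: c0)
    then have 1: "0 \<le> (C h \<bullet> h) / 2 + \<eta> * (h \<bullet> h)" by (simp add: zero_le_mult_iff)
    have "\<eta> * (h \<bullet> h) \<le> \<eta> * (h \<bullet> h + 1)" using \<eta> by simp
    also have "\<dots> = e / 2" using hp by (simp add: \<eta>_def field_simps)
    finally show "0 \<le> C h \<bullet> h + e" using 1 by simp
  qed
qed

text \<open>Subtracting the two-sided jet leaves a superjet of the constant 0. This is what makes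
  classical subsolutions viscosity subsolutions.\<close>

lemma jet2_superjet_compare:
  assumes "jet2 S z a A" "superjet S z a' A'"
  shows "a' = a" "A h \<bullet> h \<le> A' h \<bullet> h"
proof -
  have "superjet (\<lambda>y. S y + - S y) z (a' + - a) (\<lambda>h. A' h + - A h)"
    using assms by (intro superjet_add) (auto simp: jet2_def)
  then have *: "superjet (\<lambda>y. 0) z (a' + - a) (\<lambda>h. A' h + - A h)" by simp
  from superjet_const_nonneg(1)[OF *] show "a' = a" by simp
  from superjet_const_nonneg(2)[OF *] show "A h \<bullet> h \<le> A' h \<bullet> h"
    by (simp add: inner_diff_left)
qed

text \<open>Taylor's formula when the gradient is differentiable at the single point
  \<open>z\<close>: the remainder along the segment from \<open>z\<close> to \<open>z + h\<close> is
  a function of one variable whose derivative is at most \<open>\<eta> * (h \<bullet> h)\<close>,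
  and the mean value theorem concludes.\<close>

lemma superjet_gradient:
  fixes f :: "'b::real_inner \<Rightarrow> real"
  assumes f: "\<forall>\<^sub>F y in nhds z. (f has_derivative (\<lambda>h. F y \<bullet> h)) (at y)"
    and F: "(F has_derivative A) (at z)"
  shows "superjet f z (F z) A"
  unfolding superjet_def
proof (intro conjI allI impI)
  show lin: "linear A" using F by (rule has_derivative_linear)
  fix \<eta> :: real assume \<eta>: "\<eta> > 0"
  from f obtain d1 where d1: "d1 > 0" "\<And>y. dist y z < d1 \<Longrightarrow> (f has_derivative (\<lambda>h. F y \<bullet> h)) (at y)"
    unfolding eventually_nhds_metric by blast
  from F have "\<forall>e>0. \<exists>d>0. \<forall>y. norm (y - z) < d \<longrightarrow> norm (F y - F z - A (y - z)) \<le> e * norm (y - z)"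
    unfolding has_derivative_at_alt by blast
  with \<eta> obtain d2 where d2: "d2 > 0"
    "\<And>y. norm (y - z) < d2 \<Longrightarrow> norm (F y - F z - A (y - z)) \<le> \<eta> * norm (y - z)" by blast
  have "f (z + h) \<le> f z + F z \<bullet> h + (A h \<bullet> h) / 2 + \<eta> * (h \<bullet> h)" if h: "norm h < min d1 d2" for h
  proof -
    define g where "g t = f (z + t *\<^sub>R h) - t * (F z \<bullet> h) - t\<^sup>2 * (A h \<bullet> h) / 2" for t
    have bd: "norm (t *\<^sub>R h) < min d1 d2" if "0 \<le> t" "t \<le> 1" for t
    proof -
      have "norm (t *\<^sub>R h) \<le> 1 * norm h" using that by (simp add: mult_left_le_one_le)
      then show ?thesis using h by simp
    qed
    have der: "(g has_real_derivative (F (z + t *\<^sub>R h) \<bullet> h - F z \<bullet> h - t * (A h \<bullet> h))) (at t)"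
      if "0 \<le> t" "t \<le> 1" for t
    proof -
      have "(f has_derivative (\<lambda>k. F (z + t *\<^sub>R h) \<bullet> k)) (at (z + t *\<^sub>R h))"
        using bd[OF that] by (intro d1) (simp add: dist_norm)
      then have "((\<lambda>s. f (z + s *\<^sub>R h)) has_derivative (\<lambda>s. F (z + t *\<^sub>R h) \<bullet> (s *\<^sub>R h))) (at t)"
        by (rule has_derivative_compose[rotated]) (auto intro!: derivative_eq_intros)
      then have "((\<lambda>s. f (z + s *\<^sub>R h)) has_real_derivative (F (z + t *\<^sub>R h) \<bullet> h)) (at t)"
        unfolding has_field_derivative_def by (rule has_derivative_eq_rhs) (auto simp: fun_eq_iff)
      then show ?thesis
        unfolding g_def by (auto intro!: derivative_eq_intros)
    qed
    have "\<exists>t. 0 < t \<and> t < 1 \<and> g 1 - g 0 = (1 - 0) * (F (z + t *\<^sub>R h) \<bullet> h - F z \<bullet> h - t * (A h \<bullet> h))"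
      using der by (intro MVT2) auto
    then obtain t where t: "0 < t" "t < 1" "g 1 - g 0 = F (z + t *\<^sub>R h) \<bullet> h - F z \<bullet> h - t * (A h \<bullet> h)"
      by auto
    have "F (z + t *\<^sub>R h) \<bullet> h - F z \<bullet> h - t * (A h \<bullet> h) = (F (z + t *\<^sub>R h) - F z - A (t *\<^sub>R h)) \<bullet> h"
      by (simp add: inner_diff_left linear_cmul[OF lin])
    also have "\<dots> \<le> norm (F (z + t *\<^sub>R h) - F z - A (t *\<^sub>R h)) * norm h"
      by (rule norm_cauchy_schwarz)
    also have "\<dots> \<le> (\<eta> * norm (t *\<^sub>R h)) * norm h"
      using d2(2)[of "z + t *\<^sub>R h"] bd[of t] t by (intro mult_right_mono) auto
    also have "\<dots> = t * (\<eta> * (h \<bullet> h))" using t by (simp add: power2_norm_eq_inner[symmetric] power2_eq_square)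
    also have "\<dots> \<le> 1 * (\<eta> * (h \<bullet> h))" using t \<eta> by (intro mult_right_mono) auto
    finally have "g 1 - g 0 \<le> \<eta> * (h \<bullet> h)" using t by simp
    then show ?thesis by (simp add: g_def)
  qed
  then show "\<forall>\<^sub>F h in nhds 0. f (z + h) \<le> f z + F z \<bullet> h + (A h \<bullet> h) / 2 + \<eta> * (h \<bullet> h)"
    unfolding eventually_nhds_metric using d1(1) d2(1)
    by (intro exI[of _ "min d1 d2"]) (auto simp: dist_norm)
qed

lemma jet2_gradient:
  fixes f :: "'b::real_inner \<Rightarrow> real"
  assumes f: "\<forall>\<^sub>F y in nhds z. (f has_derivative (\<lambda>h. F y \<bullet> h)) (at y)"
    and F: "(F has_derivative A) (at z)"
  shows "jet2 f z (F z) A"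
proof -
  have "superjet (\<lambda>y. - f y) z (- F z) (\<lambda>h. - A h)"
  proof (rule superjet_gradient[where F = "\<lambda>y. - F y"])
    show "\<forall>\<^sub>F y in nhds z. ((\<lambda>y. - f y) has_derivative (\<lambda>h. - F y \<bullet> h)) (at y)"
      using f by eventually_elim (auto intro!: derivative_eq_intros)
    show "((\<lambda>y. - F y) has_derivative (\<lambda>h. - A h)) (at z)"
      using F by (auto intro!: derivative_eq_intros)
  qed
  then show ?thesis using superjet_gradient[OF f F] by (simp add: jet2_def)
qed

text \<open>\<open>Ck_on\<close> speaks of directional derivatives; collecting them over the basis
  gives a gradient field, which two levels of the recursion make differentiable.\<close>

lemma smooth_on_jet2:
  fixes f :: "'b::euclidean_space \<Rightarrow> real"
  assumes "open S" "z \<in> S" "smooth_on S f"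
  shows "\<exists>F A. (\<forall>y\<in>S. (f has_derivative (\<lambda>h. F y \<bullet> h)) (at y)) \<and>
    (F has_derivative A) (at z) \<and> jet2 f z (F z) A"
proof -
  define F where "F y = (\<Sum>b\<in>Basis. frechet_derivative f (at y) b *\<^sub>R b)" for y
  have C: "Ck_on (Suc (Suc 0)) S f" using assms by (auto simp: smooth_on_def)
  have fd: "(f has_derivative (\<lambda>h. F y \<bullet> h)) (at y)" if "y \<in> S" for y
  proof -
    have *: "(f has_derivative frechet_derivative f (at y)) (at y)"
      using C that by (auto simp: frechet_derivative_works)
    have lin: "linear (frechet_derivative f (at y))" using * by (rule has_derivative_linear)
    have "frechet_derivative f (at y) h = F y \<bullet> h" for h
    proof -
      have "frechet_derivative f (at y) h = frechet_derivative f (at y) (\<Sum>b\<in>Basis. (h \<bullet> b) *\<^sub>R b)"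
        by (simp add: euclidean_representation)
      also have "\<dots> = F y \<bullet> h"
        by (simp add: linear_sum[OF lin] linear_cmul[OF lin] F_def inner_sum_left inner_sum_right inner_commute mult.commute)
      finally show ?thesis .
    qed
    then have "frechet_derivative f (at y) = (\<lambda>h. F y \<bullet> h)" by (rule ext)
    with * show ?thesis by simp
  qed
  have "(\<lambda>y. frechet_derivative f (at y) b) differentiable (at z)" for b
    using C \<open>z \<in> S\<close> by simp
  then have "F differentiable (at z)"
    unfolding F_def[abs_def]
    by (intro differentiable_sum ballI differentiable_scaleR differentiable_const) auto
  then obtain A where A: "(F has_derivative A) (at z)" unfolding differentiable_def by blast
  have "\<forall>\<^sub>F y in nhds z. (f has_derivative (\<lambda>h. F y \<bullet> h)) (at y)"
    using eventually_nhds_in_open[OF assms(1,2)] by eventually_elim (rule fd)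
  from jet2_gradient[OF this A] fd A show ?thesis by blast
qed

section \<open>Quadratic polynomials as test functions\<close>

lemma Ck_on_const: "Ck_on k S (\<lambda>x. c)"
proof (induction k arbitrary: c)
  case (Suc k) then show ?case by (simp add: frechet_derivative_const)
qed simp

lemma Ck_on_affine:
  fixes d :: "'b::real_inner"
  shows "Ck_on k S (\<lambda>x. c + d \<bullet> x)"
proof (cases k)
  case (Suc m)
  have D: "((\<lambda>x. c + d \<bullet> x) has_derivative (\<lambda>h. d \<bullet> h)) (at x)" for x
    by (auto intro!: derivative_eq_intros)
  have "frechet_derivative (\<lambda>x. c + d \<bullet> x) (at x) = (\<lambda>h. d \<bullet> h)" for x
    using frechet_derivative_at[OF D] by simp
  with D show ?thesis by (auto simp: Suc Ck_on_const differentiable_def)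
qed (auto intro!: continuous_intros)

lemma quadratic_has_derivative:
  fixes A :: "'b::euclidean_space \<Rightarrow> 'b"
  assumes "linear A"
  shows "((\<lambda>x. c + a \<bullet> (x - z) + (A (x - z) \<bullet> (x - z)) / 2) has_derivative
    (\<lambda>h. (a + (1/2) *\<^sub>R (A (x - z) + adjoint A (x - z))) \<bullet> h)) (at x)"
proof -
  have bl: "bounded_linear A" using assms by (simp add: linear_conv_bounded_linear)
  have id: "((\<lambda>x. x - z) has_derivative (\<lambda>h. h)) (at x)"
    by (auto intro!: derivative_eq_intros)
  have A: "((\<lambda>x. A (x - z)) has_derivative A) (at x)"
    using bounded_linear.has_derivative[OF bl id] by simp
  have "((\<lambda>x. c + a \<bullet> (x - z) + (A (x - z) \<bullet> (x - z)) / 2) has_derivative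
      (\<lambda>h. 0 + a \<bullet> h + (A (x - z) \<bullet> h + A h \<bullet> (x - z)) / 2)) (at x)"
    using has_derivative_mult_left[OF has_derivative_inner[OF A id], of "1/2"]
    by (intro has_derivative_add has_derivative_const has_derivative_inner_right id) simp
  moreover have "A h \<bullet> (x - z) = adjoint A (x - z) \<bullet> h" for h
    using adjoint_works[OF assms, of h "x - z"] by (simp add: inner_commute)
  ultimately show ?thesis
    by (elim has_derivative_eq_rhs) (simp add: fun_eq_iff inner_add_left)
qed

text \<open>Directional derivatives of a quadratic are affine and those of an affine function are
  constant, so the recursion of \<open>Ck_on\<close> closes at once. Quadratics are the only test
  functions that ever have to be exhibited.\<close>

lemma smooth_on_quadratic:
  fixes A :: "'b::euclidean_space \<Rightarrow> 'b"
  assumes "linear A"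
  shows "smooth_on S (\<lambda>x. c + a \<bullet> (x - z) + (A (x - z) \<bullet> (x - z)) / 2)"
  unfolding smooth_on_def
proof
  fix k
  let ?f = "\<lambda>x. c + a \<bullet> (x - z) + (A (x - z) \<bullet> (x - z)) / 2"
  note D = quadratic_has_derivative[OF assms, of c a z]
  have lin: "linear (adjoint A)" by (rule adjoint_linear[OF assms])
  show "Ck_on k S ?f"
  proof (cases k)
    case 0
    have "continuous_on S ?f"
      using has_derivative_continuous[OF D] by (intro continuous_at_imp_continuous_on ballI)
    with 0 show ?thesis by simp
  next
    case (Suc m)
    have "frechet_derivative ?f (at x) v =
        (a \<bullet> v - (z \<bullet> (1/2) *\<^sub>R (adjoint A v + A v))) + ((1/2) *\<^sub>R (adjoint A v + A v)) \<bullet> x" for x v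
    proof -
      have "frechet_derivative ?f (at x) v = (a + (1/2) *\<^sub>R (A (x - z) + adjoint A (x - z))) \<bullet> v"
        using frechet_derivative_at[OF D, of x, symmetric] by simp
      also have "\<dots> = a \<bullet> v + (1/2) * ((x - z) \<bullet> (adjoint A v + A v))"
        by (simp add: inner_add_left inner_add_right adjoint_clauses[OF assms])
      also have "\<dots> = (a \<bullet> v - (z \<bullet> (1/2) *\<^sub>R (adjoint A v + A v))) + ((1/2) *\<^sub>R (adjoint A v + A v)) \<bullet> x"
        by (simp add: inner_diff_left inner_diff_right inner_commute algebra_simps)
      finally show ?thesis .
    qed
    then have "Ck_on m S (\<lambda>x. frechet_derivative ?f (at x) v)" for v
      by (simp only: Ck_on_affine)
    with D show ?thesis by (auto simp: Suc differentiable_def)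
  qed
qed

text \<open>\<open>A\<close> is not assumed symmetric, so the Hessian is its symmetrization; both
  have the same diagonal entries and hence the same trace.\<close>

lemma jet2_quadratic:
  fixes A :: "'b::euclidean_space \<Rightarrow> 'b"
  assumes "linear A"
  shows "jet2 (\<lambda>x. c + a \<bullet> (x - z) + (A (x - z) \<bullet> (x - z)) / 2) y
    (a + (1/2) *\<^sub>R (A (y - z) + adjoint A (y - z))) (\<lambda>h. (1/2) *\<^sub>R (A h + adjoint A h))"
proof (rule jet2_gradient[where F = "\<lambda>x. a + (1/2) *\<^sub>R (A (x - z) + adjoint A (x - z))"])
  show "\<forall>\<^sub>F y in nhds y. ((\<lambda>x. c + a \<bullet> (x - z) + A (x - z) \<bullet> (x - z) / 2) has_derivative
      (\<bullet>) (a + (1 / 2) *\<^sub>R (A (y - z) + adjoint A (y - z)))) (at y)"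
    using quadratic_has_derivative[OF assms] by (intro always_eventually) auto
  have bl: "bounded_linear A" "bounded_linear (adjoint A)"
    using assms adjoint_linear[OF assms] by (simp_all add: linear_conv_bounded_linear)
  have id: "((\<lambda>x. x - z) has_derivative (\<lambda>h. h)) (at y)"
    by (auto intro!: derivative_eq_intros)
  have "((\<lambda>x. a + (1 / 2) *\<^sub>R (A (x - z) + adjoint A (x - z))) has_derivative
     (\<lambda>h. 0 + (1 / 2) *\<^sub>R (A h + adjoint A h))) (at y)"
    by (intro has_derivative_add has_derivative_const has_derivative_scaleR_right
        bounded_linear.has_derivative[OF bl(1) id] bounded_linear.has_derivative[OF bl(2) id])
  then show "((\<lambda>x. a + (1 / 2) *\<^sub>R (A (x - z) + adjoint A (x - z))) has_derivative
     (\<lambda>h. (1 / 2) *\<^sub>R (A h + adjoint A h))) (at y)" by simp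
qed

lemma eventually_nhds_shift:
  fixes z :: "'b::real_normed_vector"
  shows "(\<forall>\<^sub>F h in nhds 0. P (z + h)) \<longleftrightarrow> (\<forall>\<^sub>F y in nhds z. P y)"
proof -
  have "filtermap (\<lambda>x. x - (- z)) (nhds 0) = nhds (0 - (- z))" by (rule filtermap_nhds_shift)
  then have "nhds z = filtermap (\<lambda>h. z + h) (nhds 0)" by (simp add: add.commute)
  then show ?thesis by (simp add: eventually_filtermap)
qed

lemma local_max_on_open:
  fixes z :: "'b::real_normed_vector"
  assumes "open S" "z \<in> S"
  shows "local_max_on S f z \<longleftrightarrow> (\<forall>\<^sub>F h in nhds 0. f (z + h) \<le> f z)"
proof -
  have "(\<forall>\<^sub>F y in at z within S. f y \<le> f z) \<longleftrightarrow> (\<forall>\<^sub>F y in nhds z. f y \<le> f z)"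
    unfolding at_within_open[OF assms(2,1)] eventually_at_filter
    by (intro arg_cong2[where f = eventually] ext refl) auto
  then show ?thesis
    using assms(2) eventually_nhds_shift[of "\<lambda>y. f y \<le> f z" z] by (simp add: local_max_on_def)
qed

lemma local_min_on_open:
  fixes z :: "'b::real_normed_vector"
  assumes "open S" "z \<in> S"
  shows "local_min_on S f z \<longleftrightarrow> (\<forall>\<^sub>F h in nhds 0. f z \<le> f (z + h))"
proof -
  have "(\<forall>\<^sub>F y in at z within S. f z \<le> f y) \<longleftrightarrow> (\<forall>\<^sub>F y in nhds z. f z \<le> f y)"
    unfolding at_within_open[OF assms(2,1)] eventually_at_filter
    by (intro arg_cong2[where f = eventually] ext refl) auto
  then show ?thesis
    using assms(2) eventually_nhds_shift[of "\<lambda>y. f z \<le> f y" z] by (simp add: local_min_on_def)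
qed

section \<open>Viscosity solutions and superjets\<close>

text \<open>Only spatial directions enter: for the Hessian of a function of space and time this is
  the Laplacian in space.\<close>

definition space_trace :: "('a::euclidean_space \<times> real \<Rightarrow> 'a \<times> real) \<Rightarrow> real" where
  "space_trace A = (\<Sum>i\<in>Basis. A (i, 0) \<bullet> (i, 0))"

text \<open>Superjets make the notion local: it makes sense on any set \<open>U\<close>, whereas
  \<open>parabolic_viscosity\<close> tests with functions smooth on the whole cylinder.\<close>

definition subsol ::
    "(real \<Rightarrow> real \<Rightarrow> real) \<Rightarrow> ('a::euclidean_space \<times> real) set \<Rightarrow> ('a \<times> real \<Rightarrow> real) \<Rightarrow> bool" where
  "subsol F U v \<longleftrightarrow> (\<forall>z\<in>U. \<forall>a A. superjet v z a A \<longrightarrow> F (snd a) (space_trace A) \<le> 0)"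

text \<open>
  A function \<open>v\<close> is a supersolution for \<open>F\<close> if \<open>-v\<close> is a subsolution for \<open>negF F\<close>, so supersolutions
  need no definition of their own.
\<close>

definition negF :: "(real \<Rightarrow> real \<Rightarrow> real) \<Rightarrow> real \<Rightarrow> real \<Rightarrow> real" where
  "negF F p l = - F (- p) (- l)"

lemma negF_negF [simp]: "negF (negF F) = F"
  by (simp add: negF_def fun_eq_iff)

lemma space_trace_add: "space_trace (\<lambda>h. A h + C h) = space_trace A + space_trace C"
  by (simp add: space_trace_def inner_add_left sum.distrib del: inner_Pair)

lemma space_trace_uminus: "space_trace (\<lambda>h. - A h) = - space_trace A"
  by (simp add: space_trace_def sum_negf del: inner_Pair)


lemma space_trace_mono: "(\<And>h. A h \<bullet> h \<le> C h \<bullet> h) \<Longrightarrow> space_trace A \<le> space_trace C"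
  unfolding space_trace_def by (rule sum_mono) blast

lemma space_trace_scale: "space_trace (\<lambda>h :: 'a::euclidean_space \<times> real. c *\<^sub>R h) = c * real DIM('a)"
  by (simp add: space_trace_def)

lemma line_derivs:
  fixes f :: "'b::real_inner \<Rightarrow> real"
  assumes S: "open S" "z \<in> S"
    and f: "\<And>y. y \<in> S \<Longrightarrow> (f has_derivative (\<lambda>h. F y \<bullet> h)) (at y)"
    and F: "(F has_derivative A) (at z)"
  shows "deriv (\<lambda>s. f (z + s *\<^sub>R d)) 0 = F z \<bullet> d"
    "(deriv ^^ 2) (\<lambda>s. f (z + s *\<^sub>R d)) 0 = A d \<bullet> d"
proof -
  let ?L = "\<lambda>s. z + s *\<^sub>R d"
  have D: "((\<lambda>s. f (?L s)) has_field_derivative (F (?L s) \<bullet> d)) (at s)" if "?L s \<in> S" for s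
  proof -
    have "((\<lambda>s. f (?L s)) has_derivative (\<lambda>k. F (?L s) \<bullet> (k *\<^sub>R d))) (at s)"
    proof (rule has_derivative_compose[where f = ?L and g = f and f' = "\<lambda>k. k *\<^sub>R d"])
      show "(?L has_derivative (\<lambda>k. k *\<^sub>R d)) (at s)" by (auto intro!: derivative_eq_intros)
    qed (rule f[OF that])
    then show ?thesis
      unfolding has_field_derivative_def by (rule has_derivative_eq_rhs) (auto simp: fun_eq_iff)
  qed
  then have D': "deriv (\<lambda>s. f (?L s)) s = F (?L s) \<bullet> d" if "?L s \<in> S" for s
    using that by (intro DERIV_imp_deriv)
  from D'[of 0] S show "deriv (\<lambda>s. f (z + s *\<^sub>R d)) 0 = F z \<bullet> d" by simp
  have op: "open (?L -` S)"
    by (intro open_vimage continuous_intros S)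
  have "((\<lambda>s. F (?L s)) has_derivative (\<lambda>k. A (k *\<^sub>R d))) (at 0)"
  proof (rule has_derivative_compose[where f = ?L and g = F and g' = A and f' = "\<lambda>k. k *\<^sub>R d"])
    show "(?L has_derivative (\<lambda>k. k *\<^sub>R d)) (at 0)" by (auto intro!: derivative_eq_intros)
    show "(F has_derivative A) (at (?L 0))" using F by simp
  qed
  from has_derivative_inner_left[OF this, of d]
  have "((\<lambda>s. F (?L s) \<bullet> d) has_field_derivative (A d \<bullet> d)) (at 0)"
    unfolding has_field_derivative_def
    by (rule has_derivative_eq_rhs) (simp add: fun_eq_iff linear_cmul[OF has_derivative_linear[OF F]])
  then have "(deriv (\<lambda>s. f (?L s)) has_field_derivative (A d \<bullet> d)) (at 0)"
    by (rule has_field_derivative_transform_within_open[OF _ op]) (use S D' in auto)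
  then show "(deriv ^^ 2) (\<lambda>s. f (z + s *\<^sub>R d)) 0 = A d \<bullet> d"
    by (simp add: numeral_2_eq_2 DERIV_imp_deriv)
qed

text \<open>Connects the iterated one-variable \<open>deriv\<close> of the definitions with a
  gradient field and its derivative, the language of jets.\<close>

lemma space_time_derivs:
  fixes f :: "'a::euclidean_space \<times> real \<Rightarrow> real"
  assumes S: "open S" "z \<in> S"
    and f: "\<And>y. y \<in> S \<Longrightarrow> (f has_derivative (\<lambda>h. F y \<bullet> h)) (at y)"
    and F: "(F has_derivative A) (at z)"
  shows "time_deriv f z = snd (F z)" "space_laplacian f z = space_trace A"
proof -
  have "((\<lambda>s. f (fst z, s)) has_derivative (\<lambda>k. F z \<bullet> (0, k))) (at (snd z))"
  proof (rule has_derivative_compose[where g = f])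
    show "(Pair (fst z) has_derivative Pair 0) (at (snd z))"
      by (auto intro!: derivative_eq_intros)
    show "(f has_derivative (\<bullet>) (F z)) (at (fst z, snd z))" using f S by simp
  qed
  then have "((\<lambda>s. f (fst z, s)) has_field_derivative snd (F z)) (at (snd z))"
    unfolding has_field_derivative_def by (rule has_derivative_eq_rhs) (auto simp: fun_eq_iff inner_prod_def)
  then show "time_deriv f z = snd (F z)" unfolding time_deriv_def by (rule DERIV_imp_deriv)
  have "(deriv ^^ 2) (\<lambda>s. f (fst z + s *\<^sub>R i, snd z)) 0 = A (i, 0) \<bullet> (i, 0)" for i
    using line_derivs(2)[OF S f F, of "(i, 0)"] by (cases z) simp
  then show "space_laplacian f z = space_trace A"
    by (simp add: space_laplacian_def laplacian_def space_trace_def del: inner_Pair)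
qed

lemma quadratic_space_time:
  fixes A :: "'a::euclidean_space \<times> real \<Rightarrow> 'a \<times> real" and c :: real and a z :: "'a \<times> real"
  assumes "linear A"
  defines "q \<equiv> \<lambda>x. c + a \<bullet> (x - z) + (A (x - z) \<bullet> (x - z)) / 2"
  shows "time_deriv q z = snd a" "space_laplacian q z = space_trace A"
proof -
  have bl: "bounded_linear A" "bounded_linear (adjoint A)"
    using assms adjoint_linear[OF assms(1)] by (simp_all add: linear_conv_bounded_linear)
  have id: "((\<lambda>x. x - z) has_derivative (\<lambda>h. h)) (at z)"
    by (auto intro!: derivative_eq_intros)
  have F: "((\<lambda>x. a + (1 / 2) *\<^sub>R (A (x - z) + adjoint A (x - z))) has_derivative
     (\<lambda>h. 0 + (1 / 2) *\<^sub>R (A h + adjoint A h))) (at z)"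
    by (intro has_derivative_add has_derivative_const has_derivative_scaleR_right
        bounded_linear.has_derivative[OF bl(1) id] bounded_linear.has_derivative[OF bl(2) id])
  have f: "(q has_derivative (\<lambda>h. (a + (1 / 2) *\<^sub>R (A (x - z) + adjoint A (x - z))) \<bullet> h)) (at x)" for x
    unfolding q_def by (rule quadratic_has_derivative[OF assms(1)])
  note D = space_time_derivs[OF open_UNIV UNIV_I f F]
  show "time_deriv q z = snd a"
    using D(1) by (simp add: linear_0[OF assms(1)] linear_0[OF adjoint_linear[OF assms(1)]])
  have "adjoint A (i, 0) \<bullet> (i, 0) = A (i, 0) \<bullet> (i, 0)" for i
    using adjoint_works[OF assms(1), of "(i, 0)" "(i, 0)"] by (simp add: inner_commute del: inner_Pair)
  then show "space_laplacian q z = space_trace A"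
    using D(2) by (simp add: space_trace_def inner_add_left del: inner_Pair)
qed

text \<open>Enlarging the quadratic form by \<open>2 * \<eta>\<close> absorbs the remainder, so that
  a genuine quadratic polynomial touches from above.\<close>

lemma superjet_quadratic_above:
  fixes u :: "'b::euclidean_space \<Rightarrow> real"
  assumes "superjet u z a A" "\<eta> > 0"
  shows "\<forall>\<^sub>F h in nhds 0. u (z + h) \<le> u z + a \<bullet> h + ((A h + (2 * \<eta>) *\<^sub>R h) \<bullet> h) / 2"
  using superjetD[OF assms] by eventually_elim (simp add: inner_add_left field_simps)

lemma parabolic_viscosity_touch_above:
  fixes u :: "'a::euclidean_space \<times> real \<Rightarrow> real"
  assumes \<Omega>: "open \<Omega>" and u: "parabolic_viscosity F \<Omega> u" and z: "z \<in> \<Omega> \<times> {0<..}" and A: "linear A"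
    and touch: "\<forall>\<^sub>F h in nhds 0. u (z + h) \<le> u z + a \<bullet> h + (A h \<bullet> h) / 2"
  shows "F (snd a) (space_trace A) \<le> 0"
proof -
  define q where "q x = u z + a \<bullet> (x - z) + (A (x - z) \<bullet> (x - z)) / 2" for x
  have S: "open (\<Omega> \<times> {0::real<..})" using \<Omega> by (intro open_Times) auto
  have "local_max_on (\<Omega> \<times> {0<..}) (\<lambda>y. u y - q y) z"
    unfolding local_max_on_open[OF S z] using touch
    by eventually_elim (simp add: q_def linear_0[OF A])
  moreover have "smooth_on (\<Omega> \<times> {0<..}) q"
    unfolding q_def by (rule smooth_on_quadratic[OF A])
  ultimately have "F (time_deriv q z) (space_laplacian q z) \<le> 0"
    using u unfolding parabolic_viscosity_def by blast
  then show ?thesis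
    using quadratic_space_time[OF A, of "u z" a z] by (simp add: q_def[abs_def])
qed

lemma parabolic_viscosity_touch_below:
  fixes u :: "'a::euclidean_space \<times> real \<Rightarrow> real"
  assumes \<Omega>: "open \<Omega>" and u: "parabolic_viscosity F \<Omega> u" and z: "z \<in> \<Omega> \<times> {0<..}" and A: "linear A"
    and touch: "\<forall>\<^sub>F h in nhds 0. u (z + h) \<ge> u z + a \<bullet> h + (A h \<bullet> h) / 2"
  shows "F (snd a) (space_trace A) \<ge> 0"
proof -
  define q where "q x = u z + a \<bullet> (x - z) + (A (x - z) \<bullet> (x - z)) / 2" for x
  have S: "open (\<Omega> \<times> {0::real<..})" using \<Omega> by (intro open_Times) auto
  have "local_min_on (\<Omega> \<times> {0<..}) (\<lambda>y. u y - q y) z"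
    unfolding local_min_on_open[OF S z] using touch
    by eventually_elim (simp add: q_def linear_0[OF A])
  moreover have "smooth_on (\<Omega> \<times> {0<..}) q"
    unfolding q_def by (rule smooth_on_quadratic[OF A])
  ultimately have "F (time_deriv q z) (space_laplacian q z) \<ge> 0"
    using u unfolding parabolic_viscosity_def by blast
  then show ?thesis
    using quadratic_space_time[OF A, of "u z" a z] by (simp add: q_def[abs_def])
qed

lemma space_trace_perturb: "space_trace (\<lambda>h :: 'a::euclidean_space \<times> real. A h + c *\<^sub>R h) = space_trace A + c * real DIM('a)"
  by (simp only: space_trace_add space_trace_scale)

lemma linear_perturb: "linear A \<Longrightarrow> linear (\<lambda>h. A h + c *\<^sub>R h)"
  by (intro linear_compose_add linear_compose_scale_right linear_id) (auto simp: linear_id[unfolded id_def])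

text \<open>The enlarged quadratic keeps the time slope, and its Laplacian exceeds the trace by a
  multiple of \<eta>; continuity of \<open>F\<close> in its second argument therefore lets \<eta>
  tend to 0.\<close>

lemma parabolic_viscosity_subsol:
  fixes u :: "'a::euclidean_space \<times> real \<Rightarrow> real"
  assumes \<Omega>: "open \<Omega>" and u: "parabolic_viscosity F \<Omega> u" and cont: "\<And>p. continuous_on UNIV (F p)"
  shows "subsol F (\<Omega> \<times> {0<..}) u"
  unfolding subsol_def
proof (intro ballI allI impI)
  fix z a A assume z: "z \<in> \<Omega> \<times> {0<..}" and sj: "superjet u z a A"
  have A: "linear A" using sj by (rule superjet_linear)
  show "F (snd a) (space_trace A) \<le> 0"
  proof (rule tendsto_upperbound)
    have "isCont (F (snd a)) (space_trace A)" using cont by (simp add: continuous_on_eq_continuous_at)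
    moreover have "((\<lambda>\<eta>. space_trace A + 2 * \<eta> * real DIM('a)) \<longlongrightarrow> space_trace A) (at_right 0)"
      by (rule tendsto_eq_intros | simp)+
    ultimately show "((\<lambda>\<eta>. F (snd a) (space_trace A + 2 * \<eta> * real DIM('a))) \<longlongrightarrow> F (snd a) (space_trace A)) (at_right 0)"
      by (rule isCont_tendsto_compose)
    show "\<forall>\<^sub>F \<eta> in at_right 0. F (snd a) (space_trace A + 2 * \<eta> * real DIM('a)) \<le> 0"
      unfolding eventually_at_filter
    proof (intro always_eventually allI impI)
      fix \<eta> :: real assume "\<eta> \<noteq> 0" "\<eta> \<in> {0<..}"
      then have "\<eta> > 0" by simp
      from parabolic_viscosity_touch_above[OF \<Omega> u z linear_perturb[OF A] superjet_quadratic_above[OF sj this]]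
      show "F (snd a) (space_trace A + 2 * \<eta> * real DIM('a)) \<le> 0" by (simp add: space_trace_perturb)
    qed
  qed simp
qed

lemma parabolic_viscosity_supersol:
  fixes u :: "'a::euclidean_space \<times> real \<Rightarrow> real"
  assumes \<Omega>: "open \<Omega>" and u: "parabolic_viscosity F \<Omega> u" and cont: "\<And>p. continuous_on UNIV (F p)"
  shows "subsol (negF F) (\<Omega> \<times> {0<..}) (\<lambda>z. - u z)"
  unfolding subsol_def
proof (intro ballI allI impI)
  fix z a A assume z: "z \<in> \<Omega> \<times> {0<..}" and sj: "superjet (\<lambda>z. - u z) z a A"
  have A: "linear A" using sj by (rule superjet_linear)
  have "F (- snd a) (- space_trace A) \<ge> 0"
  proof (rule tendsto_lowerbound)
    have "isCont (F (- snd a)) (- space_trace A)" using cont by (simp add: continuous_on_eq_continuous_at)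
    moreover have "((\<lambda>\<eta>. - (space_trace A + 2 * \<eta> * real DIM('a))) \<longlongrightarrow> - space_trace A) (at_right 0)"
      by (rule tendsto_eq_intros | simp)+
    ultimately show "((\<lambda>\<eta>. F (- snd a) (- (space_trace A + 2 * \<eta> * real DIM('a)))) \<longlongrightarrow> F (- snd a) (- space_trace A)) (at_right 0)"
      by (rule isCont_tendsto_compose)
    show "\<forall>\<^sub>F \<eta> in at_right 0. 0 \<le> F (- snd a) (- (space_trace A + 2 * \<eta> * real DIM('a)))"
      unfolding eventually_at_filter
    proof (intro always_eventually allI impI)
      fix \<eta> :: real assume "\<eta> \<noteq> 0" "\<eta> \<in> {0<..}"
      then have "\<eta> > 0" by simp
      let ?B = "\<lambda>h. - (A h + (2 * \<eta>) *\<^sub>R h)"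
      have "\<forall>\<^sub>F h in nhds 0. u (z + h) \<ge> u z + (- a) \<bullet> h + (?B h \<bullet> h) / 2"
        using superjet_quadratic_above[OF sj \<open>\<eta> > 0\<close>]
        by eventually_elim (auto simp: inner_add_left algebra_simps add_divide_distrib diff_divide_distrib)
      from parabolic_viscosity_touch_below[OF \<Omega> u z _ this] linear_compose_neg[OF linear_perturb[OF A]]
      have "F (snd (- a)) (space_trace ?B) \<ge> 0" by blast
      then show "0 \<le> F (- snd a) (- (space_trace A + 2 * \<eta> * real DIM('a)))"
        by (simp only: space_trace_perturb space_trace_uminus snd_uminus)
    qed
  qed simp
  then show "negF F (snd a) (space_trace A) \<le> 0" by (simp add: negF_def)
qed

text \<open>The converse passage: a smooth test function has a two-sided second-order expansion at
  the touching point, which \<open>superjet_touch\<close> turns into a superjet of the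
  solution.\<close>

lemma parabolic_viscosityI:
  fixes u :: "'a::euclidean_space \<times> real \<Rightarrow> real"
  assumes \<Omega>: "open \<Omega>" and sub: "subsol F (\<Omega> \<times> {0<..}) u"
    and sup: "subsol (negF F) (\<Omega> \<times> {0<..}) (\<lambda>z. - u z)"
  shows "parabolic_viscosity F \<Omega> u"
  unfolding parabolic_viscosity_def
proof (intro allI impI conjI)
  fix \<phi> :: "'a \<times> real \<Rightarrow> real" and z
  assume \<phi>: "smooth_on (\<Omega> \<times> {0<..}) \<phi>"
  have S: "open (\<Omega> \<times> {0::real<..})" using \<Omega> by (intro open_Times) auto
  {
    assume max: "local_max_on (\<Omega> \<times> {0<..}) (\<lambda>y. u y - \<phi> y) z"
    then have z: "z \<in> \<Omega> \<times> {0<..}" by (simp add: local_max_on_def)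
    obtain G A where G: "\<And>y. y \<in> \<Omega> \<times> {0<..} \<Longrightarrow> (\<phi> has_derivative (\<lambda>h. G y \<bullet> h)) (at y)"
      "(G has_derivative A) (at z)" "jet2 \<phi> z (G z) A" using smooth_on_jet2[OF S z \<phi>] by blast
    have "superjet u z (G z) A"
      by (rule superjet_touch[OF jet2_superjet[OF G(3)] max[unfolded local_max_on_open[OF S z]]])
    with sub z have "F (snd (G z)) (space_trace A) \<le> 0" unfolding subsol_def by blast
    then show "F (time_deriv \<phi> z) (space_laplacian \<phi> z) \<le> 0"
      using space_time_derivs[OF S z G(1,2)] by simp
  }
  {
    assume min: "local_min_on (\<Omega> \<times> {0<..}) (\<lambda>y. u y - \<phi> y) z"
    then have z: "z \<in> \<Omega> \<times> {0<..}" by (simp add: local_min_on_def)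
    obtain G A where G: "\<And>y. y \<in> \<Omega> \<times> {0<..} \<Longrightarrow> (\<phi> has_derivative (\<lambda>h. G y \<bullet> h)) (at y)"
      "(G has_derivative A) (at z)" "jet2 \<phi> z (G z) A" using smooth_on_jet2[OF S z \<phi>] by blast
    have "superjet (\<lambda>z. - u z) z (- G z) (\<lambda>h. - A h)"
    proof (rule superjet_touch[OF jet2_superjet[OF jet2_minus[OF G(3)]]])
      show "\<forall>\<^sub>F h in nhds 0. - u (z + h) - - \<phi> (z + h) \<le> - u z - - \<phi> z"
        using min[unfolded local_min_on_open[OF S z]] by eventually_elim simp
    qed
    with sup z have "negF F (snd (- G z)) (space_trace (\<lambda>h. - A h)) \<le> 0" unfolding subsol_def by blast
    then show "F (time_deriv \<phi> z) (space_laplacian \<phi> z) \<ge> 0"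
      using space_time_derivs[OF S z G(1,2)] by (simp add: negF_def space_trace_uminus)
  }
qed

section \<open>The maximum principle\<close>

lemma usc_subset: "upper_semicontinuous_on S f \<Longrightarrow> T \<subseteq> S \<Longrightarrow> upper_semicontinuous_on T f"
  unfolding upper_semicontinuous_on_def by (meson eventually_at_filter filter_leD at_le in_mono)

lemma continuous_imp_usc: "continuous_on S f \<Longrightarrow> upper_semicontinuous_on S f"
  unfolding upper_semicontinuous_on_def continuous_on_def by (auto intro: order_tendstoD(2))

lemma usc_add:
  assumes "upper_semicontinuous_on S f" "upper_semicontinuous_on S g"
  shows "upper_semicontinuous_on S (\<lambda>x. f x + g x)"
  unfolding upper_semicontinuous_on_def
proof (intro ballI allI impI)
  fix x a assume x: "x \<in> S" and a: "a > f x + g x"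
  define e where "e = (a - f x - g x) / 2"
  have e: "e > 0" using a by (simp add: e_def)
  have "\<forall>\<^sub>F y in at x within S. f y < f x + e" "\<forall>\<^sub>F y in at x within S. g y < g x + e"
    using assms x e unfolding upper_semicontinuous_on_def by auto
  then show "\<forall>\<^sub>F y in at x within S. f y + g y < a"
    by eventually_elim (simp add: e_def field_simps)
qed

lemma usc_openin:
  assumes "upper_semicontinuous_on S f"
  shows "openin (top_of_set S) {x\<in>S. f x < a}"
proof (subst openin_subopen, intro ballI)
  fix x assume "x \<in> {x\<in>S. f x < a}"
  then have x: "x \<in> S" "f x < a" by auto
  with assms have "\<forall>\<^sub>F y in at x within S. f y < a" by (auto simp: upper_semicontinuous_on_def)
  then obtain T where T: "open T" "x \<in> T" "\<forall>y\<in>T. y \<noteq> x \<longrightarrow> y \<in> S \<longrightarrow> f y < a"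
    unfolding eventually_at_topological by blast
  have "openin (top_of_set S) (S \<inter> T)" using T(1) by (rule openin_open_Int)
  moreover have "x \<in> S \<inter> T" "S \<inter> T \<subseteq> {x\<in>S. f x < a}" using x T by auto
  ultimately show "\<exists>T. openin (top_of_set S) T \<and> x \<in> T \<and> T \<subseteq> {x\<in>S. f x < a}" by blast
qed

lemma usc_closed_superlevel:
  assumes "upper_semicontinuous_on S f" "closed S"
  shows "closed {x\<in>S. f x \<ge> a}"
proof -
  have "closedin (top_of_set S) (S - {x\<in>S. f x < a})"
    using usc_openin[OF assms(1), of a] by (auto simp: closedin_def Diff_Diff_Int Int_absorb1)
  moreover have "S - {x\<in>S. f x < a} = {x\<in>S. f x \<ge> a}" by auto
  ultimately show ?thesis using closedin_closed_trans[OF _ assms(2)] by metis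
qed

text \<open>If there were no maximum, the relatively open sets \<open>{z\<in>K. f z < f y}\<close>
  would cover \<open>K\<close>; among the finitely many \<open>y\<close> of a subcover, the one with
  the largest value lies in none of its sets.\<close>

lemma usc_attains_max:
  assumes "compact K" "K \<noteq> {}" "upper_semicontinuous_on K f"
  obtains z where "z \<in> K" "\<And>y. y \<in> K \<Longrightarrow> f y \<le> f z"
proof (rule ccontr)
  note max = that
  assume no: "\<not> thesis"
  have ex: "\<exists>y\<in>K. f z < f y" if "z \<in> K" for z
  proof (rule ccontr)
    assume "\<not> ?thesis"
    then have "\<And>y. y \<in> K \<Longrightarrow> f y \<le> f z" by force
    with no show False using max[OF \<open>z \<in> K\<close>] by blast
  qed
  let ?C = "(\<lambda>y. {z\<in>K. f z < f y}) ` K"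
  have "\<forall>c\<in>?C. openin (top_of_set K) c" using usc_openin[OF assms(3)] by auto
  moreover have "K \<subseteq> \<Union>?C" using ex by auto
  ultimately obtain D where D: "D \<subseteq> ?C" "finite D" "K \<subseteq> \<Union>D"
    using assms(1) unfolding compact_eq_openin_cover by meson
  then obtain Y where Y: "Y \<subseteq> K" "finite Y" "D = (\<lambda>y. {z\<in>K. f z < f y}) ` Y"
    by (meson finite_subset_image)
  have "Y \<noteq> {}" using D Y assms(2) by auto
  have "Max (f ` Y) \<in> f ` Y" using Y(2) \<open>Y \<noteq> {}\<close> by simp
  then obtain y where y: "y \<in> Y" "f y = Max (f ` Y)" by auto
  with Y D(3) obtain y' where "y' \<in> Y" "f y < f y'" by blast
  then show False using y Y(2) by (metis Max_ge finite_imageI imageI not_le)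
qed

lemma jet2_time_penalty:
  fixes z :: "'a::euclidean_space \<times> real"
  assumes "snd z < T"
  shows "jet2 (\<lambda>y. \<epsilon> / (T - snd y)) z (0, \<epsilon> / (T - snd z)\<^sup>2) (\<lambda>h. (0, 2 * \<epsilon> / (T - snd z) ^ 3 * snd h))"
proof (rule jet2_gradient[where F = "\<lambda>y. (0, \<epsilon> / (T - snd y)\<^sup>2)"])
  have "open {y :: 'a \<times> real. snd y < T}" by (intro open_Collect_less continuous_intros)
  from eventually_nhds_in_open[OF this, of z]
  show "\<forall>\<^sub>F y in nhds z. ((\<lambda>y. \<epsilon> / (T - snd y)) has_derivative (\<bullet>) (0, \<epsilon> / (T - snd y)\<^sup>2)) (at y)"
    using assms
  proof (simp, elim eventually_mono)
    fix y :: "'a \<times> real" assume "snd y < T"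
    then show "((\<lambda>y. \<epsilon> / (T - snd y)) has_derivative (\<bullet>) (0, \<epsilon> / (T - snd y)\<^sup>2)) (at y)"
      by (auto intro!: derivative_eq_intros simp: fun_eq_iff inner_prod_def divide_simps power2_eq_square)
  qed
  show "((\<lambda>y :: 'a \<times> real. (0::'a, \<epsilon> / (T - snd y)\<^sup>2)) has_derivative (\<lambda>h. (0, 2 * \<epsilon> / (T - snd z) ^ 3 * snd h))) (at z)"
    using assms
    by (auto intro!: derivative_eq_intros simp: fun_eq_iff divide_simps power2_eq_square power3_eq_cube)
qed

text \<open>The penalty \<open>\<epsilon> / (T - t)\<close> does two things: its blow-up keeps the
  maximum of the difference away from the final time, and its positive time slope makes the
  inequality at the maximum strict, contradicting \<open>sub\<close> through \<open>mono\<close>.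
  The barrier enters only through one superjet at each point.\<close>

theorem max_principle:
  fixes v S :: "'a::euclidean_space \<times> real \<Rightarrow> real"
  assumes U: "open U" "bounded U"
    and usc: "upper_semicontinuous_on (closure U \<times> {t0..T}) (\<lambda>z. v z - S z)"
    and sub: "subsol F (U \<times> {t0<..<T}) v"
    and jets: "\<And>z. z \<in> U \<times> {t0<..<T} \<Longrightarrow> \<exists>a A. superjet S z a A \<and> F (snd a) (space_trace A) \<ge> 0"
    and mono: "\<And>p l c. c > 0 \<Longrightarrow> F p l \<ge> 0 \<Longrightarrow> F (p + c) l > 0"
    and init: "\<And>x. x \<in> closure U \<Longrightarrow> v (x, t0) \<le> S (x, t0)"
    and lat: "\<And>x t. x \<in> frontier U \<Longrightarrow> t0 \<le> t \<Longrightarrow> t \<le> T \<Longrightarrow> v (x, t) \<le> S (x, t)"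
    and z1: "x1 \<in> closure U" "t0 \<le> t1" "t1 < T"
  shows "v (x1, t1) \<le> S (x1, t1)"
proof (rule ccontr)
  assume neg: "\<not> v (x1, t1) \<le> S (x1, t1)"
  define w where "w z = v z - S z" for z
  have w1: "w (x1, t1) > 0" using neg by (simp add: w_def)
  have cpt: "compact (closure U \<times> {a..b})" for a b :: real
    using U by (intro compact_Times) (auto simp: compact_closure)
  have ne: "closure U \<times> {t0..T} \<noteq> {}" using z1 by auto
  obtain zB where zB: "zB \<in> closure U \<times> {t0..T}" "\<And>y. y \<in> closure U \<times> {t0..T} \<Longrightarrow> w y \<le> w zB"
    by (rule usc_attains_max[OF cpt ne usc[folded w_def]]) auto
  \<comment> \<open>Half of the excess at \<open>(x1, t1)\<close> survives the penalty.\<close>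
  define \<epsilon> where "\<epsilon> = w (x1, t1) * (T - t1) / 2"
  have \<epsilon>: "\<epsilon> > 0" using w1 z1 by (simp add: \<epsilon>_def)
  have wB: "w zB \<ge> w (x1, t1)" using z1 by (intro zB) auto
  then have wB0: "w zB > 0" using w1 by simp
  \<comment> \<open>At time \<open>T'\<close> the penalty is \<open>2 * w zB\<close>, more than the
    largest value of \<open>w\<close>.\<close>
  define T' where "T' = T - \<epsilon> / (2 * w zB)"
  have TT: "T' < T" using \<epsilon> wB0 by (simp add: T'_def)
  have "\<epsilon> / (2 * w zB) \<le> (T - t1) / 4"
    using wB wB0 z1 w1 by (simp add: \<epsilon>_def divide_simps)
  then have T1: "t1 < T'" using z1 by (simp add: T'_def)
  define g where "g z = w z - \<epsilon> / (T - snd z)" for z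
  have gusc: "upper_semicontinuous_on (closure U \<times> {t0..T'}) g"
  proof -
    have c: "continuous_on (closure U \<times> {t0..T'}) (\<lambda>z. - (\<epsilon> / (T - snd z)))"
      using TT by (auto intro!: continuous_intros)
    have s: "closure U \<times> {t0..T'} \<subseteq> closure U \<times> {t0..T}" using TT by auto
    from usc_add[OF usc_subset[OF usc[folded w_def] s] continuous_imp_usc[OF c]]
    show ?thesis by (simp add: g_def[abs_def])
  qed
  have "closure U \<times> {t0..T'} \<noteq> {}" using z1 T1 by auto
  then obtain zm where zm: "zm \<in> closure U \<times> {t0..T'}" "\<And>y. y \<in> closure U \<times> {t0..T'} \<Longrightarrow> g y \<le> g zm"
    by (rule usc_attains_max[OF cpt _ gusc]) auto
  have "g (x1, t1) = w (x1, t1) / 2" using z1 by (simp add: g_def \<epsilon>_def divide_simps)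
  moreover have "g (x1, t1) \<le> g zm" using z1 T1 by (intro zm) auto
  ultimately have gm: "g zm > 0" using w1 by linarith
  have "\<epsilon> / (T - snd zm) > 0" using zm(1) TT \<epsilon> by auto
  with gm have wm: "w zm > 0" by (simp add: g_def)
  have m1: "snd zm \<noteq> t0" using wm init zm(1) by (cases zm) (force simp: w_def)
  have m2: "fst zm \<notin> frontier U" using wm lat zm(1) TT by (cases zm) (force simp: w_def)
  have m3: "snd zm \<noteq> T'"
  proof
    assume "snd zm = T'"
    then have "g zm = w zm - 2 * w zB" using \<epsilon> by (simp add: g_def T'_def)
    moreover have "w zm \<le> w zB" using zm(1) TT by (intro zB) auto
    ultimately show False using gm wB0 by simp
  qed
  have int: "zm \<in> U \<times> {t0<..<T'}"
    using zm(1) m1 m2 m3 U(1) by (cases zm) (auto simp: frontier_def interior_open)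
  then have "zm \<in> U \<times> {t0<..<T}" using TT by auto
  then obtain a A where aA: "superjet S zm a A" "F (snd a) (space_trace A) \<ge> 0" using jets by blast
  let ?c = "\<epsilon> / (T - snd zm)\<^sup>2"
  have sT: "snd zm < T" using int TT by auto
  have "superjet (\<lambda>y. S y + \<epsilon> / (T - snd y)) zm (a + (0, ?c))
      (\<lambda>h. A h + (0, 2 * \<epsilon> / (T - snd zm) ^ 3 * snd h))"
    by (intro superjet_add aA jet2_superjet jet2_time_penalty sT)
  then have "superjet v zm (a + (0, ?c)) (\<lambda>h. A h + (0, 2 * \<epsilon> / (T - snd zm) ^ 3 * snd h))"
  proof (rule superjet_touch)
    have "open (U \<times> {t0<..<T'})" using U(1) by (intro open_Times) auto
    from eventually_nhds_in_open[OF this int]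
    have "\<forall>\<^sub>F y in nhds zm. g y \<le> g zm"
    proof eventually_elim
      case (elim y) then show ?case using closure_subset[of U] by (intro zm) auto
    qed
    then have "\<forall>\<^sub>F h in nhds 0. g (zm + h) \<le> g zm"
      using eventually_nhds_shift[of "\<lambda>y. g y \<le> g zm" zm] by simp
    then show "\<forall>\<^sub>F h in nhds 0. v (zm + h) - (S (zm + h) + \<epsilon> / (T - snd (zm + h)))
        \<le> v zm - (S zm + \<epsilon> / (T - snd zm))"
      by eventually_elim (simp add: g_def w_def)
  qed
  with sub \<open>zm \<in> U \<times> {t0<..<T}\<close>
  have "F (snd (a + (0, ?c))) (space_trace (\<lambda>h. A h + (0, 2 * \<epsilon> / (T - snd zm) ^ 3 * snd h))) \<le> 0"
    unfolding subsol_def by blast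
  moreover have "space_trace (\<lambda>h. A h + (0, 2 * \<epsilon> / (T - snd zm) ^ 3 * snd h)) = space_trace A"
    by (simp add: space_trace_add) (simp add: space_trace_def)
  ultimately have "F (snd a + ?c) (space_trace A) \<le> 0" by simp
  moreover have "?c > 0" using \<epsilon> sT by simp
  ultimately show False using mono aA(2) by (meson not_le)
qed

section \<open>Calculus of jets and classical subsolutions\<close>

lemma jet2_sum:
  assumes "finite I" "\<And>i. i \<in> I \<Longrightarrow> jet2 (f i) z (a i) (A i)"
  shows "jet2 (\<lambda>y. \<Sum>i\<in>I. f i y) z (\<Sum>i\<in>I. a i) (\<lambda>h. \<Sum>i\<in>I. A i h)"
  using assms by (induction rule: finite_induct) (auto intro: jet2_const jet2_add)

lemma space_trace_sum: "space_trace (\<lambda>h. \<Sum>i\<in>I. A i h) = (\<Sum>i\<in>I. space_trace (A i))"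
  unfolding space_trace_def inner_sum_left by (rule sum.swap)

lemma superjet_shift_const:
  "superjet (\<lambda>y. v y + c) z a A \<longleftrightarrow> superjet v z a A"
  by (simp add: superjet_def algebra_simps)

lemma subsol_shift_const: "subsol F U (\<lambda>y. v y + c) \<longleftrightarrow> subsol F U v"
  by (simp add: subsol_def superjet_shift_const)

lemma subsol_subset: "subsol F U v \<Longrightarrow> V \<subseteq> U \<Longrightarrow> subsol F V v"
  by (auto simp: subsol_def)

lemma superjet_scaleR:
  assumes "superjet f z a A" "c > 0"
  shows "superjet (\<lambda>y. c * f y) z (c *\<^sub>R a) (\<lambda>h. c *\<^sub>R A h)"
  unfolding superjet_def
proof (intro conjI allI impI)
  show "linear (\<lambda>h. c *\<^sub>R A h)"
    using superjet_linear[OF assms(1)] by (rule linear_compose_scale_right)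
  fix \<eta> :: real assume "\<eta> > 0"
  then have "\<eta> / c > 0" using assms(2) by simp
  from superjetD[OF assms(1) this]
  show "\<forall>\<^sub>F h in nhds 0. c * f (z + h) \<le> c * f z + (c *\<^sub>R a) \<bullet> h + (c *\<^sub>R A h) \<bullet> h / 2 + \<eta> * (h \<bullet> h)"
  proof eventually_elim
    case (elim h)
    then have "c * f (z + h) \<le> c * (f z + a \<bullet> h + A h \<bullet> h / 2 + \<eta> / c * (h \<bullet> h))"
      using assms(2) by simp
    then show ?case using assms(2) by (simp add: algebra_simps)
  qed
qed

lemma jet2_scaleR:
  assumes "jet2 f z a A" "c > 0"
  shows "jet2 (\<lambda>y. c * f y) z (c *\<^sub>R a) (\<lambda>h. c *\<^sub>R A h)"
  using superjet_scaleR[OF _ assms(2), of f z a A] superjet_scaleR[OF _ assms(2), of "\<lambda>y. - f y" z "-a" "\<lambda>h. - A h"] assms(1)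
  by (simp add: jet2_def)

lemma space_trace_scaleR: "space_trace (\<lambda>h. c *\<^sub>R A h) = c * space_trace A"
  by (simp add: space_trace_def sum_distrib_left del: inner_Pair)

text \<open>Comparison of jets fixes the slope and can only increase the trace, and \<open>F\<close>
  is nonincreasing in the trace.\<close>

lemma subsol_classical:
  assumes "\<And>z. z \<in> U \<Longrightarrow> \<exists>a A. jet2 f z a A \<and> F (snd a) (space_trace A) \<le> 0"
    and "\<And>p l l'. l \<le> l' \<Longrightarrow> F p l' \<le> F p l"
  shows "subsol F U f"
  unfolding subsol_def
proof (intro ballI allI impI)
  fix z a' A' assume z: "z \<in> U" and sj: "superjet f z a' A'"
  from assms(1)[OF z] obtain a A where j: "jet2 f z a A" "F (snd a) (space_trace A) \<le> 0" by blast
  have "a' = a" "space_trace A \<le> space_trace A'"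
    using jet2_superjet_compare[OF j(1) sj] by (auto intro: space_trace_mono)
  with j(2) assms(2)[of "space_trace A" "space_trace A'" "snd a"] show "F (snd a') (space_trace A') \<le> 0" by simp
qed

lemma jet2_space_quadratic:
  fixes z :: "'a::euclidean_space \<times> real"
  shows "jet2 (\<lambda>y. c + C * (norm (fst y - x))\<^sup>2 + D * snd y) z
    ((2 * C) *\<^sub>R (fst z - x), D) (\<lambda>h. ((2 * C) *\<^sub>R fst h, 0))"
proof (rule jet2_gradient[where F = "\<lambda>y. ((2 * C) *\<^sub>R (fst y - x), D)"])
  have "((\<lambda>y. c + C * ((fst y - x) \<bullet> (fst y - x)) + D * snd y) has_derivative
      (\<lambda>h. ((2 * C) *\<^sub>R (fst y - x), D) \<bullet> h)) (at y)" for y :: "'a \<times> real"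
    by (auto intro!: derivative_eq_intros simp: fun_eq_iff inner_prod_def inner_commute algebra_simps)
  then show "\<forall>\<^sub>F y in nhds z. ((\<lambda>y. c + C * (norm (fst y - x))\<^sup>2 + D * snd y) has_derivative
      (\<bullet>) ((2 * C) *\<^sub>R (fst y - x), D)) (at y)"
    by (simp add: power2_norm_eq_inner)
  show "((\<lambda>y. ((2 * C) *\<^sub>R (fst y - x), D)) has_derivative (\<lambda>h. ((2 * C) *\<^sub>R fst h, 0))) (at z)"
    by (auto intro!: derivative_eq_intros simp: fun_eq_iff)
qed

lemma space_trace_space_quadratic:
  "space_trace (\<lambda>h :: 'a::euclidean_space \<times> real. (C *\<^sub>R fst h, 0)) = C * real DIM('a)"
  by (simp add: space_trace_def)

text \<open>The operator \<open>\<lambda>p l. p\<close> does not see the Laplacian, so a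
  time-independent paraboloid around \<open>x\<close> is an admissible barrier however steep it
  is.\<close>

lemma subsol_nonincreasing:
  fixes v :: "'a::euclidean_space \<times> real \<Rightarrow> real"
  assumes U: "open U" and v: "continuous_on (U \<times> {a<..<b}) v" and sub: "subsol (\<lambda>p l. p) (U \<times> {a<..<b}) v"
    and M: "\<And>z. z \<in> U \<times> {a<..<b} \<Longrightarrow> \<bar>v z\<bar> \<le> M"
    and x: "x \<in> U" and t: "a < t1" "t1 \<le> t2" "t2 < b"
  shows "v (x, t2) \<le> v (x, t1)"
proof (rule field_le_epsilon)
  fix \<omega> :: real assume \<omega>: "\<omega> > 0"
  have op: "open (U \<times> {a<..<b})" using U by (intro open_Times) auto
  have t1: "t1 \<in> {a<..<b}" using t by auto
  have "continuous_on U (\<lambda>y. v (y, t1))"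
    by (rule continuous_on_compose2[OF v]) (use t1 in \<open>auto intro!: continuous_intros\<close>)
  then have "isCont (\<lambda>y. v (y, t1)) x" using U x by (simp add: continuous_on_eq_continuous_at)
  then have "\<forall>\<^sub>F y in nhds x. v (y, t1) < v (x, t1) + \<omega>"
    using \<omega> by (intro order_tendstoD(2)[OF tendsto_at_iff_tendsto_nhds[THEN iffD1]]) (auto simp: isCont_def)
  then obtain d where d: "d > 0" "\<And>y. dist y x < d \<Longrightarrow> v (y, t1) < v (x, t1) + \<omega>"
    unfolding eventually_nhds_metric by blast
  obtain e where e: "e > 0" "cball x e \<subseteq> U" using U x open_contains_cball by blast
  define r where "r = min e (d / 2)"
  have r: "r > 0" "cball x r \<subseteq> U" "r < d" using d e by (auto simp: r_def)
  \<comment> \<open>On the sphere of radius \<open>r\<close> the paraboloid then exceeds its vertex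
    value by \<open>2 * M\<close>, which covers the oscillation of \<open>v\<close>.\<close>
  define C where "C = 2 * M / r\<^sup>2"
  have M0: "M \<ge> 0" using M[of "(x, t1)"] x t1 by auto
  have C: "C \<ge> 0" using M0 by (simp add: C_def)
  \<comment> \<open>\<open>max_principle\<close> concludes strictly before its final time, so the
    cylinder extends a little beyond \<open>t2\<close>.\<close>
  define T where "T = (t2 + b) / 2"
  have T: "t2 < T" "T < b" using t by (auto simp: T_def)
  define S where "S z = v (x, t1) + \<omega> + C * (norm (fst z - x))\<^sup>2 + 0 * snd z" for z :: "'a \<times> real"
  have sub': "ball x r \<times> {t1<..<T} \<subseteq> U \<times> {a<..<b}" "cball x r \<times> {t1..T} \<subseteq> U \<times> {a<..<b}"
    using r(2) t T by (auto simp: subset_iff)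
  have cS: "continuous_on K S" for K unfolding S_def by (intro continuous_intros)
  have "v (x, t2) \<le> S (x, t2)"
  proof (rule max_principle[where F = "\<lambda>p l. p"])
    show "upper_semicontinuous_on (closure (ball x r) \<times> {t1..T}) (\<lambda>z. v z - S z)"
      using sub' r(1) by (intro continuous_imp_usc continuous_on_diff cS continuous_on_subset[OF v]) simp
    show "subsol (\<lambda>p l. p) (ball x r \<times> {t1<..<T}) v" by (rule subsol_subset[OF sub sub'(1)])
    show "\<exists>a A. superjet S z a A \<and> 0 \<le> snd a" for z
      using jet2_superjet[OF jet2_space_quadratic[of "v (x, t1) + \<omega>" C x 0 z]]
      unfolding S_def by (intro exI conjI) (assumption, simp)
    show "v (y, t1) \<le> S (y, t1)" if "y \<in> closure (ball x r)" for y
    proof -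
      have "v (y, t1) < v (x, t1) + \<omega>" using that r by (intro d) (auto simp: dist_commute)
      moreover have "C * (norm (y - x))\<^sup>2 \<ge> 0" using C by simp
      ultimately show ?thesis by (simp add: S_def)
    qed
    show "v (y, t) \<le> S (y, t)" if "y \<in> frontier (ball x r)" "t1 \<le> t" "t \<le> T" for y t
    proof -
      have n: "norm (y - x) = r" using that r by (simp add: dist_norm norm_minus_commute)
      have "\<bar>v (y, t)\<bar> \<le> M"
      proof (rule M)
        have "(y, t) \<in> cball x r \<times> {t1..T}" using that n by (simp add: dist_norm norm_minus_commute)
        then show "(y, t) \<in> U \<times> {a<..<b}" using sub'(2) by blast
      qed
      moreover have "\<bar>v (x, t1)\<bar> \<le> M" using x t1 by (intro M) auto
      moreover have "C * (norm (y - x))\<^sup>2 = 2 * M" using r by (simp add: n C_def)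
      ultimately show ?thesis using \<omega> by (simp add: S_def)
    qed
  qed (use r t T in auto)
  then show "v (x, t2) \<le> v (x, t1) + \<omega>" by (simp add: S_def)
qed

section \<open>Integrals depending on a parameter\<close>

lemma continuous_on_slice:
  assumes "continuous_on (W \<times> C) (\<lambda>(y, t). f y t)" "y \<in> W"
  shows "continuous_on C (f y)"
proof -
  have "continuous_on C (\<lambda>t. (\<lambda>(y, t). f y t) (y, t))"
    by (rule continuous_on_compose2[OF assms(1)]) (use assms(2) in \<open>auto intro!: continuous_intros\<close>)
  then show ?thesis by simp
qed

text \<open>\<open>leibniz_rule\<close> wants derivatives as bounded linear functions;
  \<open>blinfun_inner_right\<close> packs the gradient into one, and afterwards the integral is
  moved back inside the inner product.\<close>

lemma integral_has_gradient:
  fixes K :: "'b::euclidean_space \<Rightarrow> 'c::euclidean_space \<Rightarrow> real" and G :: "'b \<Rightarrow> 'c \<Rightarrow> 'b"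
  assumes W: "open W" "z \<in> W"
    and der: "\<And>y t. y \<in> W \<Longrightarrow> t \<in> cbox a b \<Longrightarrow> ((\<lambda>y. K y t) has_derivative (\<lambda>h. G y t \<bullet> h)) (at y)"
    and K: "continuous_on (W \<times> cbox a b) (\<lambda>(y, t). K y t)"
    and G: "continuous_on (W \<times> cbox a b) (\<lambda>(y, t). G y t)"
  shows "((\<lambda>y. integral (cbox a b) (K y)) has_derivative (\<lambda>h. integral (cbox a b) (G z) \<bullet> h)) (at z)"
proof -
  obtain e where e: "e > 0" "ball z e \<subseteq> W" using W open_contains_ball by blast
  have cB: "continuous_on (W \<times> cbox a b) (\<lambda>(y, t). blinfun_inner_right (G y t))"
    using bounded_linear.continuous_on[OF bounded_linear_blinfun_inner_right G] by (simp add: split_beta')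
  have "((\<lambda>y. integral (cbox a b) (K y)) has_derivative
      blinfun_apply (integral (cbox a b) (\<lambda>t. blinfun_inner_right (G z t)))) (at z within ball z e)"
  proof (rule leibniz_rule)
    show "((\<lambda>y. K y t) has_derivative blinfun_apply (blinfun_inner_right (G y t))) (at y within ball z e)"
      if "y \<in> ball z e" "t \<in> cbox a b" for y t
    proof -
      have "y \<in> W" using that e by blast
      from has_derivative_at_withinI[OF der[OF this that(2)]]
      show ?thesis by (simp add: blinfun_inner_right.rep_eq)
    qed
    show "K y integrable_on cbox a b" if "y \<in> ball z e" for y
      using that e by (intro integrable_continuous continuous_on_slice[OF K]) auto
    show "continuous_on (ball z e \<times> cbox a b) (\<lambda>(x, t). blinfun_inner_right (G x t))"
      by (rule continuous_on_subset[OF cB]) (use e in auto)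
  qed (use e in auto)
  moreover have "blinfun_apply (integral (cbox a b) (\<lambda>t. blinfun_inner_right (G z t))) =
      (\<lambda>h. integral (cbox a b) (G z) \<bullet> h)"
  proof
    fix h
    have "(\<lambda>t. blinfun_inner_right (G z t)) integrable_on cbox a b"
      using W(2) by (intro integrable_continuous continuous_on_slice[OF cB])
    moreover have "G z integrable_on cbox a b"
      using W(2) by (intro integrable_continuous continuous_on_slice[OF G])
    ultimately show "blinfun_apply (integral (cbox a b) (\<lambda>t. blinfun_inner_right (G z t))) h = integral (cbox a b) (G z) \<bullet> h"
      by (simp add: blinfun_apply_integral)
  qed
  ultimately show ?thesis using e at_within_open[of z "ball z e"] by simp
qed

text \<open>The gradient is differentiated one component at a time: \<open>H j\<close> is the
  gradient of the \<open>j\<close>-th component of \<open>G\<close>, that is, a row of the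
  Hessian.\<close>

lemma jet2_integral:
  fixes K :: "'b::euclidean_space \<Rightarrow> 'c::euclidean_space \<Rightarrow> real" and G :: "'b \<Rightarrow> 'c \<Rightarrow> 'b"
    and H :: "'b \<Rightarrow> 'b \<Rightarrow> 'c \<Rightarrow> 'b"
  assumes W: "open W" "z \<in> W"
    and derK: "\<And>y t. y \<in> W \<Longrightarrow> t \<in> cbox a b \<Longrightarrow> ((\<lambda>y. K y t) has_derivative (\<lambda>h. G y t \<bullet> h)) (at y)"
    and derG: "\<And>y t j. y \<in> W \<Longrightarrow> t \<in> cbox a b \<Longrightarrow> j \<in> Basis \<Longrightarrow>
      ((\<lambda>y. G y t \<bullet> j) has_derivative (\<lambda>h. H j y t \<bullet> h)) (at y)"
    and K: "continuous_on (W \<times> cbox a b) (\<lambda>(y, t). K y t)"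
    and G: "continuous_on (W \<times> cbox a b) (\<lambda>(y, t). G y t)"
    and H: "\<And>j. j \<in> Basis \<Longrightarrow> continuous_on (W \<times> cbox a b) (\<lambda>(y, t). H j y t)"
  shows "jet2 (\<lambda>y. integral (cbox a b) (K y)) z (integral (cbox a b) (G z))
    (\<lambda>h. \<Sum>j\<in>Basis. (integral (cbox a b) (H j z) \<bullet> h) *\<^sub>R j)"
proof (rule jet2_gradient[where F = "\<lambda>y. integral (cbox a b) (G y)"])
  show "\<forall>\<^sub>F y in nhds z. ((\<lambda>y. integral (cbox a b) (K y)) has_derivative
      (\<bullet>) (integral (cbox a b) (G y))) (at y)"
    using eventually_nhds_in_open[OF W]
    by eventually_elim (rule integral_has_gradient[OF W(1) _ derK K G])
  show "((\<lambda>y. integral (cbox a b) (G y)) has_derivative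
      (\<lambda>h. \<Sum>j\<in>Basis. (integral (cbox a b) (H j z) \<bullet> h) *\<^sub>R j)) (at z)"
  proof (subst has_derivative_componentwise_within, intro ballI)
    fix i :: 'b assume i: "i \<in> Basis"
    have Gi: "continuous_on (W \<times> cbox a b) (\<lambda>(y, t). G y t \<bullet> i)"
      using G by (auto simp: split_beta' intro!: continuous_intros)
    have d: "((\<lambda>y. integral (cbox a b) (\<lambda>t. G y t \<bullet> i)) has_derivative
        (\<lambda>h. integral (cbox a b) (H i z) \<bullet> h)) (at z)"
      by (rule integral_has_gradient[OF W derG Gi H]) (use i in auto)
    have eq: "integral (cbox a b) (\<lambda>t. G y t \<bullet> i) = integral (cbox a b) (G y) \<bullet> i" if "y \<in> W" for y
    proof -
      have "continuous_on (cbox a b) (G y)"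
        by (rule continuous_on_slice[OF G that])
      then show ?thesis by (simp add: integrable_continuous)
    qed
    have "((\<lambda>y. integral (cbox a b) (G y) \<bullet> i) has_derivative
        (\<lambda>h. integral (cbox a b) (H i z) \<bullet> h)) (at z)"
      by (rule has_derivative_transform_within_open[OF d W]) (rule eq)
    moreover have "(\<Sum>j\<in>Basis. (integral (cbox a b) (H j z) \<bullet> h) *\<^sub>R j) \<bullet> i = integral (cbox a b) (H i z) \<bullet> h" for h
      using i by (simp add: inner_sum_left inner_Basis if_distrib sum.delta' cong: if_cong)
    ultimately show "((\<lambda>y. integral (cbox a b) (G y) \<bullet> i) has_derivative
        (\<lambda>h. (\<Sum>j\<in>Basis. (integral (cbox a b) (H j z) \<bullet> h) *\<^sub>R j) \<bullet> i)) (at z)" by simp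
  qed
qed

lemma integral_reflect_shift:
  fixes f :: "'a::euclidean_space \<Rightarrow> real"
  assumes "f integrable_on cbox (c - b) (c - a)"
  shows "integral (cbox a b) (\<lambda>w. f (c - w)) = integral (cbox (c - b) (c - a)) f"
proof -
  have "((\<lambda>x. f ((-1) *\<^sub>R x + c)) has_integral (1 / (\<bar>-1\<bar> ^ DIM('a))) *\<^sub>R integral (cbox (c - b) (c - a)) f)
     ((\<lambda>x. (1 / (-1)) *\<^sub>R x + - ((1 / (-1)) *\<^sub>R c)) ` cbox (c - b) (c - a))"
    using assms by (intro has_integral_affinity) (auto simp: has_integral_integral)
  moreover have "(\<lambda>x. (1 / (-1)) *\<^sub>R x + - ((1 / (-1)) *\<^sub>R c)) ` cbox (c - b) (c - a) = cbox a b"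
  proof -
    have "(\<lambda>x. - x + c) ` cbox (c - b) (c - a) = (\<lambda>x. c - x) ` cbox (c - b) (c - a)"
      by (intro image_cong) auto
    also have "\<dots> = cbox a b"
    proof (intro set_eqI iffI)
      fix x assume "x \<in> cbox a b"
      then have "c - x \<in> cbox (c - b) (c - a)" by (auto simp: mem_box inner_diff_left)
      then show "x \<in> (\<lambda>x. c - x) ` cbox (c - b) (c - a)" by (intro image_eqI[of _ _ "c - x"]) auto
    qed (fastforce simp: mem_box inner_diff_left)
    finally show ?thesis by simp
  qed
  ultimately show ?thesis by (simp add: integral_unique)
qed

section \<open>The heat kernel\<close>

text \<open>
  The kernel of \<open>b \<partial>\<^sub>t u = \<Delta>u\<close> without its normalizing constant: averages are formed over a cube and
  divided by the mass \<open>heat_kernel_mass\<close> of that cube.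
\<close>

definition heat_kernel :: "real \<Rightarrow> 'a::euclidean_space \<times> real \<Rightarrow> real" where
  "heat_kernel b z = exp (- (real DIM('a) / 2) * ln (snd z) - b / 4 * (fst z \<bullet> fst z) * inverse (snd z))"

text \<open>The logarithmic gradient, i.e. the gradient divided by the kernel. With the exponential
  factored out, the heat equation becomes an identity between rational functions.\<close>

definition heat_kernel_grad :: "real \<Rightarrow> 'a::euclidean_space \<times> real \<Rightarrow> 'a \<times> real" where
  "heat_kernel_grad b z = (- (b / 2 * inverse (snd z)) *\<^sub>R fst z,
    - (real DIM('a) / 2) * inverse (snd z) + b / 4 * (fst z \<bullet> fst z) * (inverse (snd z))\<^sup>2)"

text \<open>The \<open>j\<close>-th row of the Hessian, again divided by the kernel: a product of
  logarithmic derivatives plus the derivative of a logarithmic derivative.\<close>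

definition heat_kernel_hess :: "real \<Rightarrow> 'a::euclidean_space \<times> real \<Rightarrow> 'a \<times> real \<Rightarrow> 'a \<times> real" where
  "heat_kernel_hess b j z = (heat_kernel_grad b z \<bullet> j) *\<^sub>R heat_kernel_grad b z +
    (- (b / 2 * inverse (snd z)) *\<^sub>R fst j + (b / 2 * snd j * (inverse (snd z))\<^sup>2) *\<^sub>R fst z,
     b / 2 * (fst z \<bullet> fst j) * (inverse (snd z))\<^sup>2
       + (real DIM('a) / 2 * (inverse (snd z))\<^sup>2 - b / 2 * (fst z \<bullet> fst z) * (inverse (snd z)) ^ 3) * snd j)"

lemma has_derivative_inverse_snd:
  "snd z \<noteq> 0 \<Longrightarrow> ((\<lambda>z. inverse (snd z :: real)) has_derivative (\<lambda>h. - (inverse (snd z))\<^sup>2 * snd h)) (at z)"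
  by (auto intro!: derivative_eq_intros simp: power2_eq_square fun_eq_iff)

lemma heat_kernel_pos: "heat_kernel b z > 0"
  by (simp add: heat_kernel_def)

lemma heat_kernel_has_gradient:
  fixes z :: "'a::euclidean_space \<times> real"
  assumes "snd z > 0"
  shows "(heat_kernel b has_derivative (\<lambda>h. (heat_kernel b z *\<^sub>R heat_kernel_grad b z) \<bullet> h)) (at z)"
proof -
  have z: "snd z \<noteq> 0" using assms by simp
  have "((\<lambda>z :: 'a \<times> real. ln (snd z)) has_derivative (\<lambda>h. inverse (snd z) * snd h)) (at z)"
    using assms by (auto intro!: derivative_eq_intros simp: divide_inverse mult.commute)
  note D = this has_derivative_inverse_snd[OF z]
  have "((\<lambda>z :: 'a \<times> real. - (real DIM('a) / 2) * ln (snd z) - b / 4 * (fst z \<bullet> fst z) * inverse (snd z)) has_derivative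
      (\<lambda>h. heat_kernel_grad b z \<bullet> h)) (at z)"
    unfolding heat_kernel_grad_def
    by (rule has_derivative_eq_rhs, (rule has_derivative_diff has_derivative_mult D has_derivative_const
        has_derivative_inner has_derivative_fst has_derivative_ident)+)
      (simp add: fun_eq_iff inner_prod_def inner_commute algebra_simps power2_eq_square)
  from has_derivative_exp[OF this] show ?thesis
    unfolding heat_kernel_def by (rule has_derivative_eq_rhs) (simp add: fun_eq_iff)
qed

lemma heat_kernel_grad_has_gradient:
  fixes z :: "'a::euclidean_space \<times> real"
  assumes "snd z > 0"
  shows "((\<lambda>z. (heat_kernel b z *\<^sub>R heat_kernel_grad b z) \<bullet> j) has_derivative (\<lambda>h. (heat_kernel b z *\<^sub>R heat_kernel_hess b j z) \<bullet> h)) (at z)"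
proof -
  define \<rho> where "\<rho> z = inverse (snd z)" for z :: "'a \<times> real"
  have d\<rho>: "(\<rho> has_derivative (\<lambda>h. - (\<rho> z * \<rho> z) * snd h)) (at z)"
    using has_derivative_inverse_snd[of z] assms by (simp add: \<rho>_def[abs_def] power2_eq_square)
  define D where "D = (- (b / 2 * \<rho> z) *\<^sub>R fst j + (b / 2 * snd j * (\<rho> z * \<rho> z)) *\<^sub>R fst z,
     b / 2 * (fst z \<bullet> fst j) * (\<rho> z * \<rho> z)
       + (real DIM('a) / 2 * (\<rho> z * \<rho> z) - b / 2 * (fst z \<bullet> fst z) * (\<rho> z * \<rho> z * \<rho> z)) * snd j)"
  have eq: "(\<lambda>z :: 'a \<times> real. heat_kernel_grad b z \<bullet> j) = (\<lambda>z. - (b / 2 * \<rho> z) * (fst z \<bullet> fst j) +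
      (- (real DIM('a) / 2) * \<rho> z + b / 4 * (fst z \<bullet> fst z) * (\<rho> z * \<rho> z)) * snd j)"
    by (simp add: fun_eq_iff heat_kernel_grad_def inner_prod_def \<rho>_def power2_eq_square)
  have "((\<lambda>z :: 'a \<times> real. heat_kernel_grad b z \<bullet> j) has_derivative (\<lambda>h. D \<bullet> h)) (at z)"
    unfolding eq
    by (rule has_derivative_eq_rhs, (rule has_derivative_add has_derivative_minus has_derivative_mult d\<rho>
        has_derivative_const has_derivative_inner has_derivative_fst has_derivative_ident)+)
      (simp add: D_def fun_eq_iff inner_prod_def inner_commute inner_add_left inner_add_right algebra_simps)
  from has_derivative_mult[OF heat_kernel_has_gradient[OF assms, of b] this]
  have "((\<lambda>z. heat_kernel b z * (heat_kernel_grad b z \<bullet> j)) has_derivative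
      (\<lambda>h. heat_kernel b z * (D \<bullet> h) + (heat_kernel b z *\<^sub>R heat_kernel_grad b z) \<bullet> h * (heat_kernel_grad b z \<bullet> j))) (at z)" .
  moreover have "heat_kernel_hess b j z = (heat_kernel_grad b z \<bullet> j) *\<^sub>R heat_kernel_grad b z + D"
    by (simp add: heat_kernel_hess_def D_def \<rho>_def power2_eq_square power3_eq_cube)
  ultimately show ?thesis
    by (auto elim!: has_derivative_eq_rhs simp: fun_eq_iff inner_add_left algebra_simps)
qed

lemma heat_kernel_heat:
  fixes z :: "'a::euclidean_space \<times> real"
  assumes "snd z > 0"
  shows "(\<Sum>i\<in>Basis. heat_kernel_hess b (i, 0) z \<bullet> (i, 0)) = b * snd (heat_kernel_grad b z)"
proof -
  define r where "r = inverse (snd z)"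
  have "heat_kernel_hess b (i, 0) z \<bullet> (i, 0) = (b / 2 * r)\<^sup>2 * ((fst z \<bullet> i) * (fst z \<bullet> i)) - b / 2 * r"
    if "i \<in> Basis" for i
    using that by (simp add: heat_kernel_hess_def heat_kernel_grad_def r_def[symmetric] power2_eq_square algebra_simps inner_add_left inner_diff_left)
  then have "(\<Sum>i\<in>Basis. heat_kernel_hess b (i, 0) z \<bullet> (i, 0)) =
      (\<Sum>i\<in>Basis. (b / 2 * r)\<^sup>2 * ((fst z \<bullet> i) * (fst z \<bullet> i)) - b / 2 * r)"
    by (intro sum.cong) auto
  also have "\<dots> = (b / 2 * r)\<^sup>2 * (fst z \<bullet> fst z) - real DIM('a) * (b / 2 * r)"
    by (simp add: sum_subtractf sum_distrib_left[symmetric] euclidean_inner[of "fst z" "fst z"])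
  also have "\<dots> = b * snd (heat_kernel_grad b z)"
    by (simp add: heat_kernel_grad_def r_def[symmetric] power2_eq_square algebra_simps)
  finally show ?thesis .
qed

lemma has_derivative_shift:
  assumes "(f has_derivative f') (at (z - c))"
  shows "((\<lambda>z. f (z - c)) has_derivative f') (at z)"
proof -
  have "((\<lambda>z. z - c) has_derivative (\<lambda>h. h)) (at z)" by (auto intro!: derivative_eq_intros)
  from has_derivative_compose[OF this assms] show ?thesis by simp
qed

text \<open>Since \<open>snd z > \<tau>\<close> keeps the kernel away from its singularity, one may
  differentiate under the integral sign, where the kernel solves the heat equation.\<close>

lemma gauss_potential_jet:
  fixes f :: "'a::euclidean_space \<Rightarrow> real"
  assumes z: "snd z > \<tau>" and f: "continuous_on (cbox p q) f"
  shows "\<exists>a A. jet2 (\<lambda>z. integral (cbox p q) (\<lambda>y. heat_kernel b (z - (y, \<tau>)) * f y)) z a A \<and> b * snd a = space_trace A"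
proof -
  let ?C = "cbox p q"
  define W where "W = {z :: 'a \<times> real. snd z > \<tau>}"
  define G where "G z y = (f y * heat_kernel b (z - (y, \<tau>))) *\<^sub>R heat_kernel_grad b (z - (y, \<tau>))" for z :: "'a \<times> real" and y
  define H where "H j z y = (f y * heat_kernel b (z - (y, \<tau>))) *\<^sub>R heat_kernel_hess b j (z - (y, \<tau>))" for j z :: "'a \<times> real" and y
  have W: "open W" "z \<in> W"
    using z unfolding W_def by (auto intro!: open_Collect_less continuous_intros)
  have cf: "continuous_on (W \<times> ?C) (\<lambda>x. f (snd x))"
    by (rule continuous_on_compose2[OF f]) (auto intro!: continuous_intros)
  have s0: "snd (fst x) - \<tau> \<noteq> 0" "snd (fst x) - \<tau> > 0" if "x \<in> W \<times> ?C" for x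
    using that by (auto simp: W_def)
  have cg: "continuous_on (W \<times> ?C) (\<lambda>x. heat_kernel b (fst x - (snd x, \<tau>)))"
    unfolding heat_kernel_def using s0 by (auto intro!: continuous_intros)
  have cg1: "continuous_on (W \<times> ?C) (\<lambda>x. heat_kernel_grad b (fst x - (snd x, \<tau>)))"
    unfolding heat_kernel_grad_def using s0 by (auto intro!: continuous_intros)
  have cg2: "continuous_on (W \<times> ?C) (\<lambda>x. heat_kernel_hess b j (fst x - (snd x, \<tau>)))" for j
    unfolding heat_kernel_hess_def using s0 by (auto intro!: continuous_intros cg1)
  have cK: "continuous_on (W \<times> ?C) (\<lambda>(z, y). heat_kernel b (z - (y, \<tau>)) * f y)"
    unfolding split_beta' by (intro continuous_intros cg cf)
  have cG: "continuous_on (W \<times> ?C) (\<lambda>(z, y). G z y)"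
    unfolding split_beta' G_def by (intro continuous_intros cg cg1 cf)
  have cH: "continuous_on (W \<times> ?C) (\<lambda>(z, y). H j z y)" for j
    unfolding split_beta' H_def by (intro continuous_intros cg cg2 cf)
  have J: "jet2 (\<lambda>z. integral ?C (\<lambda>y. heat_kernel b (z - (y, \<tau>)) * f y)) z (integral ?C (G z))
      (\<lambda>h. \<Sum>j\<in>Basis. (integral ?C (H j z) \<bullet> h) *\<^sub>R j)"
  proof (rule jet2_integral[OF W _ _ cK cG cH])
    fix y :: "'a \<times> real" and t assume "y \<in> W" "t \<in> ?C"
    then have s: "snd (y - (t, \<tau>)) > 0" by (simp add: W_def)
    have "((\<lambda>y. f t * heat_kernel b (y - (t, \<tau>))) has_derivative (\<lambda>h. f t * ((heat_kernel b (y - (t, \<tau>)) *\<^sub>R heat_kernel_grad b (y - (t, \<tau>))) \<bullet> h))) (at y)"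
      by (intro has_derivative_mult_right has_derivative_shift heat_kernel_has_gradient s)
    moreover have "(\<bullet>) (G y t) = (\<lambda>h. f t * ((heat_kernel b (y - (t, \<tau>)) *\<^sub>R heat_kernel_grad b (y - (t, \<tau>))) \<bullet> h))"
      by (simp add: G_def fun_eq_iff)
    ultimately show "((\<lambda>y. heat_kernel b (y - (t, \<tau>)) * f t) has_derivative (\<bullet>) (G y t)) (at y)"
      by (simp only: mult.commute[of _ "f t"])
    fix j :: "'a \<times> real"
    have "((\<lambda>y. f t * ((heat_kernel b (y - (t, \<tau>)) *\<^sub>R heat_kernel_grad b (y - (t, \<tau>))) \<bullet> j)) has_derivative
        (\<lambda>h. f t * ((heat_kernel b (y - (t, \<tau>)) *\<^sub>R heat_kernel_hess b j (y - (t, \<tau>))) \<bullet> h))) (at y)"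
      by (intro has_derivative_mult_right has_derivative_shift heat_kernel_grad_has_gradient s
          has_derivative_shift[where f = "\<lambda>y. (heat_kernel b y *\<^sub>R heat_kernel_grad b y) \<bullet> j"])
    moreover have "(\<bullet>) (H j y t) = (\<lambda>h. f t * ((heat_kernel b (y - (t, \<tau>)) *\<^sub>R heat_kernel_hess b j (y - (t, \<tau>))) \<bullet> h))"
      by (simp add: H_def fun_eq_iff)
    moreover have "G y t \<bullet> j = f t * ((heat_kernel b (y - (t, \<tau>)) *\<^sub>R heat_kernel_grad b (y - (t, \<tau>))) \<bullet> j)" for y
      by (simp add: G_def)
    ultimately show "((\<lambda>y. G y t \<bullet> j) has_derivative (\<bullet>) (H j y t)) (at y)"
      by (simp only:)
  qed
  have iG: "G z integrable_on ?C"
    by (intro integrable_continuous continuous_on_slice[OF cG] W)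
  have iH: "H j z integrable_on ?C" for j
    by (intro integrable_continuous continuous_on_slice[OF cH] W)
  have "space_trace (\<lambda>h. \<Sum>j\<in>Basis. (integral ?C (H j z) \<bullet> h) *\<^sub>R j) = (\<Sum>i\<in>Basis. integral ?C (H (i, 0) z) \<bullet> (i, 0))"
    unfolding space_trace_def
  proof (rule sum.cong[OF refl])
    fix i :: 'a assume i: "i \<in> Basis"
    then have "(i, 0::real) \<in> Basis" by (simp add: Basis_prod_def)
    then show "(\<Sum>j\<in>Basis. (integral ?C (H j z) \<bullet> (i, 0)) *\<^sub>R j) \<bullet> (i, 0) = integral ?C (H (i, 0) z) \<bullet> (i, 0)"
      by (simp add: inner_sum_left inner_Basis if_distrib sum.delta' cong: if_cong del: inner_Pair)
  qed
  also have "\<dots> = (\<Sum>i\<in>Basis. integral ?C (\<lambda>y. H (i, 0) z y \<bullet> (i, 0)))"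
    by (simp add: integral_component_eq[OF iH] del: inner_Pair)
  also have "\<dots> = integral ?C (\<lambda>y. \<Sum>i\<in>Basis. H (i, 0) z y \<bullet> (i, 0))"
    by (intro integral_sum[symmetric] integrable_component iH finite_Basis)
  also have "\<dots> = integral ?C (\<lambda>y. b * (G z y \<bullet> (0, 1)))"
  proof (rule integral_cong)
    fix y
    have "(\<Sum>i\<in>Basis. H (i, 0) z y \<bullet> (i, 0)) =
        (f y * heat_kernel b (z - (y, \<tau>))) * (\<Sum>i\<in>Basis. heat_kernel_hess b (i, 0) (z - (y, \<tau>)) \<bullet> (i, 0))"
      by (simp add: H_def sum_distrib_left del: inner_Pair)
    also have "\<dots> = b * (G z y \<bullet> (0, 1))"
      using z by (subst heat_kernel_heat) (auto simp: G_def inner_prod_def)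
    finally show "(\<Sum>i\<in>Basis. H (i, 0) z y \<bullet> (i, 0)) = b * (G z y \<bullet> (0, 1))" .
  qed
  also have "\<dots> = b * integral ?C (\<lambda>y. G z y \<bullet> (0, 1))" by simp
  also have "\<dots> = b * (integral ?C (G z) \<bullet> (0, 1))"
    by (simp only: integral_component_eq[OF iG])
  also have "\<dots> = b * snd (integral ?C (G z))" by (simp add: inner_prod_def)
  finally show ?thesis using J by (intro exI conjI) (assumption, simp)
qed

section \<open>Mass of the kernel on cubes\<close>

definition heat_kernel_mass :: "'a::euclidean_space itself \<Rightarrow> real \<Rightarrow> real \<Rightarrow> real \<Rightarrow> real" where
  "heat_kernel_mass _ b R s = integral (cbox (- (R *\<^sub>R One)) (R *\<^sub>R One)) (\<lambda>w :: 'a. heat_kernel b (w, s))"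

text \<open>The substitution \<open>w = sqrt s *\<^sub>R x\<close> absorbs the power of
  \<open>s\<close> in the kernel, so the mass depends on \<open>R\<close> and \<open>s\<close> only
  through \<open>R / sqrt s\<close>.\<close>

lemma heat_kernel_mass_scaling:
  assumes s: "s > 0" and R: "R > 0"
  shows "heat_kernel_mass TYPE('a::euclidean_space) b R s =
    integral (cbox (- ((R / sqrt s) *\<^sub>R One)) ((R / sqrt s) *\<^sub>R One)) (\<lambda>w :: 'a. exp (- b * (w \<bullet> w) / 4))"
    (is "_ = integral ?B ?f")
proof -
  define m where "m = 1 / sqrt s"
  have m: "m > 0" "m * m = 1 / s" "m \<noteq> 0" using s by (auto simp: m_def)
  have "?f integrable_on ?B" by (intro integrable_continuous continuous_intros) auto
  then have "((\<lambda>x. ?f (m *\<^sub>R x + 0)) has_integral (1 / (\<bar>m\<bar> ^ DIM('a))) *\<^sub>R integral ?B ?f)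
     ((\<lambda>x. (1 / m) *\<^sub>R x + - ((1 / m) *\<^sub>R 0)) ` ?B)"
    by (intro has_integral_affinity m) (simp add: has_integral_integral)
  moreover have "(\<lambda>x. (1 / m) *\<^sub>R x + - ((1 / m) *\<^sub>R (0::'a))) ` ?B = cbox (- (R *\<^sub>R One)) (R *\<^sub>R One)"
  proof -
    have "?B \<noteq> {}" using s R by (auto simp: box_ne_empty)
    then show ?thesis using m(1) s by (simp add: image_smult_cbox m_def)
  qed
  ultimately have "((\<lambda>x. ?f (m *\<^sub>R x)) has_integral (1 / m ^ DIM('a)) *\<^sub>R integral ?B ?f)
      (cbox (- (R *\<^sub>R One)) (R *\<^sub>R One))" using m by simp
  then have *: "integral (cbox (- (R *\<^sub>R One)) (R *\<^sub>R One)) (\<lambda>x. m ^ DIM('a) * ?f (m *\<^sub>R x)) = integral ?B ?f"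
    using m by (simp add: integral_unique)
  have "m ^ DIM('a) = exp (- (real DIM('a) / 2) * ln s)"
  proof -
    have "m ^ DIM('a) = exp (real DIM('a) * ln m)"
      using m by (simp add: exp_of_nat_mult)
    also have "ln m = - ln s / 2" using s by (simp add: m_def ln_div ln_sqrt)
    finally show ?thesis by simp
  qed
  moreover have "?f (m *\<^sub>R x) = exp (- (b / 4 * (x \<bullet> x) * inverse s))" for x
  proof -
    have "(m *\<^sub>R x) \<bullet> (m *\<^sub>R x) = (m * m) * (x \<bullet> x)" by simp
    also have "\<dots> = (x \<bullet> x) * inverse s" unfolding m(2) by (simp add: divide_inverse)
    finally show ?thesis by (simp del: inner_scaleR_left inner_scaleR_right)
  qed
  ultimately have "m ^ DIM('a) * ?f (m *\<^sub>R x) = heat_kernel b (x, s)" for x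
    by (simp only: heat_kernel_def fst_conv snd_conv exp_add[symmetric] diff_conv_add_uminus)
  from *[unfolded this] show ?thesis by (simp only: heat_kernel_mass_def)
qed

lemma heat_kernel_mass_pos: "R > 0 \<Longrightarrow> heat_kernel_mass TYPE('a::euclidean_space) b R s > 0"
proof -
  assume R: "R > 0"
  let ?B = "cbox (- (R *\<^sub>R One)) (R *\<^sub>R One :: 'a)"
  have c: "continuous_on ?B (\<lambda>w. heat_kernel b (w, s))"
    unfolding heat_kernel_def fst_conv snd_conv by (intro continuous_intros) auto
  have ne: "?B \<noteq> {}" using R by (auto simp: box_ne_empty)
  obtain w0 where w0: "w0 \<in> ?B" "\<And>w. w \<in> ?B \<Longrightarrow> heat_kernel b (w0, s) \<le> heat_kernel b (w, s)"
    using continuous_attains_inf[OF compact_cbox ne c] by blast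
  have "0 < measure lborel ?B * heat_kernel b (w0, s)"
    using R by (intro mult_pos_pos heat_kernel_pos content_pos_lt) auto
  also have "\<dots> = integral ?B (\<lambda>w. heat_kernel b (w0, s))" by simp
  also have "\<dots> \<le> heat_kernel_mass TYPE('a) b R s"
    unfolding heat_kernel_mass_def using w0 by (intro integral_le integrable_continuous c) auto
  finally show ?thesis .
qed

text \<open>Consequently a small cube at a very small time carries at least the mass of a large cube
  at a larger time. \<open>heat_mean\<close> uses this near its initial time.\<close>

lemma heat_kernel_mass_mono:
  assumes "s > 0" "s' > 0" "R > 0" "R' > 0" "R / sqrt s \<le> R' / sqrt s'"
  shows "heat_kernel_mass TYPE('a::euclidean_space) b R s \<le> heat_kernel_mass TYPE('a) b R' s'"
  unfolding heat_kernel_mass_scaling[OF assms(1,3)] heat_kernel_mass_scaling[OF assms(2,4)]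
proof (rule integral_subset_le)
  show "cbox (- ((R / sqrt s) *\<^sub>R One)) ((R / sqrt s) *\<^sub>R One) \<subseteq>
      cbox (- ((R' / sqrt s') *\<^sub>R One)) ((R' / sqrt s') *\<^sub>R One :: 'a)"
    using assms(5) by (intro subset_box_imp) auto
qed (auto intro!: integrable_continuous continuous_intros)

text \<open>
  The caloric polynomial with initial value \<open>\<Sum>\<^sub>i y\<^sub>i\<^sup>4\<close>. As a barrier it is large on the lateral boundary
  of a cylinder, but only of order \<open>h\<^sup>2\<close> at its center after time \<open>h\<close>.
\<close>

lemma heat_polynomial_jet:
  fixes z :: "'a::euclidean_space \<times> real" and x0 :: 'a and \<tau> b :: real
  assumes b: "b > 0"
  defines "E \<equiv> \<lambda>z. \<Sum>i\<in>Basis. ((fst z - x0) \<bullet> i) ^ 4 + 12 * ((snd z - \<tau>) / b) * ((fst z - x0) \<bullet> i)\<^sup>2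
    + 12 * ((snd z - \<tau>) / b)\<^sup>2"
  shows "\<exists>a A. jet2 E z a A \<and> b * snd a = space_trace A"
proof -
  define s where "s z = (snd z - \<tau>) / b" for z :: "'a \<times> real"
  define y where "y i z = (fst z - x0) \<bullet> i" for z :: "'a \<times> real" and i
  define e where "e i z = (y i z) ^ 4 + 12 * s z * (y i z)\<^sup>2 + 12 * (s z)\<^sup>2" for i z
  define F where "F i z = ((4 * (y i z) ^ 3 + 24 * s z * y i z) *\<^sub>R i, (12 * (y i z)\<^sup>2 + 24 * s z) / b)" for i z
  define A where "A i h = (((12 * (y i z)\<^sup>2 + 24 * s z) * (fst h \<bullet> i) + 24 * y i z / b * snd h) *\<^sub>R i,
      (24 * y i z * (fst h \<bullet> i) + 24 * snd h / b) / b)" for i and h :: "'a \<times> real"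
  have j: "jet2 (e i) z (F i z) (A i)" for i
  proof (rule jet2_gradient[where F = "F i"])
    have dy: "(y i has_derivative (\<lambda>h. fst h \<bullet> i)) (at z)" for z
      unfolding y_def by (auto intro!: derivative_eq_intros)
    have ds: "(s has_derivative (\<lambda>h. snd h / b)) (at z)" for z
      unfolding s_def by (auto intro!: derivative_eq_intros simp: divide_inverse)
    note R = has_derivative_add has_derivative_mult has_derivative_Pair has_derivative_scaleR
      has_derivative_divide' has_derivative_const dy ds
    have "(e i has_derivative (\<bullet>) (F i z)) (at z)" for z
      unfolding e_def F_def power2_eq_square power3_eq_cube power4_eq_xxxx
      by (rule has_derivative_eq_rhs, (rule R)+)
        (use b in \<open>auto simp: fun_eq_iff inner_prod_def inner_commute inner_add_right field_simps\<close>)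
    then show "\<forall>\<^sub>F z in nhds z. (e i has_derivative (\<bullet>) (F i z)) (at z)" by simp
    show "(F i has_derivative A i) (at z)"
      unfolding A_def F_def power2_eq_square power3_eq_cube divide_inverse[of _ b]
      by (rule has_derivative_eq_rhs, (rule R)+)
        (use b in \<open>auto simp: fun_eq_iff divide_inverse algebra_simps\<close>)
  qed
  have "jet2 E z (\<Sum>i\<in>Basis. F i z) (\<lambda>h. \<Sum>i\<in>Basis. A i h)"
    using jet2_sum[OF finite_Basis j] by (simp add: E_def e_def y_def s_def)
  moreover have "space_trace (A i) = 12 * (y i z)\<^sup>2 + 24 * s z" if "i \<in> Basis" for i
  proof -
    have "space_trace (A i) = (\<Sum>j\<in>Basis. (12 * (y i z)\<^sup>2 + 24 * s z) * ((j \<bullet> i) * (i \<bullet> j)))"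
      by (simp add: space_trace_def A_def mult.assoc)
    also have "\<dots> = (\<Sum>j\<in>Basis. if j = i then 12 * (y i z)\<^sup>2 + 24 * s z else 0)"
      using that by (intro sum.cong) (auto simp: inner_Basis)
    finally show ?thesis using that by simp
  qed
  then have "space_trace (\<lambda>h. \<Sum>i\<in>Basis. A i h) = (\<Sum>i\<in>Basis. 12 * (y i z)\<^sup>2 + 24 * s z)"
    by (simp add: space_trace_sum)
  moreover have "b * snd (\<Sum>i\<in>Basis. F i z) = (\<Sum>i\<in>Basis. 12 * (y i z)\<^sup>2 + 24 * s z)"
    using b by (simp add: F_def snd_sum sum_distrib_left)
  ultimately show ?thesis by (intro exI conjI) (assumption, simp)
qed

section \<open>Averaging inequality for heat subsolutions\<close>

lemma gauss_potential_continuous: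
  fixes f :: "'a::euclidean_space \<Rightarrow> real"
  assumes f: "continuous_on (cbox p q) f"
  shows "continuous_on {z. snd z > \<tau>} (\<lambda>z. integral (cbox p q) (\<lambda>y. heat_kernel b (z - (y, \<tau>)) * f y))"
proof (rule integral_continuous_on_param)
  let ?W = "{z :: 'a \<times> real. snd z > \<tau>}"
  have cf: "continuous_on (?W \<times> cbox p q) (\<lambda>x. f (snd x))"
    by (rule continuous_on_compose2[OF f]) (auto intro!: continuous_intros)
  have s0: "snd (fst x) - \<tau> \<noteq> 0" "snd (fst x) - \<tau> > 0" if "x \<in> ?W \<times> cbox p q" for x
    using that by auto
  have cg: "continuous_on (?W \<times> cbox p q) (\<lambda>x. heat_kernel b (fst x - (snd x, \<tau>)))"
    unfolding heat_kernel_def using s0 by (auto intro!: continuous_intros)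
  show "continuous_on (?W \<times> cbox p q) (\<lambda>(z, y). heat_kernel b (z - (y, \<tau>)) * f y)"
    unfolding split_beta' by (intro continuous_intros cg cf)
qed

lemma norm_le_cbox_radius:
  fixes x y :: "'a::euclidean_space"
  assumes "y \<in> cbox (x - d *\<^sub>R One) (x + d *\<^sub>R One)"
  shows "norm (y - x) \<le> real DIM('a) * d"
proof -
  have "norm (y - x) \<le> (\<Sum>i\<in>Basis. \<bar>(y - x) \<bullet> i\<bar>)" by (rule norm_le_l1)
  also have "\<dots> \<le> (\<Sum>i\<in>(Basis::'a set). d)"
  proof (rule sum_mono)
    fix i :: 'a assume i: "i \<in> Basis"
    with assms show "\<bar>(y - x) \<bullet> i\<bar> \<le> d"
      by (auto simp: mem_box inner_diff_left inner_add_left abs_le_iff dest!: bspec)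
  qed
  finally show ?thesis by simp
qed

text \<open>Comparison on a half-size cube with the heat potential of the values at time
  \<open>t0 - h\<close>, normalized by the mass at time \<open>h\<close>, plus a multiple of the
  caloric polynomial, which takes care of the lateral boundary. The error of order
  \<open>h\<^sup>2\<close> comes from the value of that polynomial at the center.\<close>

theorem heat_mean:
  fixes v :: "'a::euclidean_space \<times> real \<Rightarrow> real" and x0 :: 'a
  assumes b: "b > 0" and R: "R > 0" and h: "h > 0" and M: "M > 0"
    and cont: "continuous_on (cbox (x0 - R *\<^sub>R One) (x0 + R *\<^sub>R One) \<times> {t0 - h..t0 + h}) v"
    and sub: "subsol (\<lambda>p l. b * p - l) (box (x0 - R *\<^sub>R One) (x0 + R *\<^sub>R One) \<times> {t0 - h<..<t0 + h}) v"
    and bd: "\<And>z. z \<in> cbox (x0 - R *\<^sub>R One) (x0 + R *\<^sub>R One) \<times> {t0 - h..t0 + h} \<Longrightarrow> \<bar>v z\<bar> \<le> M"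
  shows "v (x0, t0) \<le> integral (cbox (- (R *\<^sub>R One)) (R *\<^sub>R One)) (\<lambda>w. heat_kernel b (w, h) * v (x0 - w, t0 - h)) / heat_kernel_mass TYPE('a) b R h
    + 384 * M * DIM('a) * h\<^sup>2 / (b\<^sup>2 * R ^ 4)"
proof -
  define \<tau> where "\<tau> = t0 - h"
  \<comment> \<open>Half the radius, so that around every point of the smaller cube there is room
    for a cube inside the domain of integration.\<close>
  define r where "r = R / 2"
  define B where "B \<rho> x = cbox (x - \<rho> *\<^sub>R One) (x + \<rho> *\<^sub>R One)" for \<rho> and x :: 'a
  define m where "m = heat_kernel_mass TYPE('a) b R h"
  \<comment> \<open>Raising \<open>v\<close> to a nonnegative function makes the potential
    nonnegative and lets its integral be bounded below by integrals over smaller cubes; the constant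
    cancels at the end because the average of \<open>M\<close> is \<open>M\<close>.\<close>
  define u where "u z = v z + M" for z
  define f where "f y = u (y, \<tau>)" for y
  define P where "P z = integral (B R x0) (\<lambda>y. heat_kernel b (z - (y, \<tau>)) * f y)" for z
  define E where "E z = (\<Sum>i\<in>Basis. ((fst z - x0) \<bullet> i) ^ 4 + 12 * ((snd z - \<tau>) / b) * ((fst z - x0) \<bullet> i)\<^sup>2
    + 12 * ((snd z - \<tau>) / b)\<^sup>2)" for z :: "'a \<times> real"
  have m: "m > 0" unfolding m_def by (rule heat_kernel_mass_pos[OF R])
  have r: "r > 0" "r < R" using R by (auto simp: r_def)
  have DIM: "real DIM('a) \<ge> 1" using DIM_positive[where 'a = 'a] by (simp add: Suc_le_eq)
  have Bsub: "B \<rho> x \<subseteq> B R x0" if "x \<in> B r x0" "\<rho> \<le> r" for x \<rho>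
  proof
    fix y assume y: "y \<in> B \<rho> x"
    show "y \<in> B R x0"
      unfolding B_def mem_box
    proof
      fix i :: 'a assume i: "i \<in> Basis"
      have "x0 \<bullet> i - r \<le> x \<bullet> i" "x \<bullet> i \<le> x0 \<bullet> i + r" "x \<bullet> i - \<rho> \<le> y \<bullet> i" "y \<bullet> i \<le> x \<bullet> i + \<rho>"
        using that(1) y i by (auto simp: B_def mem_box inner_diff_left inner_add_left dest!: bspec)
      then show "(x0 - R *\<^sub>R One) \<bullet> i \<le> y \<bullet> i \<and> y \<bullet> i \<le> (x0 + R *\<^sub>R One) \<bullet> i"
        using i that(2) by (simp add: inner_diff_left inner_add_left r_def)
    qed
  qed
  have ctr: "x0 \<in> B r x0" using r by (simp add: B_def mem_box inner_diff_left inner_add_left)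
  have uC: "continuous_on (B R x0 \<times> {\<tau>..t0 + h}) u"
    unfolding u_def B_def \<tau>_def by (intro continuous_intros cont)
  have ubd: "0 \<le> u z" "u z \<le> 2 * M" if "z \<in> B R x0 \<times> {\<tau>..t0 + h}" for z
    using bd[of z] that by (auto simp: u_def B_def \<tau>_def)
  have fC: "continuous_on (B R x0) f"
    unfolding f_def
    by (rule continuous_on_compose2[OF uC]) (use h in \<open>auto intro!: continuous_intros simp: \<tau>_def\<close>)
  have fbd: "0 \<le> f y" if "y \<in> B R x0" for y
    using ubd[of "(y, \<tau>)"] that h by (simp add: f_def \<tau>_def)
  have gC: "continuous_on K (\<lambda>y. heat_kernel b (x - y, s))" for K s and x :: 'a
    unfolding heat_kernel_def fst_conv snd_conv by (intro continuous_intros) auto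
  have fint: "(\<lambda>y. heat_kernel b (x - y, s) * f y) integrable_on B \<rho> y'" if "B \<rho> y' \<subseteq> B R x0" for x s \<rho> y'
    unfolding B_def
    by (intro integrable_continuous continuous_on_mult gC continuous_on_subset[OF fC])
      (use that in \<open>simp add: B_def\<close>)
  have P0: "0 \<le> P z" for z
  proof -
    have "(\<lambda>y. heat_kernel b (z - (y, \<tau>)) * f y) integrable_on B R x0"
      using fint[of R x0 "fst z" "snd z - \<tau>"] by (cases z) simp
    then show ?thesis
      unfolding P_def using fbd by (intro integral_nonneg) (auto intro!: mult_nonneg_nonneg heat_kernel_pos[THEN less_imp_le])
  qed
  have main: "u (x0, t0) \<le> (1 / m) * P (x0, t0) + (2 * M / r ^ 4) * E (x0, t0) + \<eta>" if \<eta>: "\<eta> > 0" for \<eta>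
  proof -
    have "compact (B R x0 \<times> {\<tau>..t0 + h})" unfolding B_def by (intro compact_Times compact_cbox compact_Icc)
    then have "uniformly_continuous_on (B R x0 \<times> {\<tau>..t0 + h}) u"
      by (intro compact_uniformly_continuous uC)
    then obtain d where d: "d > 0" "\<And>z z'. z \<in> B R x0 \<times> {\<tau>..t0 + h} \<Longrightarrow> z' \<in> B R x0 \<times> {\<tau>..t0 + h} \<Longrightarrow>
        dist z' z < d \<Longrightarrow> dist (u z') (u z) < \<eta> / 2"
      using \<eta> unfolding uniformly_continuous_on_def by (metis half_gt_zero)
    define \<delta> where "\<delta> = min r (d / (2 * real DIM('a)))"
    have \<delta>: "\<delta> > 0" "\<delta> \<le> r" "real DIM('a) * \<delta> < d"
    proof -
      show "\<delta> > 0" "\<delta> \<le> r" using r d DIM by (auto simp: \<delta>_def)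
      have "real DIM('a) * \<delta> \<le> real DIM('a) * (d / (2 * real DIM('a)))"
        using DIM by (intro mult_left_mono) (auto simp: \<delta>_def)
      also have "\<dots> = d / 2" using DIM by simp
      finally show "real DIM('a) * \<delta> < d" using d by simp
    qed
    \<comment> \<open>The potential is singular at time \<tau>, so the comparison starts at
      \<open>\<tau> + \<sigma>\<close>. The last bound gives
      \<open>R / sqrt h \<le> \<delta> / sqrt \<sigma>\<close>: at time \<sigma> the cube of radius
      \<delta> alone carries at least the mass \<open>m\<close>.\<close>
    define \<sigma> where "\<sigma> = min (h / 2) (min (d / 2) (h * (\<delta> / R)\<^sup>2))"
    have \<sigma>: "\<sigma> > 0" "\<sigma> \<le> h / 2" "\<sigma> < d" "\<sigma> \<le> h * (\<delta> / R)\<^sup>2"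
      using h d \<delta> R by (auto simp: \<sigma>_def)
    define S where "S z = (1 / m) * P z + (2 * M / r ^ 4) * E z + \<eta>" for z
    define T where "T = t0 + h / 2"
    have E0: "E (x, t) \<ge> 0" if "t \<ge> \<tau>" for x t
      unfolding E_def using that b by (intro sum_nonneg add_nonneg_nonneg mult_nonneg_nonneg) auto
    have box0: "box (x0 - r *\<^sub>R One) (x0 + r *\<^sub>R One) \<noteq> {}"
      using r by (simp add: box_ne_empty inner_diff_left inner_add_left)
    have clU: "closure (box (x0 - r *\<^sub>R One) (x0 + r *\<^sub>R One)) = B r x0"
      unfolding B_def by (rule closure_box[OF box0])
    have "u (x0, t0) \<le> S (x0, t0)"
    proof (rule max_principle[where U = "box (x0 - r *\<^sub>R One) (x0 + r *\<^sub>R One)" and F = "\<lambda>p l. b * p - l"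
          and ?t0.0 = "\<tau> + \<sigma>" and T = T and v = u and S = S])
      have sub0: "B r x0 \<subseteq> B R x0" using Bsub[OF ctr, of r] by simp
      have boxsub: "box (x0 - r *\<^sub>R One) (x0 + r *\<^sub>R One) \<subseteq> box (x0 - R *\<^sub>R One) (x0 + R *\<^sub>R One)"
        using r by (intro subset_box_imp) (auto simp: inner_diff_left inner_add_left)
      have "continuous_on (B r x0 \<times> {\<tau> + \<sigma>..T}) (\<lambda>z. u z - S z)"
        unfolding S_def E_def
      proof (intro continuous_intros)
        show "continuous_on (B r x0 \<times> {\<tau> + \<sigma>..T}) u"
          by (rule continuous_on_subset[OF uC]) (use sub0 \<sigma> h in \<open>auto simp: T_def\<close>)
        show "continuous_on (B r x0 \<times> {\<tau> + \<sigma>..T}) P"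
          using continuous_on_subset[OF gauss_potential_continuous[OF fC[unfolded B_def], of \<tau> b], of "B r x0 \<times> {\<tau> + \<sigma>..T}"] \<sigma>
          unfolding P_def[abs_def] B_def by fastforce
      qed (use b in auto)
      then show "upper_semicontinuous_on (closure (box (x0 - r *\<^sub>R One) (x0 + r *\<^sub>R One)) \<times> {\<tau> + \<sigma>..T}) (\<lambda>z. u z - S z)"
        unfolding clU by (rule continuous_imp_usc)
      show "subsol (\<lambda>p l. b * p - l) (box (x0 - r *\<^sub>R One) (x0 + r *\<^sub>R One) \<times> {\<tau> + \<sigma><..<T}) u"
        unfolding u_def subsol_shift_const
        by (rule subsol_subset[OF sub]) (use boxsub \<sigma> h in \<open>auto simp: \<tau>_def T_def\<close>)
      show "\<exists>a A. superjet S z a A \<and> 0 \<le> b * snd a - space_trace A"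
        if "z \<in> box (x0 - r *\<^sub>R One) (x0 + r *\<^sub>R One) \<times> {\<tau> + \<sigma><..<T}" for z
      proof -
        have zt: "snd z > \<tau>" using that \<sigma> by auto
        obtain a A where aA: "jet2 P z a A" "b * snd a = space_trace A"
          using gauss_potential_jet[OF zt fC[unfolded B_def], of b] unfolding P_def[abs_def] B_def by blast
        obtain c C where cC: "jet2 E z c C" "b * snd c = space_trace C"
          using heat_polynomial_jet[OF b, of x0 \<tau> z] unfolding E_def[abs_def] by blast
        have pos: "1 / m > 0" "2 * M / r ^ 4 > 0" using m M r by auto
        let ?A = "\<lambda>h. (1 / m) *\<^sub>R A h + (2 * M / r ^ 4) *\<^sub>R C h"
        have "superjet (\<lambda>z. (1 / m) * P z + (2 * M / r ^ 4) * E z) z ((1 / m) *\<^sub>R a + (2 * M / r ^ 4) *\<^sub>R c) ?A"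
          by (intro superjet_add superjet_scaleR jet2_superjet aA cC pos)
        then have "superjet S z ((1 / m) *\<^sub>R a + (2 * M / r ^ 4) *\<^sub>R c) ?A"
          unfolding S_def superjet_shift_const .
        moreover have "space_trace ?A = (1 / m) * space_trace A + (2 * M / r ^ 4) * space_trace C"
          by (simp only: space_trace_add space_trace_scaleR)
        ultimately show ?thesis
          by (intro exI conjI) (assumption, simp add: aA(2)[symmetric] cC(2)[symmetric] algebra_simps)
      qed
      show "u (x, \<tau> + \<sigma>) \<le> S (x, \<tau> + \<sigma>)" if "x \<in> closure (box (x0 - r *\<^sub>R One) (x0 + r *\<^sub>R One))" for x
      proof -
        have x: "x \<in> B r x0" using that clU by simp
        have xR: "x \<in> B R x0" using sub0 x by blast
        have sB: "B \<delta> x \<subseteq> B R x0" by (rule Bsub[OF x \<delta>(2)])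
        have u1: "u (x, \<tau> + \<sigma>) < f x + \<eta> / 2"
        proof -
          have "dist (u (x, \<tau> + \<sigma>)) (u (x, \<tau>)) < \<eta> / 2"
            using xR \<sigma> h by (intro d) (auto simp: \<tau>_def dist_Pair_Pair dist_real_def)
          then show ?thesis unfolding f_def dist_real_def by linarith
        qed
        \<comment> \<open>Near \<open>x\<close> the data are at least
          \<open>f x - \<eta> / 2\<close> and the mass there is at least \<open>m\<close>; the rest
          of the integral is nonnegative.\<close>
        have P1: "(f x - \<eta> / 2) * m \<le> P (x, \<tau> + \<sigma>)"
        proof (cases "f x \<le> \<eta> / 2")
          case True
          then have "(f x - \<eta> / 2) * m \<le> 0" using m by (intro mult_nonpos_nonneg) auto
          with P0[of "(x, \<tau> + \<sigma>)"] show ?thesis by linarith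
        next
          case False
          have "R / sqrt h \<le> \<delta> / sqrt \<sigma>"
          proof -
            have "sqrt \<sigma> \<le> sqrt (h * (\<delta> / R)\<^sup>2)" using \<sigma> by simp
            also have "\<dots> = sqrt h * (\<delta> / R)" using \<delta> R by (simp add: real_sqrt_mult)
            finally show ?thesis using \<sigma> h R \<delta> by (simp add: field_simps)
          qed
          then have "m \<le> heat_kernel_mass TYPE('a) b \<delta> \<sigma>"
            unfolding m_def using \<sigma> h R \<delta> by (intro heat_kernel_mass_mono) auto
          also have "\<dots> = integral (cbox (- (\<delta> *\<^sub>R One)) (\<delta> *\<^sub>R One)) (\<lambda>w. heat_kernel b (x - (x - w), \<sigma>))"
            by (simp add: heat_kernel_mass_def)
          also have "\<dots> = integral (B \<delta> x) (\<lambda>y. heat_kernel b (x - y, \<sigma>))"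
            using integral_reflect_shift[of "\<lambda>y. heat_kernel b (x - y, \<sigma>)" x "\<delta> *\<^sub>R One" "- (\<delta> *\<^sub>R One)"]
            by (simp add: B_def integrable_continuous gC)
          finally have "(f x - \<eta> / 2) * m \<le> (f x - \<eta> / 2) * integral (B \<delta> x) (\<lambda>y. heat_kernel b (x - y, \<sigma>))"
            using False by (intro mult_left_mono) auto
          also have "\<dots> = integral (B \<delta> x) (\<lambda>y. (f x - \<eta> / 2) * heat_kernel b (x - y, \<sigma>))" by simp
          also have "\<dots> \<le> integral (B \<delta> x) (\<lambda>y. heat_kernel b (x - y, \<sigma>) * f y)"
          proof (rule integral_le)
            show "(\<lambda>y. (f x - \<eta> / 2) * heat_kernel b (x - y, \<sigma>)) integrable_on B \<delta> x"
              unfolding B_def by (intro integrable_continuous continuous_intros gC)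
            show "(\<lambda>y. heat_kernel b (x - y, \<sigma>) * f y) integrable_on B \<delta> x" by (rule fint[OF sB])
            fix y assume y: "y \<in> B \<delta> x"
            have "norm (y - x) < d" using norm_le_cbox_radius[of y x \<delta>] y \<delta>(3) by (simp add: B_def)
            then have "dist (y, \<tau>) (x, \<tau>) < d" by (simp add: dist_Pair_Pair dist_norm)
            then have "dist (f y) (f x) < \<eta> / 2"
              unfolding f_def using y sB xR h by (intro d) (auto simp: \<tau>_def)
            then have "f x - \<eta> / 2 \<le> f y" unfolding dist_real_def by linarith
            then show "(f x - \<eta> / 2) * heat_kernel b (x - y, \<sigma>) \<le> heat_kernel b (x - y, \<sigma>) * f y"
              using heat_kernel_pos[of b "(x - y, \<sigma>)"] by (simp add: mult.commute)
          qed
          also have "\<dots> \<le> P (x, \<tau> + \<sigma>)"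
            unfolding P_def diff_Pair add_diff_cancel_left'
            using sB fbd by (intro integral_subset_le fint) (auto intro!: mult_nonneg_nonneg heat_kernel_pos[THEN less_imp_le])
          finally show ?thesis .
        qed
        have "f x - \<eta> / 2 \<le> (1 / m) * P (x, \<tau> + \<sigma>)" using P1 m by (simp add: field_simps)
        moreover have "(2 * M / r ^ 4) * E (x, \<tau> + \<sigma>) \<ge> 0" using E0[of "\<tau> + \<sigma>" x] \<sigma> M by simp
        ultimately show ?thesis using u1 unfolding S_def by linarith
      qed
      show "u (x, t) \<le> S (x, t)"
        if x: "x \<in> frontier (box (x0 - r *\<^sub>R One) (x0 + r *\<^sub>R One))" and t: "\<tau> + \<sigma> \<le> t" "t \<le> T" for x t
      proof -
        have xb: "x \<in> B r x0" "x \<notin> box (x0 - r *\<^sub>R One) (x0 + r *\<^sub>R One)"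
          using x unfolding frontier_def clU by (auto simp: interior_open open_box)
        then obtain i where i: "i \<in> Basis" "\<not> (x0 \<bullet> i - r < x \<bullet> i \<and> x \<bullet> i < x0 \<bullet> i + r)"
          by (auto simp: mem_box inner_diff_left inner_add_left)
        moreover have "x0 \<bullet> i - r \<le> x \<bullet> i" "x \<bullet> i \<le> x0 \<bullet> i + r"
          using xb(1) i(1) by (auto simp: B_def mem_box inner_diff_left inner_add_left dest!: bspec)
        \<comment> \<open>On a face of the cube a single coordinate already contributes
          \<open>r ^ 4\<close> to \<open>E\<close>, so the multiple \<open>2 * M / r ^ 4\<close>
          dominates \<open>u\<close> there.\<close>
        ultimately have "\<bar>(x - x0) \<bullet> i\<bar> = r" by (auto simp: inner_diff_left)
        then have "((x - x0) \<bullet> i) ^ 4 = r ^ 4" using power_even_abs[of 4 "(x - x0) \<bullet> i"] by simp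
        moreover have "((x - x0) \<bullet> i) ^ 4 \<le> ((x - x0) \<bullet> i) ^ 4 + 12 * ((t - \<tau>) / b) * ((x - x0) \<bullet> i)\<^sup>2
            + 12 * ((t - \<tau>) / b)\<^sup>2"
          using t \<sigma> b by simp
        moreover have "\<dots> \<le> E (x, t)"
          unfolding E_def fst_conv snd_conv
          using t \<sigma> b i(1)
          by (intro member_le_sum[where f = "\<lambda>i. ((x - x0) \<bullet> i) ^ 4 + 12 * ((t - \<tau>) / b) * ((x - x0) \<bullet> i)\<^sup>2
            + 12 * ((t - \<tau>) / b)\<^sup>2"]) auto
        ultimately have "r ^ 4 \<le> E (x, t)" by linarith
        then have "2 * M \<le> (2 * M / r ^ 4) * E (x, t)" using M r by (simp add: field_simps)
        moreover have "u (x, t) \<le> 2 * M"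
          using xb(1) sub0 t \<sigma> h by (intro ubd) (auto simp: T_def)
        moreover have "(1 / m) * P (x, t) \<ge> 0" using P0 m by simp
        ultimately show ?thesis using \<eta> unfolding S_def by linarith
      qed
      show "x0 \<in> closure (box (x0 - r *\<^sub>R One) (x0 + r *\<^sub>R One))" using ctr clU by simp
      show "\<tau> + \<sigma> \<le> t0" using \<sigma> h by (simp add: \<tau>_def)
      show "0 < b * (p + c) - l" if "c > 0" "0 \<le> b * p - l" for p l c
        using mult_pos_pos[OF b that(1)] that(2) by (simp add: algebra_simps)
    qed (use h in \<open>auto simp: T_def\<close>)
    then show ?thesis by (simp add: S_def)
  qed
  have u0: "u (x0, t0) \<le> (1 / m) * P (x0, t0) + (2 * M / r ^ 4) * E (x0, t0)"
    by (rule field_le_epsilon) (rule main)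
  have "P (x0, t0) = integral (cbox (- (R *\<^sub>R One)) (R *\<^sub>R One)) (\<lambda>w. heat_kernel b (x0 - (x0 - w), h) * f (x0 - w))"
    using integral_reflect_shift[of "\<lambda>y. heat_kernel b (x0 - y, h) * f y" x0 "R *\<^sub>R One" "- (R *\<^sub>R One)"] fint[of R x0 x0 h]
    by (simp add: P_def \<tau>_def B_def)
  also have "\<dots> = integral (cbox (- (R *\<^sub>R One)) (R *\<^sub>R One)) (\<lambda>w. heat_kernel b (w, h) * v (x0 - w, t0 - h) + M * heat_kernel b (w, h))"
    by (simp add: f_def u_def \<tau>_def algebra_simps)
  also have "\<dots> = integral (cbox (- (R *\<^sub>R One)) (R *\<^sub>R One)) (\<lambda>w. heat_kernel b (w, h) * v (x0 - w, t0 - h)) + M * m"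
  proof -
    let ?Q = "cbox (- (R *\<^sub>R One)) (R *\<^sub>R One) :: 'a set"
    have g: "continuous_on ?Q (\<lambda>w. heat_kernel b (w, h))"
      unfolding heat_kernel_def fst_conv snd_conv by (intro continuous_intros) auto
    have "x0 - w \<in> B R x0" if "w \<in> ?Q" for w
      using that unfolding B_def mem_box by (auto simp: inner_diff_left inner_add_left)
    then have "continuous_on ?Q (\<lambda>w. v (x0 - w, t0 - h))"
      using h by (intro continuous_on_compose2[OF cont]) (auto intro!: continuous_intros simp: B_def)
    then have "(\<lambda>w. heat_kernel b (w, h) * v (x0 - w, t0 - h)) integrable_on ?Q"
      by (intro integrable_continuous continuous_intros g)
    moreover have "(\<lambda>w. M * heat_kernel b (w, h)) integrable_on ?Q"
      by (intro integrable_continuous continuous_intros g)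
    ultimately show ?thesis by (simp add: integral_add m_def heat_kernel_mass_def)
  qed
  finally have P: "P (x0, t0) = \<dots>" .
  have E: "E (x0, t0) = real DIM('a) * (12 * (h / b)\<^sup>2)" by (simp add: E_def \<tau>_def)
  have "(1 / m) * P (x0, t0) = integral (cbox (- (R *\<^sub>R One)) (R *\<^sub>R One)) (\<lambda>w. heat_kernel b (w, h) * v (x0 - w, t0 - h)) / m + M"
    unfolding P using m by (simp add: field_simps)
  \<comment> \<open>Here \<open>384 = 2 * 12 * 2 ^ 4\<close>, the power of 2 coming from
    \<open>r = R / 2\<close>.\<close>
  moreover have "(2 * M / r ^ 4) * E (x0, t0) = 384 * M * DIM('a) * h\<^sup>2 / (b\<^sup>2 * R ^ 4)"
    unfolding E r_def by (simp add: power_divide mult_ac)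
  ultimately show ?thesis using u0 by (simp add: u_def m_def)
qed

lemma norm_Pair_le_cbox:
  fixes w :: "'a::euclidean_space"
  assumes "w \<in> cbox (x - R *\<^sub>R One) (x + R *\<^sub>R One)" "\<bar>s - t\<bar> \<le> h"
  shows "dist (x, t) (w, s) \<le> real DIM('a) * R + h"
proof -
  have "dist (x, t) (w, s) = norm ((w - x), (s - t))" by (subst dist_commute) (simp add: dist_norm)
  also have "\<dots> \<le> norm (w - x) + norm (s - t)" by (rule norm_Pair_le)
  finally show ?thesis using norm_le_cbox_radius[OF assms(1)] assms(2) by simp
qed

text \<open>The same at a space-time point with the cylinder placed inside a ball, the form needed
  under a convolution.\<close>

lemma heat_mean_point:
  fixes v :: "'a::euclidean_space \<times> real \<Rightarrow> real"
  assumes b: "b > 0" and R: "R > 0" and h: "h > 0" and M: "M > 0" and d: "real DIM('a) * R + h < d"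
    and cont: "continuous_on (ball y d) v"
    and sub: "subsol (\<lambda>p l. b * p - l) (ball y d) v"
    and bd: "\<And>z. z \<in> ball y d \<Longrightarrow> \<bar>v z\<bar> \<le> M"
  shows "v y \<le> integral (cbox (- (R *\<^sub>R One)) (R *\<^sub>R One)) (\<lambda>w. heat_kernel b (w, h) * v (y - (w, h))) / heat_kernel_mass TYPE('a) b R h
    + 384 * M * DIM('a) * h\<^sup>2 / (b\<^sup>2 * R ^ 4)"
proof -
  obtain x t where y: "y = (x, t)" by (cases y)
  have s: "cbox (x - R *\<^sub>R One) (x + R *\<^sub>R One) \<times> {t - h..t + h} \<subseteq> ball y d"
  proof
    fix z assume z: "z \<in> cbox (x - R *\<^sub>R One) (x + R *\<^sub>R One) \<times> {t - h..t + h}"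
    obtain w s where ws: "z = (w, s)" by (cases z)
    have "dist (x, t) (w, s) \<le> real DIM('a) * R + h"
      using z ws by (intro norm_Pair_le_cbox) auto
    then show "z \<in> ball y d" using d by (simp add: y ws)
  qed
  have s': "box (x - R *\<^sub>R One) (x + R *\<^sub>R One) \<times> {t - h<..<t + h} \<subseteq> ball y d"
    using s box_subset_cbox[of "x - R *\<^sub>R One" "x + R *\<^sub>R One"] by fastforce
  have bd': "\<bar>v z\<bar> \<le> M" if "z \<in> cbox (x - R *\<^sub>R One) (x + R *\<^sub>R One) \<times> {t - h..t + h}" for z
    using s that by (intro bd) blast
  show ?thesis
    using heat_mean[OF b R h M continuous_on_subset[OF cont s] subsol_subset[OF sub s'] bd']
    by (simp add: y)
qed

section \<open>Mollification\<close>

text \<open>The delicate point is 0, where the difference quotient is at most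
  \<open>\<bar>h\<bar> ^ Suc n\<close> in absolute value.\<close>

lemma max_power_deriv:
  "((\<lambda>u::real. (max 0 u) ^ Suc (Suc n)) has_real_derivative real (Suc (Suc n)) * (max 0 u) ^ Suc n) (at u)"
proof -
  consider "u > 0" | "u < 0" | "u = 0" by linarith
  then show ?thesis
  proof cases
    case 1
    have "((\<lambda>u::real. u ^ Suc (Suc n)) has_real_derivative real (Suc (Suc n)) * (max 0 u) ^ Suc n) (at u)"
      using 1 DERIV_pow[of "Suc (Suc n)" u] by (simp add: max_def)
    then show ?thesis
      by (rule has_field_derivative_transform_within_open[where S = "{0<..}"]) (use 1 in \<open>auto simp: max_def\<close>)
  next
    case 2
    have "((\<lambda>u::real. 0) has_real_derivative real (Suc (Suc n)) * (max 0 u) ^ Suc n) (at u)"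
      using 2 by (auto intro!: derivative_eq_intros simp: max_def)
    then show ?thesis
      by (rule has_field_derivative_transform_within_open[where S = "{..<0}"]) (use 2 in \<open>auto simp: max_def\<close>)
  next
    case 3
    have "(\<lambda>h::real. (max 0 (0 + h) ^ Suc (Suc n) - max 0 0 ^ Suc (Suc n)) / h) \<midarrow>0\<rightarrow> 0"
    proof (rule Lim_null_comparison)
      show "\<forall>\<^sub>F h::real in at 0. norm ((max 0 (0 + h) ^ Suc (Suc n) - max 0 0 ^ Suc (Suc n)) / h) \<le> \<bar>h\<bar> ^ Suc n"
        by (intro always_eventually allI) (auto simp: max_def abs_mult power_abs mult_nonpos_nonneg)
      show "(\<lambda>h::real. \<bar>h\<bar> ^ Suc n) \<midarrow>0\<rightarrow> 0"
        by (rule tendsto_eq_intros refl | simp)+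
    qed
    then show ?thesis by (simp add: 3 DERIV_def)
  qed
qed

text \<open>Jets ask for two derivatives, so the cube of a positive part is regular enough as a
  mollifying kernel, and its gradient and Hessian are explicit.\<close>

definition bump :: "real \<Rightarrow> 'b::euclidean_space \<Rightarrow> real" where
  "bump r z = (max 0 (1 - (z \<bullet> z) / r\<^sup>2)) ^ 3"

definition bump_grad :: "real \<Rightarrow> 'b::euclidean_space \<Rightarrow> 'b" where
  "bump_grad r z = (- (6 / r\<^sup>2) * (max 0 (1 - (z \<bullet> z) / r\<^sup>2))\<^sup>2) *\<^sub>R z"

definition bump_hess :: "real \<Rightarrow> 'b::euclidean_space \<Rightarrow> 'b \<Rightarrow> 'b" where
  "bump_hess r j z = (- (6 / r\<^sup>2) * (max 0 (1 - (z \<bullet> z) / r\<^sup>2))\<^sup>2) *\<^sub>R j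
    + (24 / r ^ 4 * max 0 (1 - (z \<bullet> z) / r\<^sup>2) * (z \<bullet> j)) *\<^sub>R z"

lemma bump_has_gradient: "(bump r has_derivative (\<lambda>h. bump_grad r z \<bullet> h)) (at z)"
proof -
  have u: "((\<lambda>z :: 'a. 1 - (z \<bullet> z) / r\<^sup>2) has_derivative (\<lambda>h. - (2 * (z \<bullet> h) / r\<^sup>2))) (at z)"
  proof -
    have "((\<lambda>z :: 'a. 1 - (z \<bullet> z) * (1 / r\<^sup>2)) has_derivative (\<lambda>h. 0 - (z \<bullet> h + h \<bullet> z) * (1 / r\<^sup>2))) (at z)"
      by (intro has_derivative_diff has_derivative_const has_derivative_mult_left has_derivative_inner has_derivative_ident)
    then show ?thesis by (simp add: inner_commute)
  qed
  have p: "((\<lambda>u::real. (max 0 u) ^ 3) has_derivative (\<lambda>h. 3 * (max 0 w)\<^sup>2 * h)) (at w)" for w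
    using max_power_deriv[of 1 w] by (simp add: has_field_derivative_def numeral_3_eq_3 numeral_2_eq_2)
  from has_derivative_compose[OF u p]
  show ?thesis unfolding bump_def[abs_def]
    by (rule has_derivative_eq_rhs) (simp add: fun_eq_iff bump_grad_def)
qed

lemma bump_grad_has_gradient: "((\<lambda>z. bump_grad r z \<bullet> j) has_derivative (\<lambda>h. bump_hess r j z \<bullet> h)) (at z)"
proof -
  have u: "((\<lambda>z :: 'a. 1 - (z \<bullet> z) / r\<^sup>2) has_derivative (\<lambda>h. - (2 * (z \<bullet> h) / r\<^sup>2))) (at z)"
  proof -
    have "((\<lambda>z :: 'a. 1 - (z \<bullet> z) * (1 / r\<^sup>2)) has_derivative (\<lambda>h. 0 - (z \<bullet> h + h \<bullet> z) * (1 / r\<^sup>2))) (at z)"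
      by (intro has_derivative_diff has_derivative_const has_derivative_mult_left has_derivative_inner has_derivative_ident)
    then show ?thesis by (simp add: inner_commute)
  qed
  have p: "((\<lambda>u::real. (max 0 u)\<^sup>2) has_derivative (\<lambda>h. 2 * max 0 w * h)) (at w)" for w
    using max_power_deriv[of 0 w] by (simp add: has_field_derivative_def numeral_2_eq_2)
  have j: "((\<lambda>z. z \<bullet> j) has_derivative (\<lambda>h. h \<bullet> j)) (at z)"
    by (auto intro!: derivative_eq_intros)
  from has_derivative_mult[OF has_derivative_mult_right[OF has_derivative_compose[OF u p], of "- (6 / r\<^sup>2)"] j]
  show ?thesis unfolding bump_grad_def[abs_def] inner_scaleR_left
    by (rule has_derivative_eq_rhs)
      (simp add: fun_eq_iff bump_hess_def inner_add_left inner_diff_left inner_diff_right inner_commute power2_eq_square power4_eq_xxxx mult_ac)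
qed

lemma bump_nonneg: "bump r z \<ge> 0"
  by (simp add: bump_def)

lemma bump_support:
  assumes "r > 0" "z \<notin> cbox (- (r *\<^sub>R One)) (r *\<^sub>R One)"
  shows "bump r z = 0"
proof -
  obtain i where i: "i \<in> Basis" "\<bar>z \<bullet> i\<bar> > r"
    using assms(2) by (force simp: mem_box abs_le_iff not_le)
  then have "norm z > r" using Basis_le_norm[OF i(1), of z] by linarith
  then have "z \<bullet> z \<ge> r\<^sup>2"
    using assms(1) by (simp add: power2_norm_eq_inner[symmetric] power_mono)
  then show ?thesis using assms(1) by (simp add: bump_def max_def divide_simps)
qed

lemma continuous_on_bump:
  assumes "r \<noteq> 0" "continuous_on S f"
  shows "continuous_on S (\<lambda>x. bump r (f x))" "continuous_on S (\<lambda>x. bump_grad r (f x))" "continuous_on S (\<lambda>x. bump_hess r j (f x))"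
  unfolding bump_def bump_grad_def bump_hess_def using assms by (auto intro!: continuous_intros)

text \<open>Left unnormalized: linear inequalities with zero right-hand side do not notice a
  positive factor, and division by the mass is postponed to \<open>mollify_approx\<close>.\<close>

definition mollify :: "real \<Rightarrow> ('b::euclidean_space \<Rightarrow> real) \<Rightarrow> 'b \<Rightarrow> real" where
  "mollify r v z = integral (cbox (- (r *\<^sub>R One)) (r *\<^sub>R One)) (\<lambda>y. bump r y * v (z - y))"

text \<open>Moves the dependence on \<open>z\<close> from \<open>v\<close>, which is only
  continuous, to the bump, and makes the domain of integration the same for all \<open>z\<close>
  near \<open>z0\<close>; both prepare differentiation under the integral.\<close>

lemma mollify_fixed_domain:
  fixes v :: "'b::euclidean_space \<Rightarrow> real"
  assumes r: "r > 0" and v: "continuous_on UNIV v" and z: "z \<in> box (z0 - r *\<^sub>R One) (z0 + r *\<^sub>R One)"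
  shows "mollify r v z = integral (cbox (z0 - (2 * r) *\<^sub>R One) (z0 + (2 * r) *\<^sub>R One)) (\<lambda>y. bump r (z - y) * v y)"
proof -
  let ?f = "\<lambda>y. bump r (z - y) * v y"
  have c: "continuous_on S ?f" for S
    using r by (intro continuous_intros continuous_on_bump continuous_on_subset[OF v]) auto
  have "mollify r v z = integral (cbox (- (r *\<^sub>R One)) (r *\<^sub>R One)) (\<lambda>y. ?f (z - y))"
    by (simp add: mollify_def)
  also have "\<dots> = integral (cbox (z - r *\<^sub>R One) (z - - (r *\<^sub>R One))) ?f"
    by (intro integral_reflect_shift integrable_continuous c)
  also have "\<dots> = integral (cbox (z0 - (2 * r) *\<^sub>R One) (z0 + (2 * r) *\<^sub>R One)) ?f"
  proof (rule integral_unique[symmetric], rule has_integral_on_superset)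
    show "(?f has_integral integral (cbox (z - r *\<^sub>R One) (z - - (r *\<^sub>R One))) ?f) (cbox (z - r *\<^sub>R One) (z - - (r *\<^sub>R One)))"
      by (intro integrable_integral integrable_continuous c)
    show "?f y = 0" if "y \<notin> cbox (z - r *\<^sub>R One) (z - - (r *\<^sub>R One))" for y
    proof -
      have "z - y \<notin> cbox (- (r *\<^sub>R One)) (r *\<^sub>R One)"
        using that by (force simp: mem_box inner_diff_left inner_add_left)
      from bump_support[OF r this] show ?thesis by simp
    qed
    show "cbox (z - r *\<^sub>R One) (z - - (r *\<^sub>R One)) \<subseteq> cbox (z0 - (2 * r) *\<^sub>R One) (z0 + (2 * r) *\<^sub>R One)"
    proof (intro subset_box_imp ballI)
      fix i :: 'b assume i: "i \<in> Basis"
      have "z0 \<bullet> i - r < z \<bullet> i" "z \<bullet> i < z0 \<bullet> i + r"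
        using z i by (auto simp: mem_box inner_diff_left inner_add_left dest!: bspec)
      then show "(z0 - (2 * r) *\<^sub>R One) \<bullet> i \<le> (z - r *\<^sub>R One) \<bullet> i \<and> (z - - (r *\<^sub>R One)) \<bullet> i \<le> (z0 + (2 * r) *\<^sub>R One) \<bullet> i"
        using i by (simp add: inner_diff_left inner_add_left)
    qed
  qed
  finally show ?thesis .
qed

lemma jet2_cong:
  assumes "open W" "z \<in> W" "\<And>y. y \<in> W \<Longrightarrow> f y = g y" "jet2 g z a A"
  shows "jet2 f z a A"
proof -
  have "\<forall>\<^sub>F y in nhds z. f y = g y"
    using eventually_nhds_in_open[OF assms(1,2)] by eventually_elim (rule assms(3))
  then have e: "\<forall>\<^sub>F h in nhds 0. f (z + h) = g (z + h)"
    using eventually_nhds_shift[of "\<lambda>y. f y = g y" z] by simp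
  have fz: "f z = g z" using assms by simp
  have "superjet f z a A"
    by (rule superjet_touch[OF jet2_superjet[OF assms(4)]]) (use e in eventually_elim, simp add: fz)
  moreover have "superjet (\<lambda>y. - f y) z (- a) (\<lambda>h. - A h)"
    by (rule superjet_touch[OF jet2_superjet[OF jet2_minus[OF assms(4)]]]) (use e in eventually_elim, simp add: fz)
  ultimately show ?thesis by (simp add: jet2_def)
qed

lemma mollify_jet:
  fixes v :: "'b::euclidean_space \<Rightarrow> real"
  assumes r: "r > 0" and v: "continuous_on UNIV v"
  shows "\<exists>a A. jet2 (mollify r v) z a A"
proof -
  let ?W = "box (z - r *\<^sub>R One) (z + r *\<^sub>R One)" and ?C = "cbox (z - (2 * r) *\<^sub>R One) (z + (2 * r) *\<^sub>R One)"
  have z: "z \<in> ?W" using r by (simp add: mem_box inner_diff_left inner_add_left)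
  have cv: "continuous_on S (\<lambda>x. v (snd x))" for S :: "('b \<times> 'b) set"
    by (rule continuous_on_compose2[OF v]) (auto intro!: continuous_intros)
  define G where "G y t = v t *\<^sub>R bump_grad r (y - t)" for y t
  define H where "H j y t = v t *\<^sub>R bump_hess r j (y - t)" for j y t
  have "jet2 (\<lambda>y. integral ?C (\<lambda>t. bump r (y - t) * v t)) z (integral ?C (G z))
      (\<lambda>h. \<Sum>j\<in>Basis. (integral ?C (H j z) \<bullet> h) *\<^sub>R j)"
  proof (rule jet2_integral[OF open_box z])
    fix y t :: 'b
    have "((\<lambda>y. v t * bump r (y - t)) has_derivative (\<lambda>h. v t * (bump_grad r (y - t) \<bullet> h))) (at y)"
      by (intro has_derivative_mult_right has_derivative_shift bump_has_gradient)
    moreover have "(\<bullet>) (G y t) = (\<lambda>h. v t * (bump_grad r (y - t) \<bullet> h))" by (simp add: G_def fun_eq_iff)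
    ultimately show "((\<lambda>y. bump r (y - t) * v t) has_derivative (\<bullet>) (G y t)) (at y)"
      by (simp only: mult.commute[of _ "v t"])
    fix j :: 'b
    have "((\<lambda>y. v t * (bump_grad r (y - t) \<bullet> j)) has_derivative (\<lambda>h. v t * (bump_hess r j (y - t) \<bullet> h))) (at y)"
      by (intro has_derivative_mult_right has_derivative_shift[where f = "\<lambda>y. bump_grad r y \<bullet> j"] bump_grad_has_gradient)
    moreover have "(\<bullet>) (H j y t) = (\<lambda>h. v t * (bump_hess r j (y - t) \<bullet> h))" by (simp add: H_def fun_eq_iff)
    moreover have "G y t \<bullet> j = v t * (bump_grad r (y - t) \<bullet> j)" for y by (simp add: G_def)
    ultimately show "((\<lambda>y. G y t \<bullet> j) has_derivative (\<bullet>) (H j y t)) (at y)"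
      by (simp only:)
  qed (use r in \<open>auto simp: split_beta' G_def H_def intro!: continuous_intros continuous_on_bump cv\<close>)
  from jet2_cong[OF open_box z mollify_fixed_domain[OF r v] this] show ?thesis by blast
qed

lemma mollify_const_mass_pos:
  assumes r: "r > 0"
  shows "integral (cbox (- (r *\<^sub>R One)) (r *\<^sub>R One)) (bump r :: 'b::euclidean_space \<Rightarrow> real) > 0"
proof -
  let ?C = "cbox (- (r *\<^sub>R One)) (r *\<^sub>R One) :: 'b set"
  have c: "continuous_on S (bump r :: 'b \<Rightarrow> real)" for S
    using continuous_on_bump(1)[of r S "\<lambda>x. x"] r by auto
  \<comment> \<open>A cube of this radius lies in the ball of radius \<open>r / 2\<close>, where the
    bump is at least 1/8.\<close>
  define d where "d = r / (2 * real DIM('b))"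
  have DIM: "real DIM('b) \<ge> 1" using DIM_positive[where 'a = 'b] by (simp add: Suc_le_eq)
  have d: "d > 0" "d \<le> r" "real DIM('b) * d = r / 2"
  proof -
    show "d > 0" "real DIM('b) * d = r / 2" using r DIM by (auto simp: d_def)
    have "r * 1 \<le> r * (2 * real DIM('b))" using r DIM by (intro mult_left_mono) linarith+
    then show "d \<le> r" using DIM by (simp add: d_def divide_simps)
  qed
  let ?D = "cbox (- (d *\<^sub>R One)) (d *\<^sub>R One) :: 'b set"
  have "0 < measure lborel ?D * (1 / 8)"
    using d by (intro mult_pos_pos content_pos_lt) auto
  also have "\<dots> = integral ?D (\<lambda>w. 1 / 8)" by simp
  also have "\<dots> \<le> integral ?D (bump r)"
  proof (intro integral_le integrable_continuous c continuous_intros)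
    fix w assume w: "w \<in> ?D"
    have "norm w \<le> r / 2" using norm_le_cbox_radius[of w 0 d] w d(3) by simp
    then have "(norm w)\<^sup>2 \<le> (r / 2)\<^sup>2" by (intro power_mono) auto
    then have "w \<bullet> w / r\<^sup>2 \<le> 1 / 2"
      using r by (simp add: power2_norm_eq_inner power_divide divide_simps) (smt (verit) zero_le_power2)
    then have "1 / 2 \<le> max 0 (1 - (w \<bullet> w) / r\<^sup>2)" by linarith
    then have "(1 / 2) ^ 3 \<le> (max 0 (1 - (w \<bullet> w) / r\<^sup>2)) ^ 3" by (rule power_mono) simp
    moreover have "(1 / 2 :: real) ^ 3 = 1 / 8" by (simp add: power_divide)
    ultimately show "1 / 8 \<le> bump r w" by (simp only: bump_def)
  qed
  also have "\<dots> \<le> integral ?C (bump r)"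
    using d by (intro integral_subset_le integrable_continuous c subset_box_imp) (auto intro: bump_nonneg)
  finally show ?thesis .
qed

text \<open>
  If the inequality failed at \<open>z\<close>, the second-order Taylor polynomial of the mollification, slightly
  perturbed, would be a strict classical supersolution near \<open>z\<close>, and its heat average over a step \<open>h\<close>
  would lie below its value at \<open>z\<close> by an amount of order \<open>h\<close>; for the mollification itself the
  averaging inequality holds up to \<open>O(h\<^sup>2)\<close>, because it commutes with mollification. In particular no
  moments of the kernel have to be computed.
\<close>

theorem mollify_heat_subsolution:
  fixes v :: "'a::euclidean_space \<times> real \<Rightarrow> real"
  assumes b: "b > 0" and r: "r > 0" and \<delta>: "\<delta> > 0" and v: "continuous_on UNIV v"
    and sub: "subsol (\<lambda>p l. b * p - l) (ball z (real DIM('a \<times> real) * r + \<delta>)) v"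
    and jet: "jet2 (mollify r v) z a A"
  shows "b * snd a \<le> space_trace A"
proof (rule ccontr)
  assume "\<not> b * snd a \<le> space_trace A"
  define \<kappa> where "\<kappa> = b * snd a - space_trace A"
  have \<kappa>: "\<kappa> > 0" using \<open>\<not> b * snd a \<le> space_trace A\<close> by (simp add: \<kappa>_def)
  define N where "N = real DIM('a)"
  have N: "N \<ge> 1" using DIM_positive[where 'a = 'a] by (simp add: N_def Suc_le_eq)
  \<comment> \<open>The defect \<kappa> is split: a quarter pays for enlarging the spatial Hessian,
    a quarter for tilting the time slope by \<theta>, and half for the variation of the slope near
    \<open>z\<close>.\<close>
  define \<eta> where "\<eta> = \<kappa> / (8 * N)"
  define \<theta> where "\<theta> = \<kappa> / (4 * b)"
  have \<eta>: "\<eta> > 0" "2 * \<eta> * N = \<kappa> / 4" using \<kappa> N by (auto simp: \<eta>_def)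
  have \<theta>: "\<theta> > 0" "b * \<theta> = \<kappa> / 4" using \<kappa> b by (auto simp: \<theta>_def)
  define \<phi> where "\<phi> = mollify r v"
  have linA: "linear A" using jet superjet_linear by (auto simp: jet2_def)
  \<comment> \<open>\<open>p\<close> below is minus the perturbed Taylor polynomial. The sign makes
    it a subsolution, so the averaging inequality holds for \<open>p\<close> and for \<phi> alike;
    adding the two gives the contradiction.\<close>
  define a' where "a' = - (a - (0, \<theta>))"
  define A' where "A' h = - (A h + ((2 * \<eta>) *\<^sub>R fst h, 0))" for h :: "'a \<times> real"
  have lin2: "linear (\<lambda>h :: 'a \<times> real. ((2 * \<eta>) *\<^sub>R fst h, 0::real))"
    by (auto intro!: linearI simp: algebra_simps)
  have linA': "linear A'"
    unfolding A'_def[abs_def] by (intro linear_compose_neg linear_compose_add linA lin2)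
  have trA': "space_trace A' = - (space_trace A + 2 * \<eta> * N)"
    by (simp only: A'_def[abs_def] space_trace_uminus space_trace_add space_trace_space_quadratic N_def)
  define p where "p y = - \<phi> z + a' \<bullet> (y - z) + (A' (y - z) \<bullet> (y - z)) / 2" for y
  define L where "L h = (1/2) *\<^sub>R (A' h + adjoint A' h)" for h
  have jp: "jet2 p y (a' + L (y - z)) L" for y
    using jet2_quadratic[OF linA', of "- \<phi> z" a' z y] by (simp add: p_def[abs_def] L_def[abs_def])
  have trL: "space_trace L = space_trace A'"
  proof -
    have "adjoint A' (i, 0) \<bullet> (i, 0) = A' (i, 0) \<bullet> (i, 0)" for i
      using adjoint_works[OF linA', of "(i, 0)" "(i, 0)"] by (simp add: inner_commute del: inner_Pair)
    then show ?thesis by (simp add: space_trace_def L_def inner_add_left del: inner_Pair)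
  qed
  have "bounded_linear L"
    unfolding L_def[abs_def] linear_conv_bounded_linear[symmetric]
    by (intro linear_compose_scale_right linear_compose_add linA' adjoint_linear)
  then obtain K where K: "K > 0" "\<And>h. norm (L h) \<le> norm h * K"
    using bounded_linear.pos_bounded by blast
  define d1 where "d1 = \<kappa> / (2 * b * K)"
  have d1: "d1 > 0" using \<kappa> b K by (simp add: d1_def)
  have psub: "subsol (\<lambda>p l. b * p - l) (ball z d1) p"
  proof (rule subsol_classical)
    fix y assume y: "y \<in> ball z d1"
    have "\<bar>snd (L (y - z))\<bar> \<le> norm (L (y - z))" by (metis norm_snd_le prod.collapse real_norm_def)
    also have "\<dots> \<le> norm (y - z) * K" by (rule K)
    also have "\<dots> \<le> d1 * K" using y K by (intro mult_right_mono) (auto simp: dist_norm norm_minus_commute)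
    finally have "b * \<bar>snd (L (y - z))\<bar> \<le> b * (d1 * K)" using b by (intro mult_left_mono) auto
    also have "\<dots> = \<kappa> / 2" using b K by (simp add: d1_def)
    finally have "b * snd (L (y - z)) \<le> \<kappa> / 2"
      using b by (smt (verit) mult_left_mono)
    then have "b * snd (a' + L (y - z)) - space_trace L \<le> 0"
      using \<eta>(2) \<theta>(2) by (simp add: trL trA' a'_def \<kappa>_def algebra_simps)
    with jp show "\<exists>a A. jet2 p y a A \<and> b * snd a - space_trace A \<le> 0" by blast
  qed simp
  have "\<forall>\<^sub>F h in nhds 0. \<phi> (z + h) \<le> \<phi> z + a \<bullet> h + (A h \<bullet> h) / 2 + \<eta> * (h \<bullet> h)"
    using jet \<eta>(1) superjetD unfolding \<phi>_def jet2_def by blast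
  then obtain d2 where d2: "d2 > 0"
    "\<And>h. norm h < d2 \<Longrightarrow> \<phi> (z + h) \<le> \<phi> z + a \<bullet> h + (A h \<bullet> h) / 2 + \<eta> * (h \<bullet> h)"
    unfolding eventually_nhds_metric by (auto simp: dist_norm)
  define d where "d = min \<delta> (min d1 d2)"
  have d: "d > 0" "d \<le> \<delta>" "d \<le> d1" "d \<le> d2" using \<delta> d1 d2 by (auto simp: d_def)
  \<comment> \<open>For \<open>h \<le> d / 4\<close> the cylinder of radius \<open>R\<close> and
    height \<open>h\<close> then stays in a ball of radius \<open>d\<close>.\<close>
  define R where "R = d / (4 * N)"
  have R: "R > 0" "N * R = d / 4" using d N by (auto simp: R_def)
  define \<rho> where "\<rho> = real DIM('a \<times> real) * r"
  have "bounded (v ` cball z (\<rho> + \<delta>))"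
    by (intro compact_imp_bounded compact_continuous_image continuous_on_subset[OF v]) auto
  then obtain M1 where M1: "M1 > 0" "\<And>y. y \<in> cball z (\<rho> + \<delta>) \<Longrightarrow> \<bar>v y\<bar> \<le> M1"
    unfolding bounded_pos by (auto simp: )
  have pcont: "continuous_on S p" for S
    using jp smooth_on_quadratic[OF linA', of S "- \<phi> z" a' z]
    unfolding smooth_on_def p_def[abs_def] by (auto dest: spec[of _ 0])
  have "bounded (p ` cball z d)"
    by (intro compact_imp_bounded compact_continuous_image pcont) auto
  then obtain M2 where M2: "M2 > 0" "\<And>y. y \<in> cball z d \<Longrightarrow> \<bar>p y\<bar> \<le> M2"
    unfolding bounded_pos by auto
  define c where "c = integral (cbox (- (r *\<^sub>R One)) (r *\<^sub>R One)) (bump r :: 'a \<times> real \<Rightarrow> real)"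
  define C1 where "C1 = 384 * M1 * N / (b\<^sup>2 * R ^ 4)"
  define C2 where "C2 = 384 * M2 * N / (b\<^sup>2 * R ^ 4)"
  let ?Q = "cbox (- (r *\<^sub>R One)) (r *\<^sub>R One) :: ('a \<times> real) set"
  let ?W = "cbox (- (R *\<^sub>R One)) (R *\<^sub>R One) :: 'a set"
  have mkc: "continuous_on S (\<lambda>x. bump r (f x))" if "continuous_on S f" for S :: "'c::topological_space set" and f :: "'c \<Rightarrow> 'a \<times> real"
    using continuous_on_bump(1)[OF _ that, of r] r by simp
  have vc: "continuous_on S (\<lambda>x. v (f x))" if "continuous_on S f" for S :: "'c::topological_space set" and f
    by (rule continuous_on_compose2[OF v that]) auto
  have key: "\<theta> * h \<le> (C1 * c + \<eta> + C2) * h\<^sup>2" if h: "h > 0" "h \<le> d / 4" for h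
  proof -
    define m where "m = heat_kernel_mass TYPE('a) b R h"
    have m: "m > 0" unfolding m_def by (rule heat_kernel_mass_pos[OF R(1)])
    define g where "g w = heat_kernel b (w, h) / m" for w :: 'a
    have g0: "g w \<ge> 0" for w using m heat_kernel_pos[of b "(w, h)"] by (simp add: g_def)
    have gC: "continuous_on S (\<lambda>x. g (f x))" if "continuous_on S f" for S :: "'c::topological_space set" and f
      unfolding g_def heat_kernel_def fst_conv snd_conv using m that by (auto intro!: continuous_intros)
    have small: "real DIM('a) * R + h < d" using R(2) h d by (simp add: N_def)
    have hm: "(f y :: real) \<le> integral ?W (\<lambda>w. g w * f (y - (w, h))) + 384 * M * N / (b\<^sup>2 * R ^ 4) * h\<^sup>2"
      if "continuous_on UNIV f" "subsol (\<lambda>p l. b * p - l) (ball y d) f" "M > 0" "\<And>z. z \<in> ball y d \<Longrightarrow> \<bar>f z\<bar> \<le> M"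
      for f y M
      using heat_mean_point[OF b R(1) h(1) that(3) small continuous_on_subset[OF that(1)] that(2,4)]
      by (simp add: g_def N_def m_def)
    have v1: "v (z - y) \<le> integral ?W (\<lambda>w. g w * v (z - y - (w, h))) + C1 * h\<^sup>2" if y: "y \<in> ?Q" for y
      unfolding C1_def
    proof (rule hm[OF v _ M1(1)])
      have "norm y \<le> \<rho>" using norm_le_cbox_radius[of y 0 r] y by (simp add: \<rho>_def)
      then have s: "ball (z - y) d \<subseteq> ball z (\<rho> + \<delta>)"
        using d(2) by (intro ball_subset_ball_iff[THEN iffD2]) (simp add: dist_norm)
      show "subsol (\<lambda>p l. b * p - l) (ball (z - y) d) v"
        by (rule subsol_subset[OF sub]) (use s \<rho>_def in auto)
      show "\<bar>v z'\<bar> \<le> M1" if "z' \<in> ball (z - y) d" for z'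
        using s that by (intro M1(2)) auto
    qed
    have "\<phi> z \<le> integral ?Q (\<lambda>y. integral ?W (\<lambda>w. bump r y * (g w * v (z - y - (w, h)))) + C1 * h\<^sup>2 * bump r y)"
      unfolding \<phi>_def mollify_def
    proof (rule integral_le)
      show "(\<lambda>y. bump r y * v (z - y)) integrable_on ?Q"
        by (intro integrable_continuous continuous_intros mkc vc)
      show "(\<lambda>y. integral ?W (\<lambda>w. bump r y * (g w * v (z - y - (w, h)))) + C1 * h\<^sup>2 * bump r y) integrable_on ?Q"
        by (intro integrable_continuous continuous_intros mkc integral_continuous_on_param)
          (auto simp: split_beta' intro!: continuous_intros mkc vc gC)
      fix y assume y: "y \<in> ?Q"
      have "bump r y * v (z - y) \<le> bump r y * (integral ?W (\<lambda>w. g w * v (z - y - (w, h))) + C1 * h\<^sup>2)"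
        by (intro mult_left_mono v1 y bump_nonneg)
      moreover have "integral ?W (\<lambda>w. bump r y * (g w * v (z - y - (w, h)))) =
          bump r y * integral ?W (\<lambda>w. g w * v (z - y - (w, h)))" by (rule integral_mult_right)
      ultimately show "bump r y * v (z - y) \<le> integral ?W (\<lambda>w. bump r y * (g w * v (z - y - (w, h)))) + C1 * h\<^sup>2 * bump r y"
        by (simp only: distrib_left mult.commute[of "bump r y" "C1 * h\<^sup>2"])
    qed
    also have "\<dots> = integral ?Q (\<lambda>y. integral ?W (\<lambda>w. bump r y * (g w * v (z - y - (w, h))))) + C1 * h\<^sup>2 * c"
    proof -
      have "(\<lambda>y. integral ?W (\<lambda>w. bump r y * (g w * v (z - y - (w, h))))) integrable_on ?Q"
        by (intro integrable_continuous integral_continuous_on_param)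
          (auto simp: split_beta' intro!: continuous_intros mkc vc gC)
      moreover have "(\<lambda>y. C1 * h\<^sup>2 * bump r y) integrable_on ?Q"
        by (intro integrable_continuous continuous_intros mkc)
      ultimately show ?thesis by (simp add: integral_add c_def)
    qed
    \<comment> \<open>Exchanging the integrals moves the heat average from \<open>v\<close> onto its
      mollification.\<close>
    also have "integral ?Q (\<lambda>y. integral ?W (\<lambda>w. bump r y * (g w * v (z - y - (w, h))))) =
        integral ?W (\<lambda>w. integral ?Q (\<lambda>y. bump r y * (g w * v (z - y - (w, h)))))"
      by (rule integral_swap_continuous) (auto simp: split_beta' intro!: continuous_intros mkc vc gC)
    also have "\<dots> = integral ?W (\<lambda>w. g w * \<phi> (z - (w, h)))"
    proof (rule integral_cong)
      fix w
      have "integral ?Q (\<lambda>y. bump r y * (g w * v (z - y - (w, h)))) = integral ?Q (\<lambda>y. g w * (bump r y * v (z - (w, h) - y)))"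
        by (intro integral_cong) (simp add: algebra_simps)
      then show "integral ?Q (\<lambda>y. bump r y * (g w * v (z - y - (w, h)))) = g w * \<phi> (z - (w, h))"
        by (simp add: \<phi>_def mollify_def)
    qed
    finally have 1: "\<phi> z \<le> integral ?W (\<lambda>w. g w * \<phi> (z - (w, h))) + C1 * h\<^sup>2 * c" .
    have "p z \<le> integral ?W (\<lambda>w. g w * p (z - (w, h))) + C2 * h\<^sup>2"
      unfolding C2_def
    proof (rule hm[OF pcont _ M2(1)])
      show "subsol (\<lambda>p l. b * p - l) (ball z d) p"
        by (rule subsol_subset[OF psub]) (use d in auto)
      show "\<bar>p z'\<bar> \<le> M2" if "z' \<in> ball z d" for z'
        using that by (intro M2(2)) auto
    qed
    also have "integral ?W (\<lambda>w. g w * p (z - (w, h))) \<le> integral ?W (\<lambda>w. (\<eta> * h\<^sup>2 - \<theta> * h) * g w - g w * \<phi> (z - (w, h)))"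
    proof (rule integral_le)
      have \<phi>c: "continuous_on ?W (\<lambda>w. \<phi> (z - (w, h)))"
        unfolding \<phi>_def mollify_def
        by (intro integral_continuous_on_param) (auto simp: split_beta' intro!: continuous_intros mkc vc gC)
      show "(\<lambda>w. g w * p (z - (w, h))) integrable_on ?W"
        by (intro integrable_continuous continuous_on_mult gC continuous_on_compose2[OF pcont[of UNIV]])
          (auto intro!: continuous_intros)
      show "(\<lambda>w. (\<eta> * h\<^sup>2 - \<theta> * h) * g w - g w * \<phi> (z - (w, h))) integrable_on ?W"
        by (intro integrable_continuous continuous_intros gC \<phi>c)
      fix w assume w: "w \<in> ?W"
      have "dist (0, 0) (w, h) \<le> real DIM('a) * R + h"
        by (rule norm_Pair_le_cbox) (use w h in auto)
      then have "norm (w, h) < d2" using small d by (simp add: dist_norm norm_Pair)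
      then have "norm (- (w, h)) < d2" by (simp only: norm_minus_cancel)
      moreover have "z + - (w, h) = z - (w, h)" by simp
      ultimately have "\<phi> (z - (w, h)) \<le> \<phi> z + a \<bullet> (- (w, h)) + (A (- (w, h)) \<bullet> (- (w, h))) / 2 + \<eta> * ((- (w, h)) \<bullet> (- (w, h)))"
        using d2(2)[of "- (w, h)"] by metis
      \<comment> \<open>At \<open>z - (w, h)\<close> the spatial part of the remainder is absorbed
        by \<open>A'\<close>, and the tilt \<theta> of the time slope leaves a deficit linear in
        \<open>h\<close>.\<close>
      then have "\<phi> (z - (w, h)) \<le> - p (z - (w, h)) - \<theta> * h + \<eta> * h\<^sup>2"
        by (simp add: p_def a'_def A'_def linear_neg[OF linA] linear_neg[OF linA, of "(w, h)", simplified]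
            inner_add_left inner_diff_left algebra_simps power2_eq_square diff_divide_distrib)
      then have "p (z - (w, h)) \<le> (\<eta> * h\<^sup>2 - \<theta> * h) - \<phi> (z - (w, h))" by simp
      from mult_left_mono[OF this g0[of w]]
      show "g w * p (z - (w, h)) \<le> (\<eta> * h\<^sup>2 - \<theta> * h) * g w - g w * \<phi> (z - (w, h))"
        by (simp add: algebra_simps)
    qed
    also have "integral ?W (\<lambda>w. (\<eta> * h\<^sup>2 - \<theta> * h) * g w - g w * \<phi> (z - (w, h))) =
        (\<eta> * h\<^sup>2 - \<theta> * h) - integral ?W (\<lambda>w. g w * \<phi> (z - (w, h)))"
    proof -
      have \<phi>c: "continuous_on ?W (\<lambda>w. \<phi> (z - (w, h)))"
        unfolding \<phi>_def mollify_def
        by (intro integral_continuous_on_param) (auto simp: split_beta' intro!: continuous_intros mkc vc gC)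
      have i1: "(\<lambda>w. (\<eta> * h\<^sup>2 - \<theta> * h) * g w) integrable_on ?W"
        by (intro integrable_continuous continuous_intros gC)
      have i2: "(\<lambda>w. g w * \<phi> (z - (w, h))) integrable_on ?W"
        by (intro integrable_continuous continuous_intros gC \<phi>c)
      have "integral ?W g = integral ?W (\<lambda>w. heat_kernel b (w, h)) / m" by (simp add: g_def[abs_def])
      also have "integral ?W (\<lambda>w. heat_kernel b (w, h)) = m" by (simp add: m_def heat_kernel_mass_def)
      finally have "integral ?W g = 1" using m by simp
      then show ?thesis using integral_diff[OF i1 i2] by simp
    qed
    finally have "p z + integral ?W (\<lambda>w. g w * \<phi> (z - (w, h))) \<le> \<eta> * h\<^sup>2 - \<theta> * h + C2 * h\<^sup>2" by simp
    moreover have "p z = - \<phi> z" by (simp add: p_def linear_0[OF linA'])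
    ultimately show ?thesis using 1 by (simp add: algebra_simps)
  qed
  define C where "C = C1 * c + \<eta> + C2"
  have bound: "\<theta> \<le> C * h" if "h > 0" "h \<le> d / 4" for h
  proof -
    have "\<theta> * h \<le> (C * h) * h" using key[OF that] by (simp add: C_def power2_eq_square mult.assoc)
    then show ?thesis using that by (simp add: mult_le_cancel_right)
  qed
  have "\<theta> \<le> C * (d / 4)" using bound[of "d / 4"] d by simp
  then have C: "C > 0" using \<theta>(1) d by (smt (verit) mult_nonpos_nonneg divide_nonneg_nonneg)
  define h where "h = min (d / 4) (\<theta> / (2 * C))"
  have "h > 0" "h \<le> d / 4" using d C \<theta> by (auto simp: h_def)
  from bound[OF this] have "\<theta> \<le> C * h" .
  also have "\<dots> \<le> C * (\<theta> / (2 * C))" using C by (intro mult_left_mono) (auto simp: h_def)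
  also have "\<dots> = \<theta> / 2" using C by simp
  finally show False using \<theta> by simp
qed

text \<open>Averages inherit monotonicity in time; the lower half of the jet then bounds the slope
  by a quantity of order \<open>s\<close> for every small time step \<open>s\<close>.\<close>

lemma mollify_nonincreasing_jet:
  fixes v :: "'a::euclidean_space \<times> real \<Rightarrow> real"
  assumes r: "r > 0" and v: "continuous_on UNIV v" and jet: "jet2 (mollify r v) z a A" and \<delta>: "\<delta> > 0"
    and dec: "\<And>y s. y \<in> cbox (- (r *\<^sub>R One)) (r *\<^sub>R One) \<Longrightarrow> 0 \<le> s \<Longrightarrow> s < \<delta> \<Longrightarrow> v (z - y + (0, s)) \<le> v (z - y)"
  shows "snd a \<le> 0"
proof -
  have linA: "linear A" using jet superjet_linear by (auto simp: jet2_def)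
  have vc: "continuous_on S (\<lambda>x. v (f x))" if "continuous_on S f" for S :: "'c::topological_space set" and f
    by (rule continuous_on_compose2[OF v that]) auto
  have mkc: "continuous_on S (bump r)" for S :: "('a \<times> real) set"
    using continuous_on_bump(1)[of r S "\<lambda>x. x"] r by simp
  have dm: "mollify r v (z + (0, s)) \<le> mollify r v z" if "0 \<le> s" "s < \<delta>" for s
    unfolding mollify_def
  proof (intro integral_le integrable_continuous continuous_intros mkc vc)
    fix y :: "'a \<times> real" assume "y \<in> cbox (- (r *\<^sub>R One)) (r *\<^sub>R One)"
    from dec[OF this that] have "v (z + (0, s) - y) \<le> v (z - y)" by (simp add: algebra_simps)
    then show "bump r y * v (z + (0, s) - y) \<le> bump r y * v (z - y)"
      by (intro mult_left_mono bump_nonneg)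
  qed
  have "\<forall>\<^sub>F h in nhds 0. - mollify r v (z + h) \<le> - mollify r v z + (- a) \<bullet> h + ((- A h) \<bullet> h) / 2 + 1 * (h \<bullet> h)"
    using jet superjetD[of "\<lambda>z. - mollify r v z" z "-a" "\<lambda>h. - A h" 1] by (simp add: jet2_def)
  then obtain d where d: "d > 0" "\<And>h. norm h < d \<Longrightarrow> - mollify r v (z + h) \<le> - mollify r v z + (- a) \<bullet> h + ((- A h) \<bullet> h) / 2 + 1 * (h \<bullet> h)"
    unfolding eventually_nhds_metric by (auto simp: dist_norm)
  define C where "C = 1 - snd (A (0, 1)) / 2"
  show ?thesis
  proof (rule tendsto_lowerbound[where F = "at_right 0" and f = "\<lambda>s. s * C"])
    show "((\<lambda>s. s * C) \<longlongrightarrow> 0) (at_right 0)" by (rule tendsto_eq_intros refl | simp)+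
    have "\<forall>\<^sub>F s in at_right 0. s < min \<delta> d"
      using \<delta> d by (intro eventually_at_right_less order_tendstoD(2)[OF tendsto_ident_at]) auto
    moreover have "\<forall>\<^sub>F s in at_right 0. (0::real) < s" by (simp add: eventually_at_filter)
    ultimately show "\<forall>\<^sub>F s in at_right 0. snd a \<le> s * C"
    proof eventually_elim
      case (elim s)
      have "norm (0 :: 'a, s) < d" using elim by (simp add: norm_Pair)
      from d(2)[OF this] have 1: "- mollify r v (z + (0, s)) \<le> - mollify r v z - s * snd a - (A (0, s) \<bullet> (0, s)) / 2 + s * s"
        by (simp add: inner_prod_def mult.commute)
      have "A (0, s) = s *\<^sub>R A (0, 1)" using linear_cmul[OF linA, of s "(0, 1)"] by simp
      then have "A (0, s) \<bullet> (0, s) = s * s * snd (A (0, 1))" by (simp add: inner_prod_def)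
      with 1 dm[of s] elim have "s * snd a \<le> s * (s * C)" by (simp add: C_def algebra_simps)
      then show ?case using elim by (simp add: mult_le_cancel_left)
    qed
  qed simp
qed

lemma mollify_approx:
  fixes v :: "'b::euclidean_space \<Rightarrow> real"
  assumes r: "r > 0" and v: "continuous_on UNIV v"
    and e: "\<And>y. y \<in> cbox (- (r *\<^sub>R One)) (r *\<^sub>R One) \<Longrightarrow> \<bar>v (z - y) - v z\<bar> \<le> e"
  shows "\<bar>mollify r v z / integral (cbox (- (r *\<^sub>R One)) (r *\<^sub>R One)) (bump r :: 'b \<Rightarrow> real) - v z\<bar> \<le> e"
proof -
  let ?Q = "cbox (- (r *\<^sub>R One)) (r *\<^sub>R One) :: 'b set"
  define c where "c = integral ?Q (bump r)"
  have c: "c > 0" unfolding c_def by (rule mollify_const_mass_pos[OF r])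
  have vc: "continuous_on S (\<lambda>x. v (f x))" if "continuous_on S f" for S :: "'c::topological_space set" and f
    by (rule continuous_on_compose2[OF v that]) auto
  have mkc: "continuous_on S (bump r)" for S :: "'b set"
    using continuous_on_bump(1)[of r S "\<lambda>x. x"] r by simp
  have i: "(\<lambda>y. bump r y * v (z - y)) integrable_on ?Q" "(\<lambda>y. bump r y * k) integrable_on ?Q" for k
    by (intro integrable_continuous continuous_intros mkc vc)+
  have "mollify r v z \<le> integral ?Q (\<lambda>y. bump r y * (v z + e))"
    unfolding mollify_def using e by (intro integral_le i mult_left_mono bump_nonneg) (auto simp: abs_le_iff algebra_simps)
  then have 1: "mollify r v z \<le> c * (v z + e)" by (simp add: c_def)
  have "integral ?Q (\<lambda>y. bump r y * (v z - e)) \<le> mollify r v z"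
    unfolding mollify_def using e by (intro integral_le i mult_left_mono bump_nonneg) (auto simp: abs_le_iff algebra_simps)
  then have 2: "c * (v z - e) \<le> mollify r v z" by (simp add: c_def)
  have "mollify r v z / c \<le> v z + e" "v z - e \<le> mollify r v z / c"
    using 1 2 c by (simp_all add: field_simps)
  then show ?thesis unfolding c_def[symmetric] by linarith
qed

section \<open>Sup-convolution\<close>

text \<open>A cone in place of the usual parabola: the mollification that follows supplies second
  derivatives, so the sup-convolution has to provide Lipschitz continuity only.\<close>

definition sup_conv :: "real \<Rightarrow> 'b::metric_space set \<Rightarrow> ('b \<Rightarrow> real) \<Rightarrow> 'b \<Rightarrow> real" where
  "sup_conv n K V z = (SUP y\<in>K. V y - n * dist z y)"

lemma sup_conv_attained:
  assumes "compact K" "K \<noteq> {}" "upper_semicontinuous_on K V"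
  shows "\<exists>y\<in>K. sup_conv n K V z = V y - n * dist z y \<and> (\<forall>y'\<in>K. V y' - n * dist z y' \<le> sup_conv n K V z)"
proof -
  have "upper_semicontinuous_on K (\<lambda>y. V y + - (n * dist z y))"
    by (intro usc_add assms continuous_imp_usc continuous_intros)
  then have "upper_semicontinuous_on K (\<lambda>y. V y - n * dist z y)" by simp
  from usc_attains_max[OF assms(1,2) this] obtain y where
    y: "y \<in> K" "\<And>y'. y' \<in> K \<Longrightarrow> V y' - n * dist z y' \<le> V y - n * dist z y" by blast
  have "sup_conv n K V z = V y - n * dist z y"
    unfolding sup_conv_def using y by (intro cSup_eq_maximum) auto
  with y show ?thesis by auto
qed

lemma sup_conv_lipschitz:
  assumes K: "compact K" "K \<noteq> {}" "upper_semicontinuous_on K V" and n: "n \<ge> 0"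
  shows "\<bar>sup_conv n K V z - sup_conv n K V z'\<bar> \<le> n * dist z z'"
proof -
  have *: "sup_conv n K V z \<le> sup_conv n K V z' + n * dist z z'" for z z'
  proof -
    obtain y where y: "y \<in> K" "sup_conv n K V z = V y - n * dist z y" using sup_conv_attained[OF K] by blast
    have y': "\<And>y'. y' \<in> K \<Longrightarrow> V y' - n * dist z' y' \<le> sup_conv n K V z'" using sup_conv_attained[OF K] by blast
    have "n * dist z' y \<le> n * (dist z z' + dist z y)"
      using n dist_triangle[of z' y z] by (intro mult_left_mono) (auto simp: dist_commute)
    with y'[OF y(1)] y(2) show ?thesis by (simp add: algebra_simps)
  qed
  from *[of z z'] *[of z' z] show ?thesis by (simp add: dist_commute abs_le_iff)
qed

lemma sup_conv_continuous:
  assumes K: "compact K" "K \<noteq> {}" "upper_semicontinuous_on K V" and n: "n \<ge> 0"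
  shows "continuous_on S (sup_conv n K V)"
  unfolding continuous_on_iff
proof (intro ballI allI impI)
  fix x e assume e: "e > (0::real)"
  show "\<exists>d>0. \<forall>x'\<in>S. dist x' x < d \<longrightarrow> dist (sup_conv n K V x') (sup_conv n K V x) < e"
  proof (intro exI[of _ "e / (n + 1)"] conjI ballI impI)
    show "e / (n + 1) > 0" using e n by simp
    fix x' assume "dist x' x < e / (n + 1)"
    then have "(n + 1) * dist x' x < e" using n by (simp add: field_simps)
    then have "n * dist x' x + 1 * dist x' x < e" by (simp only: distrib_right)
    then have "n * dist x' x < e" using zero_le_dist[of x' x] by linarith
    then show "dist (sup_conv n K V x') (sup_conv n K V x) < e"
      using sup_conv_lipschitz[OF K n, of x' x] by (simp add: dist_real_def)
  qed
qed

text \<open>The operator does not depend on the point. If \<open>y\<close> attains the supremum at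
  \<open>z\<close>, shifting both by \<open>h\<close> leaves their distance unchanged, so a superjet
  of the sup-convolution at \<open>z\<close> is a superjet of \<open>V\<close> at \<open>y\<close>.
  Comparing with the choice \<open>y = z\<close> bounds the displacement by
  \<open>2 * M / n\<close>.\<close>

lemma sup_conv_subsol:
  fixes V :: "'a::euclidean_space \<times> real \<Rightarrow> real"
  assumes K: "compact K" "K \<noteq> {}" "upper_semicontinuous_on K V" and n: "n > 0"
    and M: "\<And>z. z \<in> K \<Longrightarrow> \<bar>V z\<bar> \<le> M"
    and U: "open U" "U \<subseteq> K" and sub: "subsol F U V"
    and Z: "\<And>z. z \<in> Z \<Longrightarrow> z \<in> K \<and> cball z (2 * M / n) \<subseteq> U"
  shows "subsol F Z (sup_conv n K V)"
  unfolding subsol_def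
proof (intro ballI allI impI)
  fix z a A assume z: "z \<in> Z" and sj: "superjet (sup_conv n K V) z a A"
  obtain y where y: "y \<in> K" "sup_conv n K V z = V y - n * dist z y"
    "\<And>y'. y' \<in> K \<Longrightarrow> V y' - n * dist z y' \<le> sup_conv n K V z" using sup_conv_attained[OF K] by blast
  have "V z \<le> V y - n * dist z y" using y(3)[of z] y(2) Z[OF z] by simp
  then have "n * dist z y \<le> 2 * M" using M[OF y(1)] M[of z] Z[OF z] by (simp add: abs_le_iff)
  then have "dist z y \<le> 2 * M / n" using n by (simp add: field_simps)
  then have yU: "y \<in> U" using Z[OF z] by auto
  have ev: "\<forall>\<^sub>F h in nhds 0. y + h \<in> K"
    using eventually_nhds_shift[of "\<lambda>x. x \<in> K" y] eventually_nhds_in_open[OF U(1) yU] U(2)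
    by (auto elim: eventually_mono)
  have "superjet V y a A"
    unfolding superjet_def
  proof (intro conjI allI impI)
    show "linear A" using sj by (rule superjet_linear)
    fix \<eta> :: real assume "\<eta> > 0"
    from superjetD[OF sj this] ev
    show "\<forall>\<^sub>F h in nhds 0. V (y + h) \<le> V y + a \<bullet> h + A h \<bullet> h / 2 + \<eta> * (h \<bullet> h)"
    proof eventually_elim
      case (elim h)
      have "\<And>y'. y' \<in> K \<Longrightarrow> V y' - n * dist (z + h) y' \<le> sup_conv n K V (z + h)"
        using sup_conv_attained[OF K] by blast
      from this[OF elim(2)] elim(1) y(2) show ?case by simp
    qed
  qed
  with sub yU show "F (snd a) (space_trace A) \<le> 0" unfolding subsol_def by blast
qed

section \<open>Comparison principle\<close>

lemma usc_compose:
  assumes f: "upper_semicontinuous_on S f" and g: "continuous_on T g" "g ` T \<subseteq> S"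
  shows "upper_semicontinuous_on T (\<lambda>x. f (g x))"
  unfolding upper_semicontinuous_on_def
proof (intro ballI allI impI)
  fix x a assume x: "x \<in> T" and a: "f (g x) < a"
  have "openin (top_of_set S) {y\<in>S. f y < a}" by (rule usc_openin[OF f])
  then obtain O' where O': "open O'" "{y\<in>S. f y < a} = S \<inter> O'" unfolding openin_open by blast
  have gx: "g x \<in> O'" using O'(2) g(2) x a by auto
  have "\<forall>\<^sub>F y in at x within T. g y \<in> O'"
    using g(1) x O'(1) gx unfolding continuous_on_def by (auto intro: topological_tendstoD)
  moreover have "\<forall>\<^sub>F y in at x within T. y \<in> T" by (simp add: eventually_at_filter)
  ultimately show "\<forall>\<^sub>F y in at x within T. f (g y) < a"
    by eventually_elim (use O'(2) g(2) in blast)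
qed

text \<open>The segment to a nearest point of the complement meets the frontier.\<close>

lemma frontier_within:
  fixes \<Omega> :: "'a::euclidean_space set"
  assumes "open \<Omega>" "bounded \<Omega>" "x \<in> closure \<Omega>" "infdist x (- \<Omega>) < d"
  shows "\<exists>y\<in>frontier \<Omega>. dist x y < d"
proof -
  have ne: "- \<Omega> \<noteq> {}" using assms(2) not_bounded_UNIV by (metis Compl_empty_eq double_complement)
  have cl: "closed (- \<Omega>)" using assms(1) by auto
  obtain y where y: "y \<in> - \<Omega>" "infdist x (- \<Omega>) = dist x y"
    using infdist_attains_inf[OF cl ne] by metis
  show ?thesis
  proof (cases "x \<in> \<Omega>")
    case False
    then have "x \<in> frontier \<Omega>" using assms by (simp add: frontier_def interior_open)
    moreover have "dist x x < d" using assms(4) infdist_nonneg[of x "- \<Omega>"] by simp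
    ultimately show ?thesis by blast
  next
    case True
    have "closed_segment x y \<inter> frontier \<Omega> \<noteq> {}"
      by (rule connected_Int_frontier) (use True y in auto)
    then obtain p where p: "p \<in> closed_segment x y" "p \<in> frontier \<Omega>" by blast
    have "dist x p \<le> dist x y"
      using dist_in_closed_segment[OF p(1)] by (simp add: dist_commute)
    then have "dist x p < d" using y assms(4) by linarith
    then show ?thesis using p by blast
  qed
qed

text \<open>The operator equals \<open>max (b * p - l) (b * p)\<close>, so a subsolution satisfies
  two linear inequalities at once.\<close>

lemma F_limit_le_iff:
  assumes "b > 0"
  shows "F_limit b p l \<le> 0 \<longleftrightarrow> p \<le> 0 \<and> b * p \<le> l"
proof -
  have "b * p \<le> 0 \<longleftrightarrow> p \<le> 0" using assms by (simp add: mult_le_0_iff)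
  then show ?thesis unfolding F_limit_def by (auto simp: min_def)
qed

text \<open>The difficulty sits at the parabolic boundary, where the regularized function at a point
  involves values of \<open>V\<close> at other points while \<open>V\<close> and \<open>W\<close>
  are only semicontinuous. Compactness in the product space shows that there
  \<open>V y < W z + c\<close> whenever \<open>y\<close> and \<open>z\<close> are close. Inside, the
  regularized subsolution is classical and \<open>max_principle\<close> compares it with
  \<open>W\<close>.\<close>

theorem comparison:
  fixes V W :: "'a::euclidean_space \<times> real \<Rightarrow> real"
  assumes \<Omega>: "open \<Omega>" "bounded \<Omega>" and b: "b > 0"
    and V: "upper_semicontinuous_on (closure \<Omega> \<times> {0..T}) V"
    and W: "upper_semicontinuous_on (closure \<Omega> \<times> {0..T}) (\<lambda>z. - W z)"
    and M: "\<And>z. z \<in> closure \<Omega> \<times> {0..T} \<Longrightarrow> \<bar>V z\<bar> \<le> M"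
    and subV: "subsol (F_limit b) (\<Omega> \<times> {0<..<T}) V"
    and supW: "subsol (negF (F_limit b)) (\<Omega> \<times> {0<..<T}) (\<lambda>z. - W z)"
    and init: "\<And>x. x \<in> closure \<Omega> \<Longrightarrow> V (x, 0) \<le> W (x, 0)"
    and lat: "\<And>x t. x \<in> frontier \<Omega> \<Longrightarrow> 0 \<le> t \<Longrightarrow> t \<le> T \<Longrightarrow> V (x, t) \<le> W (x, t)"
    and z0: "x0 \<in> closure \<Omega>" "0 \<le> t0" "t0 < T"
  shows "V (x0, t0) \<le> W (x0, t0)"
proof (rule ccontr)
  assume neg: "\<not> V (x0, t0) \<le> W (x0, t0)"
  define K where "K = closure \<Omega> \<times> {0..T}"
  define \<Gamma> where "\<Gamma> = closure \<Omega> \<times> {0} \<union> frontier \<Omega> \<times> {0..T}"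
  \<comment> \<open>One third of the excess: the boundary estimate costs \<open>c\<close> and
    mollification twice \<open>c / 2\<close>, which is less than \<open>3 * c\<close> in
    total.\<close>
  define c where "c = (V (x0, t0) - W (x0, t0)) / 3"
  have c: "c > 0" "V (x0, t0) = W (x0, t0) + 3 * c" using neg by (auto simp: c_def field_simps)
  have z0K: "(x0, t0) \<in> K" using z0 by (simp add: K_def)
  have cK: "compact K" "K \<noteq> {}" using \<Omega> z0K unfolding K_def by (auto intro!: compact_Times simp: compact_closure)
  have "compact \<Gamma>"
    unfolding \<Gamma>_def using \<Omega> by (intro compact_Un compact_Times compact_frontier_bounded) (auto simp: compact_closure)
  have fr: "frontier \<Omega> \<subseteq> closure \<Omega>" by (auto simp: frontier_def)
  have \<Gamma>K: "\<Gamma> \<subseteq> K" using fr z0 by (auto simp: \<Gamma>_def K_def)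
  have \<Gamma>le: "V \<gamma> \<le> W \<gamma>" if "\<gamma> \<in> \<Gamma>" for \<gamma> using that init lat by (auto simp: \<Gamma>_def)
  \<comment> \<open>The diagonal over the parabolic boundary is compact, the set of pairs with
    \<open>V y - W z \<ge> c\<close> is closed, and they are disjoint, hence a positive distance
    apart. This stands in for uniform continuity.\<close>
  define D where "D = (\<lambda>\<gamma>. (\<gamma>, \<gamma>)) ` \<Gamma>"
  define E where "E = {p \<in> K \<times> K. V (fst p) + - W (snd p) \<ge> c}"
  have "compact D" unfolding D_def by (intro compact_continuous_image continuous_intros \<open>compact \<Gamma>\<close>)
  moreover have "closed E"
    unfolding E_def
  proof (intro usc_closed_superlevel usc_add)
    show "upper_semicontinuous_on (K \<times> K) (\<lambda>p. V (fst p))"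
      by (rule usc_compose[OF V[folded K_def]]) (auto intro!: continuous_intros)
    show "upper_semicontinuous_on (K \<times> K) (\<lambda>p. - W (snd p))"
      by (rule usc_compose[OF W[folded K_def]]) (auto intro!: continuous_intros)
    show "closed (K \<times> K)" using cK by (intro closed_Times compact_imp_closed)
  qed
  moreover have "D \<inter> E = {}" using \<Gamma>le c by (force simp: D_def E_def)
  ultimately obtain d where d: "d > 0" "\<And>x y. x \<in> D \<Longrightarrow> y \<in> E \<Longrightarrow> d \<le> dist x y"
    using separate_compact_closed by metis
  \<comment> \<open>If \<open>z\<close> is within \<delta> of \<open>\<gamma>\<close> and
    \<open>y\<close> within \<delta> of \<open>z\<close>, then \<open>(y, z)\<close> is at distance
    less than \<open>3 * \<delta>\<close> from \<open>(\<gamma>, \<gamma>)\<close>.\<close>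
  define \<delta> where "\<delta> = min (d / 4) ((T - t0) / 2)"
  have \<delta>: "\<delta> > 0" "3 * \<delta> < d" "\<delta> < T - t0" using d z0 by (auto simp: \<delta>_def min_def field_simps)
  have near: "V y < W z + c" if "\<gamma> \<in> \<Gamma>" "z \<in> K" "y \<in> K" "dist z \<gamma> < \<delta>" "dist z y < \<delta>" for \<gamma> z y
  proof (rule ccontr)
    assume "\<not> ?thesis"
    then have "(y, z) \<in> E" using that by (simp add: E_def)
    moreover have "(\<gamma>, \<gamma>) \<in> D" using that by (simp add: D_def)
    ultimately have "d \<le> dist (\<gamma>, \<gamma>) (y, z)" using d by blast
    also have "\<dots> = norm (\<gamma> - y, \<gamma> - z)" by (simp add: dist_norm)
    also have "\<dots> \<le> dist \<gamma> y + dist \<gamma> z" using norm_Pair_le[of "\<gamma> - y" "\<gamma> - z"] by (simp add: dist_norm)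
    also have "dist \<gamma> y \<le> dist z \<gamma> + dist z y" by (metis dist_commute dist_triangle)
    finally show False using that \<delta> by (simp add: dist_commute)
  qed
  \<comment> \<open>The inner cylinder keeps a margin of \<open>\<delta> / 2\<close> on all sides,
    including the final time; both regularizations take place within this margin.\<close>
  define U where "U = {x. infdist x (- \<Omega>) > \<delta> / 2}"
  define T' where "T' = T - \<delta> / 2"
  have ne: "- \<Omega> \<noteq> {}" using \<Omega>(2) not_bounded_UNIV by (metis Compl_empty_eq double_complement)
  have near_bdry: "\<exists>\<gamma>\<in>\<Gamma>. dist (x, t) \<gamma> < \<delta>" if "(x, t) \<in> K" "t < \<delta> \<or> infdist x (- \<Omega>) < \<delta>" for x t
    using that(2)
  proof
    assume "t < \<delta>"
    then show ?thesis using that(1) by (intro bexI[of _ "(x, 0)"]) (auto simp: \<Gamma>_def K_def dist_Pair_Pair)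
  next
    assume "infdist x (- \<Omega>) < \<delta>"
    moreover have "x \<in> closure \<Omega>" using that(1) by (simp add: K_def)
    ultimately obtain y where "y \<in> frontier \<Omega>" "dist x y < \<delta>"
      using frontier_within[OF \<Omega>, of x \<delta>] by blast
    then show ?thesis using that(1) by (intro bexI[of _ "(y, t)"]) (auto simp: \<Gamma>_def K_def dist_Pair_Pair)
  qed
  have z0in: "t0 \<ge> \<delta>" "infdist x0 (- \<Omega>) \<ge> \<delta>"
    using near_bdry[OF z0K] near[OF _ z0K z0K] c \<delta>(1) by (force simp: not_less)+
  have U: "open U" unfolding U_def by (intro open_Collect_less continuous_intros)
  have U\<Omega>: "U \<subseteq> \<Omega>"
  proof
    fix x assume "x \<in> U"
    then show "x \<in> \<Omega>" using \<delta> by (cases "x \<in> \<Omega>") (auto simp: U_def)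
  qed
  have bU: "bounded U" using U\<Omega> \<Omega> bounded_subset by blast
  have clU: "closure U \<subseteq> {x. infdist x (- \<Omega>) \<ge> \<delta> / 2}"
    by (rule closure_minimal) (auto simp: U_def intro!: closed_Collect_le continuous_intros)
  have clU\<Omega>: "closure U \<subseteq> \<Omega>"
  proof
    fix x assume "x \<in> closure U"
    then have "infdist x (- \<Omega>) > 0" using clU \<delta>(1) by auto
    then show "x \<in> \<Omega>" by (cases "x \<in> \<Omega>") auto
  qed
  have frU: "infdist x (- \<Omega>) = \<delta> / 2" if "x \<in> frontier U" for x
  proof -
    have "x \<in> closure U" "x \<notin> U" using that U by (auto simp: frontier_def interior_open)
    then have "\<delta> / 2 \<le> infdist x (- \<Omega>)" "\<not> infdist x (- \<Omega>) > \<delta> / 2" using clU by (auto simp: U_def)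
    then show ?thesis by simp
  qed
  have inside: "ball z (\<delta> / 2) \<subseteq> \<Omega> \<times> {0<..<T}" if "z \<in> U \<times> {\<delta> / 2<..<T'}" for z
  proof
    fix y assume y: "y \<in> ball z (\<delta> / 2)"
    have 1: "dist (fst z) (fst y) < \<delta> / 2" "dist (snd z) (snd y) < \<delta> / 2"
      using y dist_fst_le[of z y] dist_snd_le[of z y] by auto
    have "fst y \<in> \<Omega>"
    proof (rule ccontr)
      assume "fst y \<notin> \<Omega>"
      then have "infdist (fst z) (- \<Omega>) \<le> dist (fst z) (fst y)" by (intro infdist_le) auto
      then show False using 1 that by (auto simp: U_def)
    qed
    moreover have "0 < snd y" "snd y < T"
    proof -
      have "\<delta> / 2 < snd z" "snd z < T - \<delta> / 2" using that by (auto simp: T'_def)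
      then show "0 < snd y" "snd y < T" using 1(2) unfolding dist_real_def by linarith+
    qed
    ultimately show "y \<in> \<Omega> \<times> {0<..<T}" by (cases y) auto
  qed
  define M' where "M' = max M 1"
  have M': "M' > 0" "\<And>z. z \<in> K \<Longrightarrow> \<bar>V z\<bar> \<le> M'" using M by (force simp: M'_def K_def)+
  \<comment> \<open>Makes the displacement in the sup-convolution at most
    \<open>\<delta> / 16\<close>.\<close>
  define n where "n = 32 * M' / \<delta>"
  have n: "n > 0" "2 * M' / n = \<delta> / 16" using M' \<delta> by (auto simp: n_def)
  define v where "v = sup_conv n K V"
  note VK = V[folded K_def]
  have vC: "continuous_on UNIV v" unfolding v_def using n by (intro sup_conv_continuous cK VK) auto
  have lip: "\<bar>v z - v z'\<bar> \<le> n * dist z z'" for z z'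
    unfolding v_def using n by (intro sup_conv_lipschitz cK VK) auto
  have opU: "open (\<Omega> \<times> {0<..<T})" using \<Omega> by (intro open_Times) auto
  have UK: "\<Omega> \<times> {0<..<T} \<subseteq> K" using closure_subset[of \<Omega>] by (auto simp: K_def)
  have vsub: "subsol (F_limit b) (ball z (\<delta> / 4)) v" if "z \<in> U \<times> {\<delta> / 2<..<T'}" for z
    unfolding v_def
  proof (rule sup_conv_subsol[OF cK VK n(1) M'(2) opU UK subV])
    fix y assume y: "y \<in> ball z (\<delta> / 4)"
    have "cball y (2 * M' / n) \<subseteq> ball z (\<delta> / 2)"
      unfolding n(2)
    proof
      fix w assume "w \<in> cball y (\<delta> / 16)"
      then show "w \<in> ball z (\<delta> / 2)" using y \<delta>(1) dist_triangle[of z w y] by (simp add: dist_commute)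
    qed
    moreover have "y \<in> ball z (\<delta> / 2)" using y \<delta>(1) by simp
    ultimately show "y \<in> K \<and> cball y (2 * M' / n) \<subseteq> \<Omega> \<times> {0<..<T}"
      using inside[OF that] UK by blast
  qed
  have vbd: "V z \<le> v z" "v z \<le> M'" "\<exists>y\<in>K. v z \<le> V y \<and> dist z y \<le> \<delta> / 16" if z: "z \<in> K" for z
  proof -
    obtain y where y: "y \<in> K" "v z = V y - n * dist z y" "\<And>y'. y' \<in> K \<Longrightarrow> V y' - n * dist z y' \<le> v z"
      using sup_conv_attained[OF cK VK, of n z] unfolding v_def by blast
    show 1: "V z \<le> v z" using y(3)[OF z] by simp
    have nd: "n * dist z y \<ge> 0" using n by simp
    then show "v z \<le> M'" using y(2) M'(2)[OF y(1)] by (simp add: abs_le_iff)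
    have "n * dist z y \<le> 2 * M'" using 1 y(2) M'(2)[OF y(1)] M'(2)[OF z] by (simp add: abs_le_iff)
    then have "dist z y \<le> 2 * M' / n" using n by (simp add: field_simps)
    then show "\<exists>y\<in>K. v z \<le> V y \<and> dist z y \<le> \<delta> / 16" using y nd n by (intro bexI[of _ y]) auto
  qed
  define N where "N = real DIM('a \<times> real)"
  have N: "N \<ge> 1" by (simp add: N_def)
  \<comment> \<open>The first bound keeps the support of the kernel within
    \<open>\<delta> / 16\<close>; the second makes the error of mollifying an
    \<open>n\<close>-Lipschitz function at most \<open>c / 2\<close>.\<close>
  define r where "r = min (\<delta> / (16 * N)) (c / (2 * n * N))"
  have r: "r > 0" "N * r \<le> \<delta> / 16" "n * (N * r) \<le> c / 2"
  proof -
    show "r > 0" using \<delta> c n N by (simp add: r_def)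
    have "N * r \<le> N * (\<delta> / (16 * N))" using N by (intro mult_left_mono) (auto simp: r_def)
    then show "N * r \<le> \<delta> / 16" using N by simp
    have "n * (N * r) \<le> n * (N * (c / (2 * n * N)))" using N n by (intro mult_left_mono) (auto simp: r_def)
    then show "n * (N * r) \<le> c / 2" using N n by simp
  qed
  let ?Q = "cbox (- (r *\<^sub>R One)) (r *\<^sub>R One) :: ('a \<times> real) set"
  define m where "m = integral ?Q (bump r)"
  have m: "m > 0" unfolding m_def by (rule mollify_const_mass_pos[OF r(1)])
  have yQ: "norm y \<le> N * r" if "y \<in> ?Q" for y
    using norm_le_cbox_radius[of y 0 r] that by (simp add: N_def)
  define \<phi> where "\<phi> z = (1 / m) * mollify r v z" for z
  have app: "\<bar>\<phi> z - v z\<bar> \<le> c / 2" for z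
  proof -
    have "\<bar>mollify r v z / m - v z\<bar> \<le> c / 2"
      unfolding m_def
    proof (rule mollify_approx[OF r(1) vC])
      fix y assume "y \<in> ?Q"
      have "\<bar>v (z - y) - v z\<bar> \<le> n * norm y" using lip[of "z - y" z] by (simp add: dist_norm)
      also have "\<dots> \<le> n * (N * r)" using yQ[OF \<open>y \<in> ?Q\<close>] n by (intro mult_left_mono) auto
      finally show "\<bar>v (z - y) - v z\<bar> \<le> c / 2" using r(3) by simp
    qed
    then show ?thesis by (simp add: \<phi>_def)
  qed
  have \<phi>C: "continuous_on S \<phi>" for S
  proof -
    have "continuous_on ?Q (bump r)" using continuous_on_bump(1)[of r ?Q "\<lambda>x. x"] r by simp
    then have "continuous_on (S \<times> ?Q) (\<lambda>(z, y). bump r y * v (z - y))"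
      unfolding split_beta' using r
      by (intro continuous_on_mult continuous_on_bump continuous_on_compose2[OF vC]) (auto intro!: continuous_intros)
    then have "continuous_on S (mollify r v)"
      unfolding mollify_def[abs_def] by (rule integral_continuous_on_param)
    then show ?thesis unfolding \<phi>_def by (intro continuous_intros)
  qed
  have jets: "\<exists>a A. jet2 \<phi> z a A \<and> snd a \<le> 0 \<and> b * snd a \<le> space_trace A" if z: "z \<in> U \<times> {\<delta> / 2<..<T'}" for z
  proof -
    obtain a A where j: "jet2 (mollify r v) z a A" using mollify_jet[OF r(1) vC] by blast
    have s1: "subsol (\<lambda>p l. b * p - l) (ball z (\<delta> / 4)) v" "subsol (\<lambda>p l. p) (ball z (\<delta> / 4)) v"
      using vsub[OF z] b by (auto simp: subsol_def F_limit_le_iff)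
    have "b * snd a \<le> space_trace A"
    proof (rule mollify_heat_subsolution[OF b r(1) _ vC _ j])
      show "subsol (\<lambda>p l. b * p - l) (ball z (real DIM('a \<times> real) * r + \<delta> / 8)) v"
        by (rule subsol_subset[OF s1(1)]) (use r(2) \<delta>(1) N_def in auto)
    qed (use \<delta> in auto)
    moreover have "snd a \<le> 0"
    proof (rule mollify_nonincreasing_jet[OF r(1) vC j, of "\<delta> / 16"])
      fix y and s :: real assume y: "y \<in> ?Q" and s: "0 \<le> s" "s < \<delta> / 16"
      obtain x t where xt: "z = (x, t)" by (cases z)
      obtain y1 y2 where yy: "y = (y1, y2)" by (cases y)
      have n12: "norm y1 \<le> \<delta> / 16" "\<bar>y2\<bar> \<le> \<delta> / 16"
        using yQ[OF y] r(2) norm_fst_le[of y1 y2] norm_snd_le[of y2 y1] by (auto simp: yy)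
      have sb: "ball x (\<delta> / 8) \<times> {t - \<delta> / 8<..<t + \<delta> / 8} \<subseteq> ball z (\<delta> / 4)"
      proof
        fix w assume w: "w \<in> ball x (\<delta> / 8) \<times> {t - \<delta> / 8<..<t + \<delta> / 8}"
        have "dist z w \<le> norm (fst (z - w)) + norm (snd (z - w))"
          using norm_Pair_le[of "fst (z - w)" "snd (z - w)"] by (simp only: dist_norm prod.collapse)
        also have "\<dots> < \<delta> / 8 + \<delta> / 8"
        proof (rule add_strict_mono)
          show "norm (fst (z - w)) < \<delta> / 8" using w by (auto simp: xt dist_norm)
          have "t - \<delta> / 8 < snd w" "snd w < t + \<delta> / 8" using w by auto
          then have "\<bar>t - snd w\<bar> < \<delta> / 8" by linarith
          then show "norm (snd (z - w)) < \<delta> / 8" by (simp add: xt)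
        qed
        finally show "w \<in> ball z (\<delta> / 4)" by simp
      qed
      have "v (x - y1, t - y2 + s) \<le> v (x - y1, t - y2)"
      proof (rule subsol_nonincreasing[OF open_ball continuous_on_subset[OF vC] subsol_subset[OF s1(2) sb]])
        show "\<bar>v w\<bar> \<le> M'" if "w \<in> ball x (\<delta> / 8) \<times> {t - \<delta> / 8<..<t + \<delta> / 8}" for w
        proof -
          have "ball z (\<delta> / 4) \<subseteq> ball z (\<delta> / 2)" using \<delta>(1) by (intro subset_ball) simp
          then have "w \<in> ball z (\<delta> / 2)" using sb that by blast
          then have "w \<in> K" using inside[OF z] UK by blast
          then show ?thesis using vbd[of w] M'(2)[of w] by (simp add: abs_le_iff)
        qed
        show "x - y1 \<in> ball x (\<delta> / 8)" using n12(1) \<delta>(1) by (simp add: dist_norm)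
        show "t - \<delta> / 8 < t - y2" "t - y2 \<le> t - y2 + s" "t - y2 + s < t + \<delta> / 8"
          using n12(2) s \<delta>(1) by linarith+
      qed simp
      then show "v (z - y + (0, s)) \<le> v (z - y)" by (simp add: xt yy)
    qed (use \<delta> in auto)
    moreover have "jet2 \<phi> z ((1 / m) *\<^sub>R a) (\<lambda>h. (1 / m) *\<^sub>R A h)"
      unfolding \<phi>_def[abs_def] using m by (intro jet2_scaleR j) simp
    ultimately show ?thesis
      using m by (intro exI[of _ "(1 / m) *\<^sub>R a"] exI[of _ "\<lambda>h. (1 / m) *\<^sub>R A h"])
        (auto simp: space_trace_scaleR divide_right_mono divide_le_0_iff)
  qed
  have bdry: "\<phi> (x, t) - 3 / 2 * c \<le> W (x, t)" if xt: "(x, t) \<in> K" "t < \<delta> \<or> infdist x (- \<Omega>) < \<delta>" for x t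
  proof -
    obtain y where y: "y \<in> K" "v (x, t) \<le> V y" "dist (x, t) y \<le> \<delta> / 16" using vbd(3)[OF xt(1)] by blast
    obtain \<gamma> where "\<gamma> \<in> \<Gamma>" "dist (x, t) \<gamma> < \<delta>" using near_bdry[OF xt] by blast
    then have "V y < W (x, t) + c" using y \<delta>(1) xt(1) by (intro near) auto
    then show ?thesis using y(2) app[of "(x, t)"] by linarith
  qed
  have clK: "closure U \<times> {\<delta> / 2..T'} \<subseteq> K"
  proof -
    have "closure U \<subseteq> closure \<Omega>" using clU\<Omega> closure_subset[of \<Omega>] by blast
    moreover have "{\<delta> / 2..T'} \<subseteq> {0..T}" using \<delta>(1) by (auto simp: T'_def)
    ultimately show ?thesis unfolding K_def by (rule Sigma_mono) 
  qed
  \<comment> \<open>The roles are exchanged: \<open>- W\<close> is the semicontinuous subsolution,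
    for the reflected operator, and the regularized function supplies the barrier.\<close>
  have "- W (x0, t0) \<le> - (\<phi> (x0, t0) - 3 / 2 * c)"
  proof (rule max_principle[where U = U and F = "negF (F_limit b)" and ?t0.0 = "\<delta> / 2" and T = T'
        and v = "\<lambda>z. - W z" and S = "\<lambda>z. - (\<phi> z - 3 / 2 * c)"])
    have "continuous_on (closure U \<times> {\<delta> / 2..T'}) (\<lambda>z. \<phi> z - 3 / 2 * c)"
      by (intro continuous_intros \<phi>C)
    from usc_add[OF usc_subset[OF W[folded K_def] clK] continuous_imp_usc[OF this]]
    show "upper_semicontinuous_on (closure U \<times> {\<delta> / 2..T'}) (\<lambda>z. - W z - - (\<phi> z - 3 / 2 * c))"
      by (simp only: diff_minus_eq_add)
    show "subsol (negF (F_limit b)) (U \<times> {\<delta> / 2<..<T'}) (\<lambda>z. - W z)"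
      by (rule subsol_subset[OF supW]) (use U\<Omega> \<delta>(1) in \<open>auto simp: T'_def\<close>)
    show "\<exists>a A. superjet (\<lambda>z. - (\<phi> z - 3 / 2 * c)) z a A \<and> 0 \<le> negF (F_limit b) (snd a) (space_trace A)"
      if z: "z \<in> U \<times> {\<delta> / 2<..<T'}" for z
    proof -
      obtain a A where aA: "jet2 \<phi> z a A" "snd a \<le> 0" "b * snd a \<le> space_trace A" using jets[OF z] by blast
      have "superjet (\<lambda>z. - \<phi> z + 3 / 2 * c) z (- a) (\<lambda>h. - A h)"
        unfolding superjet_shift_const using aA(1) by (simp add: jet2_def)
      moreover have "0 \<le> negF (F_limit b) (snd (- a)) (space_trace (\<lambda>h. - A h))"
        using aA(2,3) b F_limit_le_iff[OF b, of "snd a" "space_trace A"] by (simp add: negF_def space_trace_uminus)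
      moreover have "(\<lambda>z. - (\<phi> z - 3 / 2 * c)) = (\<lambda>z. - \<phi> z + 3 / 2 * c)" by (simp add: fun_eq_iff)
      ultimately show ?thesis by metis
    qed
    show "0 < negF (F_limit b) (p + k) l" if "k > 0" "0 \<le> negF (F_limit b) p l" for p l k
      using that(2) mult_pos_pos[OF b that(1)] by (simp add: negF_def F_limit_def algebra_simps)
    show "- W (x, \<delta> / 2) \<le> - (\<phi> (x, \<delta> / 2) - 3 / 2 * c)" if "x \<in> closure U" for x
    proof -
      have "(x, \<delta> / 2) \<in> K" using clK that \<delta> z0in z0 by (auto simp: T'_def)
      then show ?thesis using bdry[of x "\<delta> / 2"] \<delta>(1) by simp
    qed
    show "- W (x, t) \<le> - (\<phi> (x, t) - 3 / 2 * c)" if "x \<in> frontier U" "\<delta> / 2 \<le> t" "t \<le> T'" for x t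
    proof -
      have "(x, t) \<in> K" using clK that by (auto simp: frontier_def)
      then show ?thesis using bdry[of x t] frU[OF that(1)] \<delta>(1) by simp
    qed
    show "x0 \<in> closure U" using z0in(2) \<delta>(1) closure_subset[of U] by (auto simp: U_def)
  qed (use U bU z0in \<delta> in \<open>auto simp: T'_def\<close>)
  moreover have "V (x0, t0) \<le> v (x0, t0)" by (rule vbd(1)[OF z0K])
  ultimately show False using app[of "(x0, t0)"] c by linarith
qed

section \<open>Barriers\<close>

text \<open>
  The first condition holds with the same \<open>b = b\<^sup>-\<close> for all \<open>b\<^sup>+\<close> and for the reflected operators: this
  makes the barriers independent of \<open>b\<^sup>+\<close>.
\<close>

definition growth :: "real \<Rightarrow> (real \<Rightarrow> real \<Rightarrow> real) \<Rightarrow> bool" where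
  "growth b F \<longleftrightarrow> (\<forall>p l. 0 \<le> p \<longrightarrow> l \<le> b * p \<longrightarrow> 0 \<le> F p l) \<and> (\<forall>p l c. 0 < c \<longrightarrow> 0 \<le> F p l \<longrightarrow> 0 < F (p + c) l)"

lemma F_two_speed_max:
  assumes "bm < bp" "0 < bm"
  shows "F_two_speed bm bp p l = max (bm * p) (bp * p) - l"
  using assms mult_right_mono[of bm bp p] mult_right_mono_neg[of bm bp p]
  by (auto simp: F_two_speed_def b_coeff_def max_def)

text \<open>For \<open>p \<ge> 0\<close> the operator is \<open>bp * p - l\<close>, which is at
  least \<open>bm * p - l\<close>, and the reflected one equals \<open>bm * p - l\<close>; hence the
  single constant \<open>bm\<close> for both.\<close>

lemma growth_two_speed:
  assumes "bm < bp" "0 < bm"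
  shows "growth bm (F_two_speed bm bp)" "growth bm (negF (F_two_speed bm bp))"
proof -
  have k: "bm * c > 0" "bp * c > 0" if "c > 0" for c using assms that by auto
  show "growth bm (F_two_speed bm bp)"
    unfolding growth_def F_two_speed_max[OF assms]
  proof (intro conjI allI impI)
    fix p l c :: real
    show "0 \<le> max (bm * p) (bp * p) - l" if "l \<le> bm * p" using that by simp
    show "0 < max (bm * (p + c)) (bp * (p + c)) - l" if "0 < c" "0 \<le> max (bm * p) (bp * p) - l"
      using that k[OF that(1)] by (auto simp: max_def distrib_left split: if_splits)
  qed
  show "growth bm (negF (F_two_speed bm bp))"
    unfolding growth_def negF_def F_two_speed_max[OF assms]
  proof (intro conjI allI impI)
    fix p l c :: real
    show "0 \<le> - (max (bm * - p) (bp * - p) - - l)" if "0 \<le> p" "l \<le> bm * p"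
      using that mult_right_mono[of bm bp p] assms by simp
    show "0 < - (max (bm * - (p + c)) (bp * - (p + c)) - - l)" if "0 < c" "0 \<le> - (max (bm * - p) (bp * - p) - - l)"
      using that k[OF that(1)] by (auto simp: max_def distrib_left right_diff_distrib split: if_splits)
  qed
qed

lemma growth_limit:
  assumes "0 < b"
  shows "growth b (F_limit b)" "growth b (negF (F_limit b))"
proof -
  have k: "b * c > 0" if "c > 0" for c using assms that by auto
  have m: "b * p \<ge> 0" if "p \<ge> 0" for p using assms that by auto
  show "growth b (F_limit b)"
    unfolding growth_def F_limit_def
  proof (intro conjI allI impI)
    fix p l c :: real
    show "0 \<le> b * p - min l 0" if "0 \<le> p" "l \<le> b * p" using m[OF that(1)] that(2) by (auto simp: min_def)
    show "0 < b * (p + c) - min l 0" if "0 < c" "0 \<le> b * p - min l 0"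
      using k[OF that(1)] that(2) unfolding distrib_left by linarith
  qed
  show "growth b (negF (F_limit b))"
    unfolding growth_def negF_def F_limit_def
  proof (intro conjI allI impI)
    fix p l c :: real
    show "0 \<le> - (b * - p - min (- l) 0)" if "0 \<le> p" "l \<le> b * p" using m[OF that(1)] that(2) by (auto simp: min_def)
    have "b * - (p + c) = b * - p - b * c" by (simp add: algebra_simps)
    then show "0 < - (b * - (p + c) - min (- l) 0)" if "0 < c" "0 \<le> - (b * - p - min (- l) 0)"
      using k[OF that(1)] that(2) by linarith
  qed
qed

text \<open>Nondecreasing in time and a supersolution of the heat equation: by the first half of
  \<open>growth\<close>, such a function is an upper barrier for every operator in question.\<close>

definition classical_super ::
    "real \<Rightarrow> 'a::euclidean_space set \<Rightarrow> ('a \<times> real \<Rightarrow> real) \<Rightarrow> bool" where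
  "classical_super b \<Omega> S \<longleftrightarrow> continuous_on UNIV S \<and>
     (\<forall>z\<in>\<Omega> \<times> {0<..}. \<exists>a A. jet2 S z a A \<and> 0 \<le> snd a \<and> space_trace A \<le> b * snd a)"

lemma subsol_le_barrier:
  fixes u S :: "'a::euclidean_space \<times> real \<Rightarrow> real"
  assumes \<Omega>: "open \<Omega>" "bounded \<Omega>" and F: "growth b F"
    and u: "continuous_on (closure \<Omega> \<times> {0..}) u" "subsol F (\<Omega> \<times> {0<..}) u"
    and S: "classical_super b \<Omega> S"
    and init: "\<And>x. x \<in> closure \<Omega> \<Longrightarrow> u (x, 0) \<le> S (x, 0)"
    and lat: "\<And>x t. x \<in> frontier \<Omega> \<Longrightarrow> 0 \<le> t \<Longrightarrow> u (x, t) \<le> S (x, t)"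
    and z: "z \<in> closure \<Omega> \<times> {0..}"
  shows "u z \<le> S z"
proof -
  obtain x t where xt: "z = (x, t)" by (cases z)
  have "u (x, t) \<le> S (x, t)"
  proof (rule max_principle[OF \<Omega>, where F = F and ?t0.0 = 0 and T = "t + 1"])
    show "upper_semicontinuous_on (closure \<Omega> \<times> {0..t + 1}) (\<lambda>z. u z - S z)"
      using S unfolding classical_super_def
      by (intro continuous_imp_usc continuous_on_diff continuous_on_subset[OF u(1)]) (auto intro: continuous_on_subset)
    show "subsol F (\<Omega> \<times> {0<..<t + 1}) u" by (rule subsol_subset[OF u(2)]) auto
    show "\<exists>a A. superjet S z a A \<and> 0 \<le> F (snd a) (space_trace A)" if "z \<in> \<Omega> \<times> {0<..<t + 1}" for z
    proof -
      have "z \<in> \<Omega> \<times> {0<..}" using that by auto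
      then obtain a A where "jet2 S z a A" "0 \<le> snd a" "space_trace A \<le> b * snd a"
        using S unfolding classical_super_def by blast
      then show ?thesis using F unfolding growth_def by (blast dest: jet2_superjet)
    qed
    show "0 < F (p + c) l" if "c > 0" "0 \<le> F p l" for p l c
      using F that unfolding growth_def by blast
  qed (use init lat z xt in auto)
  then show ?thesis by (simp add: xt)
qed

text \<open>A steep paraboloid around \<open>p\<close> dominates \<open>u0\<close>, and linear
  growth in time pays for its Laplacian. On the lateral boundary it starts above
  \<open>u0 = 0\<close> and does not decrease.\<close>

lemma initial_barrier:
  fixes u0 :: "'a::euclidean_space \<Rightarrow> real"
  assumes \<Omega>: "bounded \<Omega>" and u0: "continuous_on (closure \<Omega>) u0" "\<forall>x\<in>frontier \<Omega>. u0 x = 0"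
    and b: "b > 0" and p: "p \<in> closure \<Omega>" and \<epsilon>: "\<epsilon> > 0"
  shows "\<exists>S. classical_super b \<Omega> S \<and> (\<forall>x\<in>closure \<Omega>. u0 x \<le> S (x, 0)) \<and>
    (\<forall>x\<in>frontier \<Omega>. \<forall>t\<ge>0. 0 \<le> S (x, t)) \<and> S (p, 0) \<le> u0 p + \<epsilon>"
proof -
  have cpt: "compact (closure \<Omega>)" using \<Omega> by (simp add: compact_closure)
  have "bounded (u0 ` closure \<Omega>)" by (intro compact_imp_bounded compact_continuous_image u0 cpt)
  then obtain M where M: "M > 0" "\<And>x. x \<in> closure \<Omega> \<Longrightarrow> \<bar>u0 x\<bar> \<le> M" unfolding bounded_pos by auto
  obtain d where d: "d > 0" "\<And>x. x \<in> closure \<Omega> \<Longrightarrow> dist x p < d \<Longrightarrow> dist (u0 x) (u0 p) < \<epsilon>"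
    using u0(1) p \<epsilon> unfolding continuous_on_iff by metis
  \<comment> \<open>At distance \<open>d\<close> from \<open>p\<close> the paraboloid has gained
    \<open>2 * M\<close>, a bound for the oscillation of \<open>u0\<close>; \<open>D\<close> below
    balances its Laplacian.\<close>
  define C where "C = 2 * M / d\<^sup>2"
  define D where "D = 2 * C * DIM('a) / b"
  have C: "C > 0" using M d by (simp add: C_def)
  have D: "D \<ge> 0" "b * D = 2 * C * DIM('a)" using C b by (auto simp: D_def)
  define S where "S z = (u0 p + \<epsilon>) + C * (norm (fst z - p))\<^sup>2 + D * snd z" for z :: "'a \<times> real"
  have "classical_super b \<Omega> S"
    unfolding classical_super_def
  proof (intro conjI ballI)
    show "continuous_on UNIV S" unfolding S_def by (intro continuous_intros)
    fix z
    have "jet2 S z ((2 * C) *\<^sub>R (fst z - p), D) (\<lambda>h. ((2 * C) *\<^sub>R fst h, 0))"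
      unfolding S_def by (rule jet2_space_quadratic)
    moreover have "0 \<le> snd ((2 * C) *\<^sub>R (fst z - p), D)" using D by simp
    moreover have "space_trace (\<lambda>h :: 'a \<times> real. ((2 * C) *\<^sub>R fst h, 0)) \<le> b * snd ((2 * C) *\<^sub>R (fst z - p), D)"
      by (simp only: space_trace_space_quadratic snd_conv D(2))
    ultimately show "\<exists>a A. jet2 S z a A \<and> 0 \<le> snd a \<and> space_trace A \<le> b * snd a" by blast
  qed
  moreover have le: "u0 x \<le> S (x, 0)" if x: "x \<in> closure \<Omega>" for x
  proof (cases "dist x p < d")
    case True
    have "C * (norm (x - p))\<^sup>2 \<ge> 0" using C by simp
    moreover have "dist (u0 x) (u0 p) < \<epsilon>" by (rule d(2)[OF x True])
    ultimately show ?thesis unfolding S_def dist_real_def fst_conv snd_conv by linarith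
  next
    case False
    then have "d\<^sup>2 \<le> (norm (x - p))\<^sup>2" using d by (intro power_mono) (auto simp: dist_norm)
    then have "C * d\<^sup>2 \<le> C * (norm (x - p))\<^sup>2" using C by (intro mult_left_mono) auto
    moreover have "C * d\<^sup>2 = 2 * M" using d by (simp add: C_def)
    ultimately show ?thesis using M(2)[OF x] M(2)[OF p] \<epsilon> unfolding S_def fst_conv snd_conv by linarith
  qed
  moreover have "0 \<le> S (x, t)" if x: "x \<in> frontier \<Omega>" and t: "t \<ge> 0" for x t
  proof -
    have "0 = u0 x" using u0(2) x by simp
    also have "\<dots> \<le> S (x, 0)" using x by (intro le) (auto simp: frontier_def)
    also have "\<dots> \<le> S (x, t)" using D t by (simp add: S_def)
    finally show ?thesis .
  qed
  moreover have "S (p, 0) \<le> u0 p + \<epsilon>" by (simp add: S_def)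
  ultimately show ?thesis by blast
qed

text \<open>Near \<open>p\<close> the domain is \<open>{g < 0}\<close>, and the second-order
  expansion gives \<open>g (p + h) \<ge> n \<bullet> h - C * (h \<bullet> h)\<close>. In a small
  closed ball touching the boundary at \<open>p\<close> from the side of \<open>n\<close>, this
  lower bound is positive except at \<open>p\<close>.\<close>

lemma exterior_ball:
  fixes \<Omega> :: "'a::euclidean_space set"
  assumes \<Omega>: "smooth_bounded_domain \<Omega>" and p: "p \<in> frontier \<Omega>"
  shows "\<exists>c \<rho>. \<rho> > 0 \<and> dist c p = \<rho> \<and> (\<forall>x\<in>closure \<Omega>. x \<noteq> p \<longrightarrow> \<rho> < dist c x)"
proof -
  obtain U and g :: "'a \<Rightarrow> real" where U: "open U" "p \<in> U" "smooth_on U g"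
    "\<And>x. x \<in> U \<Longrightarrow> frechet_derivative g (at x) \<noteq> (\<lambda>_. 0)" "\<Omega> \<inter> U = {x\<in>U. g x < 0}"
    using assms unfolding smooth_bounded_domain_def by meson
  obtain G A where G: "\<And>y. y \<in> U \<Longrightarrow> (g has_derivative (\<lambda>h. G y \<bullet> h)) (at y)" and j: "jet2 g p (G p) A"
    using smooth_on_jet2[OF U(1,2,3)] by blast
  define n where "n = G p"
  have n: "n \<noteq> 0"
  proof
    assume "n = 0"
    then have "frechet_derivative g (at p) = (\<lambda>_. 0)"
      using frechet_derivative_at[OF G[OF U(2)]] by (simp add: n_def)
    then show False using U(4)[OF U(2)] by simp
  qed
  have "open \<Omega>" using \<Omega> by (simp add: smooth_bounded_domain_def)
  then have "p \<notin> \<Omega>" using p by (simp add: frontier_def interior_open)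
  then have gp: "g p \<ge> 0" using U(2,5) by (auto simp: not_less[symmetric])
  have linA: "linear A" using j superjet_linear by (auto simp: jet2_def)
  then obtain B where B: "B > 0" "\<And>h. norm (A h) \<le> norm h * B"
    using bounded_linear.pos_bounded linear_conv_bounded_linear by blast
  define C where "C = B / 2 + 1"
  have C: "C > 0" using B by (simp add: C_def)
  have "\<forall>\<^sub>F h in nhds 0. - g (p + h) \<le> - g p + (- n) \<bullet> h + ((- A h) \<bullet> h) / 2 + 1 * (h \<bullet> h)"
    using j superjetD[of "\<lambda>z. - g z" p "- G p" "\<lambda>h. - A h" 1] by (simp add: jet2_def n_def)
  then obtain d1 where d1: "d1 > 0" "\<And>h. norm h < d1 \<Longrightarrow> - g (p + h) \<le> - g p + (- n) \<bullet> h + ((- A h) \<bullet> h) / 2 + 1 * (h \<bullet> h)"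
    unfolding eventually_nhds_metric by (auto simp: dist_norm)
  obtain d2 where d2: "d2 > 0" "ball p d2 \<subseteq> U" using U(1,2) open_contains_ball by blast
  have lower: "n \<bullet> h - C * (h \<bullet> h) \<le> g (p + h)" if "norm h < d1" for h
  proof -
    have "\<bar>A h \<bullet> h\<bar> \<le> norm (A h) * norm h" by (rule Cauchy_Schwarz_ineq2)
    also have "\<dots> \<le> (norm h * B) * norm h" by (intro mult_right_mono B) auto
    also have "\<dots> = B * (h \<bullet> h)" by (simp add: power2_norm_eq_inner[symmetric] power2_eq_square)
    finally have "- (A h \<bullet> h) / 2 \<le> B / 2 * (h \<bullet> h)" by simp
    with d1(2)[OF that] gp show ?thesis by (simp add: C_def algebra_simps)
  qed
  define d where "d = min d1 d2"
  have d: "d > 0" using d1 d2 by (simp add: d_def)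
  \<comment> \<open>The first bound makes the curvature of the sphere beat the quadratic term, the
    second keeps the ball in the region where the expansion holds.\<close>
  define \<tau> where "\<tau> = min (1 / (4 * C)) (d / (4 * norm n))"
  have \<tau>: "\<tau> > 0" "2 * \<tau> * C < 1" "2 * \<tau> * norm n < d"
  proof -
    show "\<tau> > 0" using C d n by (simp add: \<tau>_def)
    have "\<tau> * C \<le> 1 / (4 * C) * C" using C by (intro mult_right_mono) (auto simp: \<tau>_def)
    then show "2 * \<tau> * C < 1" using C by simp
    have "\<tau> * norm n \<le> d / (4 * norm n) * norm n" by (intro mult_right_mono) (auto simp: \<tau>_def)
    then show "2 * \<tau> * norm n < d" using n d by simp
  qed
  define c where "c = p + \<tau> *\<^sub>R n"
  define \<rho> where "\<rho> = \<tau> * norm n"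
  have "\<rho> > 0" using \<tau> n by (simp add: \<rho>_def)
  moreover have "dist c p = \<rho>" using \<tau> by (simp add: c_def \<rho>_def dist_norm)
  moreover have "\<rho> < dist c x" if x: "x \<in> closure \<Omega>" "x \<noteq> p" for x
  proof (rule ccontr)
    assume "\<not> \<rho> < dist c x"
    then have le: "dist c x \<le> \<rho>" by simp
    define h where "h = x - p"
    have h: "h \<noteq> 0" "x = p + h" using x by (auto simp: h_def)
    have "norm (h - \<tau> *\<^sub>R n) \<le> \<tau> * norm n"
      using le by (simp add: c_def \<rho>_def h_def dist_norm norm_minus_commute algebra_simps)
    then have "(norm (h - \<tau> *\<^sub>R n))\<^sup>2 \<le> (\<tau> * norm n)\<^sup>2" by (intro power_mono) auto
    moreover have "(norm (h - \<tau> *\<^sub>R n))\<^sup>2 = h \<bullet> h - 2 * \<tau> * (n \<bullet> h) + \<tau>\<^sup>2 * (n \<bullet> n)"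
      unfolding power2_norm_eq_inner by (simp add: inner_diff_left inner_diff_right inner_commute power2_eq_square)
    moreover have "(\<tau> * norm n)\<^sup>2 = \<tau>\<^sup>2 * (n \<bullet> n)" by (simp add: power_mult_distrib power2_norm_eq_inner)
    ultimately have hh: "h \<bullet> h \<le> 2 * \<tau> * (n \<bullet> h)" by linarith
    have "norm h \<le> norm (h - \<tau> *\<^sub>R n) + norm (\<tau> *\<^sub>R n)" using norm_triangle_ineq[of "h - \<tau> *\<^sub>R n" "\<tau> *\<^sub>R n"] by simp
    also have "\<dots> \<le> 2 * \<tau> * norm n" using \<open>norm (h - \<tau> *\<^sub>R n) \<le> \<tau> * norm n\<close> \<tau> by simp
    finally have hd: "norm h < d" using \<tau> by simp
    have hp: "h \<bullet> h > 0" using h by simp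
    have "2 * \<tau> * C * (h \<bullet> h) < 1 * (h \<bullet> h)" using \<tau> hp by (intro mult_strict_right_mono) auto
    also have "\<dots> \<le> 2 * \<tau> * (n \<bullet> h)" using hh by simp
    finally have "(2 * \<tau>) * (C * (h \<bullet> h)) < (2 * \<tau>) * (n \<bullet> h)" by (simp add: mult.assoc)
    then have "C * (h \<bullet> h) < n \<bullet> h" using \<tau> by simp
    then have gx: "g x > 0" using lower[of h] hd h by (simp add: d_def)
    have xU: "x \<in> U" using d2(2) hd h by (auto simp: d_def dist_norm)
    \<comment> \<open>Positivity of \<open>g\<close> at \<open>x\<close> persists in a neighbourhood
      that misses the domain, so \<open>x\<close> is not even in the closure.\<close>
    have "continuous_on U g"
      using G by (intro continuous_at_imp_continuous_on ballI has_derivative_continuous)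
    then have "open (U \<inter> g -` {0<..})" using U(1) by (intro continuous_open_preimage) auto
    moreover have "(U \<inter> g -` {0<..}) \<inter> \<Omega> = {}"
    proof -
      have "g y < 0" if "y \<in> \<Omega>" "y \<in> U" for y using U(5) that by blast
      then show ?thesis by force
    qed
    ultimately have "(U \<inter> g -` {0<..}) \<inter> closure \<Omega> = {}" by (simp add: open_Int_closure_eq_empty)
    then show False using xU gx x by auto
  qed
  ultimately show ?thesis by blast
qed

lemma exp_barrier_jet:
  fixes c :: "'a::euclidean_space" and z :: "'a \<times> real" and \<alpha> \<beta> \<gamma> K :: real
  defines "e \<equiv> exp (- \<alpha> * ((fst z - c) \<bullet> (fst z - c) - \<beta>))"
  shows "jet2 (\<lambda>z. \<gamma> - K * exp (- \<alpha> * ((fst z - c) \<bullet> (fst z - c) - \<beta>))) z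
    ((2 * K * \<alpha> * e) *\<^sub>R (fst z - c), 0)
    (\<lambda>h. ((2 * K * \<alpha> * e) *\<^sub>R fst h - (4 * K * \<alpha>\<^sup>2 * e * ((fst z - c) \<bullet> fst h)) *\<^sub>R (fst z - c), 0))"
proof -
  define E where "E z = exp (- \<alpha> * ((fst z - c) \<bullet> (fst z - c) - \<beta>))" for z :: "'a \<times> real"
  have dx: "((\<lambda>z :: 'a \<times> real. fst z - c) has_derivative (\<lambda>h. fst h)) (at z)" for z
    by (auto intro!: derivative_eq_intros)
  have "((\<lambda>z :: 'a \<times> real. - \<alpha> * ((fst z - c) \<bullet> (fst z - c) - \<beta>)) has_derivative
      (\<lambda>h. - \<alpha> * ((fst z - c) \<bullet> fst h + fst h \<bullet> (fst z - c) - 0))) (at z)" for z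
    by (intro has_derivative_mult_right has_derivative_diff has_derivative_const has_derivative_inner dx)
  from has_derivative_exp[OF this]
  have dE: "(E has_derivative (\<lambda>h. - (2 * \<alpha> * E z * ((fst z - c) \<bullet> fst h)))) (at z)" for z
    unfolding E_def[abs_def] by (rule has_derivative_eq_rhs) (simp add: fun_eq_iff inner_commute algebra_simps)
  have "jet2 (\<lambda>z. \<gamma> - K * E z) z ((2 * K * \<alpha> * E z) *\<^sub>R (fst z - c), 0)
    (\<lambda>h. ((2 * K * \<alpha> * E z) *\<^sub>R fst h - (4 * K * \<alpha>\<^sup>2 * E z * ((fst z - c) \<bullet> fst h)) *\<^sub>R (fst z - c), 0))"
  proof (rule jet2_gradient[where F = "\<lambda>z. ((2 * K * \<alpha> * E z) *\<^sub>R (fst z - c), 0)"])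
    have "((\<lambda>z. \<gamma> - K * E z) has_derivative (\<lambda>h. 0 - K * - (2 * \<alpha> * E z * ((fst z - c) \<bullet> fst h)))) (at z)" for z
      by (intro has_derivative_diff has_derivative_const has_derivative_mult_right dE)
    then have "((\<lambda>z. \<gamma> - K * E z) has_derivative (\<bullet>) ((2 * K * \<alpha> * E z) *\<^sub>R (fst z - c), 0)) (at z)" for z
      by (rule has_derivative_eq_rhs) (simp add: fun_eq_iff inner_prod_def)
    then show "\<forall>\<^sub>F z in nhds z. ((\<lambda>z. \<gamma> - K * E z) has_derivative (\<bullet>) ((2 * K * \<alpha> * E z) *\<^sub>R (fst z - c), 0)) (at z)"
      by simp
    have "((\<lambda>z. ((2 * K * \<alpha> * E z) *\<^sub>R (fst z - c), 0::real)) has_derivative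
        (\<lambda>h. ((2 * K * \<alpha> * E z) *\<^sub>R fst h + (2 * K * \<alpha> * - (2 * \<alpha> * E z * ((fst z - c) \<bullet> fst h))) *\<^sub>R (fst z - c), 0))) (at z)"
      by (intro has_derivative_Pair has_derivative_const has_derivative_scaleR has_derivative_mult_right dE dx)
    then show "((\<lambda>z. ((2 * K * \<alpha> * E z) *\<^sub>R (fst z - c), 0::real)) has_derivative
        (\<lambda>h. ((2 * K * \<alpha> * E z) *\<^sub>R fst h - (4 * K * \<alpha>\<^sup>2 * E z * ((fst z - c) \<bullet> fst h)) *\<^sub>R (fst z - c), 0))) (at z)"
      by (rule has_derivative_eq_rhs) (simp add: fun_eq_iff power2_eq_square algebra_simps)
  qed
  then show ?thesis unfolding E_def e_def .
qed

text \<open>The classical barrier \<open>1 - exp (- \<alpha> * q x)\<close> on an exterior ball,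
  \<open>q\<close> being the squared distance to its center minus the squared radius. On the closure
  it vanishes only at \<open>p\<close>, so a multiple of it dominates \<open>u0\<close> away from
  \<open>p\<close>, and \<epsilon> does so near \<open>p\<close>. Being independent of time, it
  serves for all times at once.\<close>

lemma boundary_barrier:
  fixes u0 :: "'a::euclidean_space \<Rightarrow> real"
  assumes \<Omega>: "smooth_bounded_domain \<Omega>" and u0: "continuous_on (closure \<Omega>) u0" "\<forall>x\<in>frontier \<Omega>. u0 x = 0"
    and b: "b > 0" and p: "p \<in> frontier \<Omega>" and \<epsilon>: "\<epsilon> > 0"
  shows "\<exists>\<psi>. classical_super b \<Omega> (\<lambda>z. \<psi> (fst z)) \<and> continuous_on UNIV \<psi> \<and> (\<forall>x\<in>closure \<Omega>. u0 x \<le> \<psi> x \<and> 0 \<le> \<psi> x) \<and> \<psi> p \<le> \<epsilon>"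
proof -
  have "bounded \<Omega>" using \<Omega> by (simp add: smooth_bounded_domain_def)
  then have cpt: "compact (closure \<Omega>)" by (simp add: compact_closure)
  have pc: "p \<in> closure \<Omega>" using p by (simp add: frontier_def)
  have "bounded (u0 ` closure \<Omega>)" by (intro compact_imp_bounded compact_continuous_image u0 cpt)
  then obtain M where M: "M > 0" "\<And>x. x \<in> closure \<Omega> \<Longrightarrow> \<bar>u0 x\<bar> \<le> M" unfolding bounded_pos by auto
  obtain d where d: "d > 0" "\<And>x. x \<in> closure \<Omega> \<Longrightarrow> dist x p < d \<Longrightarrow> dist (u0 x) (u0 p) < \<epsilon>"
    using u0(1) pc \<epsilon> unfolding continuous_on_iff by metis
  obtain c \<rho> where c: "\<rho> > 0" "dist c p = \<rho>" "\<And>x. x \<in> closure \<Omega> \<Longrightarrow> x \<noteq> p \<Longrightarrow> \<rho> < dist c x"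
    using exterior_ball[OF \<Omega> p] by blast
  \<comment> \<open>With this value the Laplacian terms combine to a nonpositive multiple of
    \<open>q\<close>, and \<open>q\<close> is nonnegative outside the ball.\<close>
  define \<alpha> where "\<alpha> = real DIM('a) / (2 * \<rho>\<^sup>2)"
  have \<alpha>: "\<alpha> > 0" "2 * \<alpha> * \<rho>\<^sup>2 = DIM('a)" using c by (auto simp: \<alpha>_def)
  define q where "q x = (x - c) \<bullet> (x - c) - \<rho>\<^sup>2" for x
  have qd: "q x = (dist c x)\<^sup>2 - \<rho>\<^sup>2" for x
    by (simp add: q_def dist_norm power2_norm_eq_inner norm_minus_commute[of c x])
  have q0: "q x \<ge> 0" if "x \<in> closure \<Omega>" for x
    using c(2) c(3)[OF that] c(1) by (cases "x = p") (auto simp: qd intro!: power_mono)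
  have qpos: "q x > 0" if "x \<in> closure \<Omega>" "x \<noteq> p" for x
    using c(3)[OF that] c(1) by (auto simp: qd intro!: power_strict_mono)
  define bar where "bar x = 1 - exp (- \<alpha> * q x)" for x
  have bar_nonneg: "bar x \<ge> 0" if "x \<in> closure \<Omega>" for x using q0[OF that] \<alpha> by (simp add: bar_def)
  have bar_pos: "bar x > 0" if "x \<in> closure \<Omega>" "x \<noteq> p" for x using qpos[OF that] \<alpha> by (simp add: bar_def)
  have bar_cont: "continuous_on S bar" for S unfolding bar_def q_def by (intro continuous_intros)
  have "\<exists>K>0. \<forall>x\<in>closure \<Omega> - ball p d. M \<le> K * bar x"
  proof (cases "closure \<Omega> - ball p d = {}")
    case False
    have "compact (closure \<Omega> - ball p d)" using cpt by (rule compact_diff) auto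
    from continuous_attains_inf[OF this False bar_cont] obtain x0 where
      x0: "x0 \<in> closure \<Omega> - ball p d" "\<And>x. x \<in> closure \<Omega> - ball p d \<Longrightarrow> bar x0 \<le> bar x" by blast
    have pos: "bar x0 > 0" using x0(1) d by (intro bar_pos) auto
    show ?thesis
    proof (intro exI[of _ "M / bar x0"] conjI ballI)
      show "M / bar x0 > 0" using M pos by simp
      fix x assume x: "x \<in> closure \<Omega> - ball p d"
      have "M = M / bar x0 * bar x0" using pos by simp
      also have "\<dots> \<le> M / bar x0 * bar x" using x0(2)[OF x] M pos by (intro mult_left_mono) auto
      finally show "M \<le> M / bar x0 * bar x" .
    qed
  qed (auto intro: exI[of _ 1])
  then obtain K where K: "K > 0" "\<And>x. x \<in> closure \<Omega> - ball p d \<Longrightarrow> M \<le> K * bar x" by blast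
  define \<psi> where "\<psi> x = (\<epsilon> + K) - K * exp (- \<alpha> * ((x - c) \<bullet> (x - c) - \<rho>\<^sup>2))" for x
  have psi_bar: "\<psi> x = \<epsilon> + K * bar x" for x by (simp add: \<psi>_def bar_def q_def algebra_simps)
  have "classical_super b \<Omega> (\<lambda>z. \<psi> (fst z))"
    unfolding classical_super_def
  proof (intro conjI ballI)
    show "continuous_on UNIV (\<lambda>z :: 'a \<times> real. \<psi> (fst z))" unfolding \<psi>_def by (intro continuous_intros)
    fix z :: "'a \<times> real" assume z: "z \<in> \<Omega> \<times> {0<..}"
    let ?e = "exp (- \<alpha> * ((fst z - c) \<bullet> (fst z - c) - \<rho>\<^sup>2))"
    let ?A = "\<lambda>h :: 'a \<times> real. ((2 * K * \<alpha> * ?e) *\<^sub>R fst h - (4 * K * \<alpha>\<^sup>2 * ?e * ((fst z - c) \<bullet> fst h)) *\<^sub>R (fst z - c), 0::real)"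
    have j: "jet2 (\<lambda>z. \<psi> (fst z)) z ((2 * K * \<alpha> * ?e) *\<^sub>R (fst z - c), 0) ?A"
      unfolding \<psi>_def by (rule exp_barrier_jet)
    have "space_trace ?A = (\<Sum>i\<in>Basis. 2 * K * \<alpha> * ?e * 1 - 4 * K * \<alpha>\<^sup>2 * ?e * (((fst z - c) \<bullet> i) * ((fst z - c) \<bullet> i)))"
      unfolding space_trace_def by (intro sum.cong refl) (simp add: inner_diff_left)
    also have "\<dots> = 2 * K * \<alpha> * ?e * DIM('a) - 4 * K * \<alpha>\<^sup>2 * ?e * ((fst z - c) \<bullet> (fst z - c))"
      by (simp add: sum_subtractf sum_distrib_left[symmetric] euclidean_inner[of "fst z - c" "fst z - c"])
    also have "\<dots> = - (4 * K * \<alpha>\<^sup>2 * ?e * q (fst z))"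
      unfolding \<alpha>(2)[symmetric] q_def by (simp add: algebra_simps power2_eq_square)
    also have "\<dots> \<le> 0"
    proof -
      have "fst z \<in> closure \<Omega>" using z closure_subset[of \<Omega>] by auto
      then show ?thesis using q0 K by simp
    qed
    finally have "space_trace ?A \<le> 0" .
    then show "\<exists>a A. jet2 (\<lambda>z. \<psi> (fst z)) z a A \<and> 0 \<le> snd a \<and> space_trace A \<le> b * snd a"
      using j by (intro exI[of _ "((2 * K * \<alpha> * ?e) *\<^sub>R (fst z - c), 0)"] exI[of _ ?A] conjI) auto
  qed
  moreover have "u0 x \<le> \<psi> x" if x: "x \<in> closure \<Omega>" for x
  proof (cases "dist x p < d")
    case True
    then have "u0 x < \<epsilon>" using d(2)[OF x True] u0(2) p by (simp add: dist_real_def)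
    moreover have "K * bar x \<ge> 0" using bar_nonneg[OF x] K by simp
    ultimately show ?thesis by (simp add: psi_bar)
  next
    case False
    then have "M \<le> K * bar x" using x by (intro K) (auto simp: dist_commute)
    then show ?thesis using M(2)[OF x] \<epsilon> by (simp add: psi_bar abs_le_iff)
  qed
  moreover have "0 \<le> \<psi> x" if "x \<in> closure \<Omega>" for x
    using bar_nonneg[OF that] K \<epsilon> by (simp add: psi_bar)
  moreover have "\<psi> p \<le> \<epsilon>" using c(2) by (simp add: psi_bar bar_def qd)
  moreover have "continuous_on UNIV \<psi>" unfolding \<psi>_def by (intro continuous_intros)
  ultimately show ?thesis by blast
qed

section \<open>Half-relaxed limits\<close>

definition relaxed_bounds :: "'b::metric_space set \<Rightarrow> (real \<Rightarrow> 'b \<Rightarrow> real) \<Rightarrow> 'b \<Rightarrow> real set" where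
  "relaxed_bounds D u z = {c. \<exists>B. \<exists>\<delta>>0. \<forall>\<beta>\<ge>B. \<forall>y\<in>D. dist y z < \<delta> \<longrightarrow> u \<beta> y \<le> c}"

text \<open>The upper half-relaxed limit of Barles and Perthame as the real index tends to infinity,
  with neighbourhoods taken in \<open>D\<close> and containing \<open>z\<close> itself. The lower
  one is minus the upper one of \<open>\<lambda>\<beta> y. - u \<beta> y\<close>.\<close>

definition relaxed_limsup :: "'b::metric_space set \<Rightarrow> (real \<Rightarrow> 'b \<Rightarrow> real) \<Rightarrow> 'b \<Rightarrow> real" where
  "relaxed_limsup D u z = Inf (relaxed_bounds D u z)"

context
  fixes D :: "'b::metric_space set" and u :: "real \<Rightarrow> 'b \<Rightarrow> real" and B0 M :: real
  assumes bd: "\<And>\<beta> y. \<beta> > B0 \<Longrightarrow> y \<in> D \<Longrightarrow> \<bar>u \<beta> y\<bar> \<le> M"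
begin

lemma relaxed_limsup_lower:
  assumes "z \<in> D" "c \<in> relaxed_bounds D u z"
  shows "- M \<le> c"
proof -
  obtain B \<delta> where "\<delta> > 0" "\<forall>\<beta>\<ge>B. \<forall>y\<in>D. dist y z < \<delta> \<longrightarrow> u \<beta> y \<le> c" using assms(2) unfolding relaxed_bounds_def by blast
  \<comment> \<open>The threshold \<open>B\<close> may lie below \<open>B0\<close>, where no bound
    on \<open>u\<close> is available.\<close>
  then have "u (max B (B0 + 1)) z \<le> c" using assms(1) by simp
  moreover have "\<bar>u (max B (B0 + 1)) z\<bar> \<le> M" using assms(1) by (intro bd) auto
  ultimately show ?thesis by linarith
qed

lemma relaxed_limsup_bdd: "z \<in> D \<Longrightarrow> bdd_below (relaxed_bounds D u z)"
  using relaxed_limsup_lower[of z] by (intro bdd_belowI[of _ "- M"]) blast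

lemma relaxed_limsup_mem: "M \<in> relaxed_bounds D u z"
proof -
  have "\<forall>\<beta>\<ge>B0 + 1. \<forall>y\<in>D. dist y z < 1 \<longrightarrow> u \<beta> y \<le> M"
    using bd by (force simp: abs_le_iff)
  then show ?thesis unfolding relaxed_bounds_def
    by - (rule CollectI, rule exI[of _ "B0 + 1"], rule exI[of _ "1::real"], simp)
qed

lemma relaxed_limsup_leI: "z \<in> D \<Longrightarrow> \<delta> > 0 \<Longrightarrow> (\<And>\<beta> y. \<beta> \<ge> B \<Longrightarrow> y \<in> D \<Longrightarrow> dist y z < \<delta> \<Longrightarrow> u \<beta> y \<le> c) \<Longrightarrow> relaxed_limsup D u z \<le> c"
  unfolding relaxed_limsup_def by (rule cInf_lower[OF _ relaxed_limsup_bdd]) (auto simp: relaxed_bounds_def)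

lemma relaxed_limsup_lessD:
  assumes "relaxed_limsup D u z < a"
  shows "\<exists>B. \<exists>\<delta>>0. \<forall>\<beta>\<ge>B. \<forall>y\<in>D. dist y z < \<delta> \<longrightarrow> u \<beta> y < a"
proof -
  have "relaxed_bounds D u z \<noteq> {}" using relaxed_limsup_mem by blast
  from cInf_lessD[OF this assms[unfolded relaxed_limsup_def]] obtain c where c: "c \<in> relaxed_bounds D u z" "c < a" by blast
  then obtain B \<delta> where "\<delta> > 0" "\<forall>\<beta>\<ge>B. \<forall>y\<in>D. dist y z < \<delta> \<longrightarrow> u \<beta> y \<le> c" unfolding relaxed_bounds_def by blast
  with c(2) show ?thesis by (meson le_less_trans)
qed

lemma relaxed_limsup_greaterD:
  assumes "z \<in> D" "a < relaxed_limsup D u z" "\<delta> > 0"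
  shows "\<exists>\<beta>\<ge>B. \<exists>y\<in>D. dist y z < \<delta> \<and> a < u \<beta> y"
proof (rule ccontr)
  assume "\<not> ?thesis"
  then have "u \<beta> y \<le> a" if "\<beta> \<ge> B" "y \<in> D" "dist y z < \<delta>" for \<beta> y
    using that by (meson not_less)
  then have "relaxed_limsup D u z \<le> a" by (rule relaxed_limsup_leI[OF assms(1,3)])
  with assms show False by simp
qed

lemma relaxed_limsup_bounds: "z \<in> D \<Longrightarrow> \<bar>relaxed_limsup D u z\<bar> \<le> M"
proof -
  assume z: "z \<in> D"
  have "relaxed_limsup D u z \<le> M" unfolding relaxed_limsup_def by (intro cInf_lower relaxed_limsup_mem relaxed_limsup_bdd z)
  moreover have "- M \<le> relaxed_limsup D u z" unfolding relaxed_limsup_def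
    using relaxed_limsup_mem[of z] relaxed_limsup_lower[OF z] by (intro cInf_greatest) blast+
  ultimately show ?thesis by simp
qed

lemma relaxed_limsup_usc: "upper_semicontinuous_on D (relaxed_limsup D u)"
  unfolding upper_semicontinuous_on_def
proof (intro ballI allI impI)
  fix z a assume z: "z \<in> D" and a: "relaxed_limsup D u z < a"
  obtain a' where a': "relaxed_limsup D u z < a'" "a' < a" using a dense by blast
  obtain B \<delta> where B: "\<delta> > 0" "\<forall>\<beta>\<ge>B. \<forall>y\<in>D. dist y z < \<delta> \<longrightarrow> u \<beta> y < a'" using relaxed_limsup_lessD[OF a'(1)] by blast
  show "\<forall>\<^sub>F y in at z within D. relaxed_limsup D u y < a"
    unfolding eventually_at
  proof (intro exI[of _ "\<delta> / 2"] conjI ballI impI)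
    fix y assume y: "y \<in> D" "y \<noteq> z \<and> dist y z < \<delta> / 2"
    have "relaxed_limsup D u y \<le> a'"
    proof (rule relaxed_limsup_leI[of y "\<delta> / 2" B])
      fix \<beta> w assume w: "\<beta> \<ge> B" "w \<in> D" "dist w y < \<delta> / 2"
      have "dist w z < \<delta>" using w(3) y(2) dist_triangle[of w z y] by linarith
      then show "u \<beta> w \<le> a'" using B(2) w by (simp add: less_imp_le)
    qed (use y B in auto)
    then show "relaxed_limsup D u y < a" using a' by simp
  qed (use B in auto)
qed

text \<open>A finite cover makes a pointwise strict inequality for the relaxed limit uniform on
  compact sets. Applied to \<open>u\<close> and to \<open>- u\<close>, this yields the uniform
  convergence in the end.\<close>

lemma relaxed_limsup_uniform:
  assumes K: "compact K" "K \<subseteq> D" and Q: "continuous_on K Q" and lt: "\<And>y. y \<in> K \<Longrightarrow> relaxed_limsup D u y < Q y"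
  shows "\<exists>B. \<forall>\<beta>\<ge>B. \<forall>y\<in>K. u \<beta> y < Q y"
proof -
  have "\<exists>B. \<exists>\<delta>>0. \<forall>\<beta>\<ge>B. \<forall>w\<in>K. dist w y < \<delta> \<longrightarrow> u \<beta> w < Q w" if y: "y \<in> K" for y
  proof -
    obtain a where a: "relaxed_limsup D u y < a" "a < Q y" using lt[OF y] dense by blast
    obtain B \<delta> where B: "\<delta> > 0" "\<forall>\<beta>\<ge>B. \<forall>w\<in>D. dist w y < \<delta> \<longrightarrow> u \<beta> w < a" using relaxed_limsup_lessD[OF a(1)] by blast
    obtain d where d: "d > 0" "\<And>w. w \<in> K \<Longrightarrow> dist w y < d \<Longrightarrow> dist (Q w) (Q y) < Q y - a"
      using Q y a(2) unfolding continuous_on_iff by (metis diff_gt_0_iff_gt)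
    have "u \<beta> w < Q w" if "\<beta> \<ge> B" "w \<in> K" "dist w y < min \<delta> d" for \<beta> w
    proof -
      have "u \<beta> w < a" using B(2) that K(2) by auto
      moreover have "dist (Q w) (Q y) < Q y - a" using that by (intro d) auto
      ultimately show ?thesis unfolding dist_real_def by linarith
    qed
    then show ?thesis using B(1) d(1) by - (rule exI[of _ B], rule exI[of _ "min \<delta> d"], auto)
  qed
  then obtain B \<delta> where B: "\<And>y. y \<in> K \<Longrightarrow> \<delta> y > 0"
    "\<And>y \<beta> w. y \<in> K \<Longrightarrow> \<beta> \<ge> B y \<Longrightarrow> w \<in> K \<Longrightarrow> dist w y < \<delta> y \<Longrightarrow> u \<beta> w < Q w" by metis
  have "K \<subseteq> (\<Union>y\<in>K. ball y (\<delta> y))" using B(1) by force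
  then obtain Y where Y: "Y \<subseteq> K" "finite Y" "K \<subseteq> (\<Union>y\<in>Y. ball y (\<delta> y))"
    using compactE_image[OF K(1), of K "\<lambda>y. ball y (\<delta> y)"] by auto
  \<comment> \<open>The inserted 0 covers the case of an empty \<open>Y\<close>.\<close>
  have "u \<beta> w < Q w" if \<beta>: "\<beta> \<ge> Max (insert 0 (B ` Y))" and w: "w \<in> K" for \<beta> w
  proof -
    obtain y where y: "y \<in> Y" "dist w y < \<delta> y" using Y(3) w by (auto simp: dist_commute)
    have "B y \<le> Max (insert 0 (B ` Y))" using Y(2) y(1) by (intro Max_ge) auto
    then show ?thesis using B(2)[of y \<beta> w] y Y(1) \<beta> w by auto
  qed
  then show ?thesis by blast
qed

end

text \<open>Stability of viscosity subsolutions. Instead of convergence of the operators,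
  \<open>lim\<close> asks that positivity of \<open>G\<close> at a point persist for
  \<open>F \<beta>\<close> near it, which tolerates operators that blow up.\<close>

theorem relaxed_limsup_subsol:
  fixes u :: "real \<Rightarrow> 'a::euclidean_space \<times> real \<Rightarrow> real"
  assumes bd: "\<And>\<beta> y. \<beta> > B0 \<Longrightarrow> y \<in> D \<Longrightarrow> \<bar>u \<beta> y\<bar> \<le> M"
    and U: "open U" "U \<subseteq> D"
    and cont: "\<And>\<beta>. \<beta> > B0 \<Longrightarrow> continuous_on U (u \<beta>)"
    and sub: "\<And>\<beta>. \<beta> > B0 \<Longrightarrow> subsol (F \<beta>) U (u \<beta>)"
    and lim: "\<And>p0 l0. G p0 l0 > 0 \<Longrightarrow> \<exists>e>0. \<exists>B. \<forall>\<beta>\<ge>B. \<forall>p l. \<bar>p - p0\<bar> < e \<longrightarrow> \<bar>l - l0\<bar> < e \<longrightarrow> F \<beta> p l > 0"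
  shows "subsol G U (relaxed_limsup D u)"
  unfolding subsol_def
proof (intro ballI allI impI, rule ccontr)
  fix z a A assume z: "z \<in> U" and sj: "superjet (relaxed_limsup D u) z a A" and "\<not> G (snd a) (space_trace A) \<le> 0"
  then have "G (snd a) (space_trace A) > 0" by simp
  from lim[OF this] obtain e B1 where e: "e > 0"
    "\<And>\<beta> p l. \<beta> \<ge> B1 \<Longrightarrow> \<bar>p - snd a\<bar> < e \<Longrightarrow> \<bar>l - space_trace A\<bar> < e \<Longrightarrow> F \<beta> p l > 0" by metis
  have zD: "z \<in> D" using z U by blast
  have linA: "linear A" using sj by (rule superjet_linear)
  define V where "V = relaxed_limsup D u"
  define N where "N = real DIM('a)"
  have N: "N \<ge> 1" using DIM_positive[where 'a = 'a] by (simp add: N_def Suc_le_eq)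
  define \<eta> where "\<eta> = e / (8 * N)"
  have \<eta>: "\<eta> > 0" "4 * \<eta> * N = e / 2" using e N by (auto simp: \<eta>_def)
  \<comment> \<open>The added \<open>4 * \<eta>\<close> makes the touching strict: on the annulus
    \<open>R\<close> below, \<open>Q\<close> exceeds the relaxed limit by at least \<kappa>, while
    the trace moves by \<open>e / 2\<close> only.\<close>
  define A' where "A' h = A h + (4 * \<eta>) *\<^sub>R h" for h
  have linA': "linear A'" unfolding A'_def[abs_def] by (rule linear_perturb[OF linA])
  define Q where "Q y = V z + a \<bullet> (y - z) + (A' (y - z) \<bullet> (y - z)) / 2" for y
  define L where "L h = (1/2) *\<^sub>R (A' h + adjoint A' h)" for h
  have jQ: "jet2 Q y (a + L (y - z)) L" for y
    using jet2_quadratic[OF linA', of "V z" a z y] by (simp add: Q_def[abs_def] L_def[abs_def])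
  have trL: "space_trace L = space_trace A + 4 * \<eta> * N"
  proof -
    have "adjoint A' (i, 0) \<bullet> (i, 0) = A' (i, 0) \<bullet> (i, 0)" for i
      using adjoint_works[OF linA', of "(i, 0)" "(i, 0)"] by (simp add: inner_commute del: inner_Pair)
    then have "space_trace L = space_trace A'" by (simp add: space_trace_def L_def inner_add_left del: inner_Pair)
    then show ?thesis by (simp only: A'_def[abs_def] space_trace_perturb N_def)
  qed
  have Qc: "continuous_on S Q" for S
    using smooth_on_quadratic[OF linA', of S "V z" a z]
    unfolding smooth_on_def Q_def[abs_def] by (auto dest: spec[of _ 0])
  have "bounded_linear L"
    unfolding L_def[abs_def] linear_conv_bounded_linear[symmetric]
    by (intro linear_compose_scale_right linear_compose_add linA' adjoint_linear)
  then obtain K where K: "K > 0" "\<And>h. norm (L h) \<le> norm h * K"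
    using bounded_linear.pos_bounded by blast
  obtain d1 where d1: "d1 > 0" "\<And>h. norm h < d1 \<Longrightarrow> V (z + h) \<le> V z + a \<bullet> h + (A h \<bullet> h) / 2 + \<eta> * (h \<bullet> h)"
    using superjetD[OF sj \<eta>(1)] unfolding eventually_nhds_metric V_def by (auto simp: dist_norm)
  obtain d2 where d2: "d2 > 0" "cball z d2 \<subseteq> U" using U(1) z open_contains_cball by blast
  define \<rho> where "\<rho> = min (d1 / 2) d2"
  have \<rho>: "\<rho> > 0" "\<rho> < d1" "cball z \<rho> \<subseteq> U" using d1 d2 by (auto simp: \<rho>_def)
  \<comment> \<open>Within this distance of \<open>z\<close> the time slope of \<open>Q\<close>
    varies by less than \<open>e\<close>.\<close>
  define \<delta> where "\<delta> = min \<rho> (e / K)"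
  have \<delta>: "\<delta> > 0" "\<delta> \<le> \<rho>" "\<delta> * K \<le> e"
  proof -
    show "\<delta> > 0" "\<delta> \<le> \<rho>" using \<rho> e K by (auto simp: \<delta>_def)
    have "\<delta> * K \<le> e / K * K" using K by (intro mult_right_mono) (auto simp: \<delta>_def)
    then show "\<delta> * K \<le> e" using K by simp
  qed
  define \<kappa> where "\<kappa> = \<eta> * \<delta>\<^sup>2"
  have \<kappa>: "\<kappa> > 0" using \<eta> \<delta> by (simp add: \<kappa>_def)
  define R where "R = cball z \<rho> - ball z \<delta>"
  have VR: "V y < Q y - \<kappa> / 2" if "y \<in> R" for y
  proof -
    define h where "h = y - z"
    have h: "\<delta> \<le> norm h" "norm h \<le> \<rho>" "y = z + h" using that by (auto simp: R_def h_def dist_norm norm_minus_commute)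
    have "\<delta>\<^sup>2 \<le> (norm h)\<^sup>2" using h \<delta> by (intro power_mono) auto
    then have "\<kappa> \<le> \<eta> * (h \<bullet> h)" using \<eta> by (simp add: \<kappa>_def power2_norm_eq_inner)
    moreover have "V (z + h) \<le> V z + a \<bullet> h + (A h \<bullet> h) / 2 + \<eta> * (h \<bullet> h)" using h \<rho> by (intro d1) auto
    moreover have "Q (z + h) = V z + a \<bullet> h + (A h \<bullet> h) / 2 + 2 * (\<eta> * (h \<bullet> h))"
      by (simp add: Q_def A'_def inner_add_left algebra_simps add_divide_distrib)
    ultimately have "V (z + h) < Q (z + h) - \<kappa> / 2" using \<kappa> by linarith
    then show ?thesis by (simp only: h(3)[symmetric])
  qed
  have cR: "compact R" unfolding R_def by (rule compact_diff) auto
  have RD: "R \<subseteq> D" using \<rho> U by (auto simp: R_def)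
  have "\<exists>B. \<forall>\<beta>\<ge>B. \<forall>y\<in>R. u \<beta> y < Q y - \<kappa> / 2"
  proof (rule relaxed_limsup_uniform[where ?B0.0 = B0 and M = M and D = D])
    show "continuous_on R (\<lambda>y. Q y - \<kappa> / 2)" by (intro continuous_intros Qc)
    show "relaxed_limsup D u y < Q y - \<kappa> / 2" if "y \<in> R" for y using VR[OF that] by (simp add: V_def)
  qed (use bd cR RD in auto)
  then obtain B2 where B2: "\<And>\<beta> y. \<beta> \<ge> B2 \<Longrightarrow> y \<in> R \<Longrightarrow> u \<beta> y < Q y - \<kappa> / 2" by blast
  have "isCont Q z" using Qc[of UNIV] continuous_on_eq_continuous_at[OF open_UNIV] by blast
  then obtain d3 where d3: "d3 > 0" "\<And>y. dist y z < d3 \<Longrightarrow> dist (Q y) (Q z) < \<kappa> / 4"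
    using \<kappa> unfolding continuous_at_eps_delta by (metis zero_less_divide_iff zero_less_numeral)
  have Qz: "Q z = V z" by (simp add: Q_def linear_0[OF linA'])
  \<comment> \<open>One large index and one point near \<open>z\<close> with a value close to
    \<open>V z\<close> suffice: the maximum of \<open>u \<beta> - Q\<close> over the ball then
    avoids the annulus.\<close>
  have "\<exists>\<beta>\<ge>max (B0 + 1) (max B1 B2). \<exists>y\<in>D. dist y z < min \<rho> d3 \<and> V z - \<kappa> / 4 < u \<beta> y"
  proof (rule relaxed_limsup_greaterD[where ?B0.0 = B0 and M = M])
    show "V z - \<kappa> / 4 < relaxed_limsup D u z" using \<kappa> by (simp add: V_def)
  qed (use bd zD \<rho>(1) d3(1) in auto)
  then obtain \<beta> y where \<beta>: "\<beta> \<ge> max (B0 + 1) (max B1 B2)" and y: "y \<in> D" "dist y z < min \<rho> d3" "V z - \<kappa> / 4 < u \<beta> y"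
    by blast
  have uy: "u \<beta> y - Q y > - \<kappa> / 2"   proof -
    have "dist (Q y) (Q z) < \<kappa> / 4" using y(2) by (intro d3(2)) auto
    then show ?thesis using y(3) Qz unfolding dist_real_def by linarith
  qed
  have \<beta>0: "\<beta> > B0" using \<beta> by simp
  have "continuous_on (cball z \<rho>) (\<lambda>y. u \<beta> y - Q y)"
    by (intro continuous_on_diff Qc continuous_on_subset[OF cont[OF \<beta>0] \<rho>(3)])
  moreover have "cball z \<rho> \<noteq> {}" using \<rho> by auto
  ultimately obtain w where w: "w \<in> cball z \<rho>" "\<And>y. y \<in> cball z \<rho> \<Longrightarrow> u \<beta> y - Q y \<le> u \<beta> w - Q w"
    using continuous_attains_sup[OF compact_cball] by blast
  have "u \<beta> w - Q w > - \<kappa> / 2" using w(2)[of y] y(2) uy by (simp add: dist_commute)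
  then have "w \<notin> R" using B2[of \<beta> w] \<beta> by auto
  then have wz: "dist z w < \<delta>" using w(1) by (auto simp: R_def)
  have "\<forall>\<^sub>F y in nhds w. u \<beta> y - Q y \<le> u \<beta> w - Q w"
    using eventually_nhds_in_open[of "ball z \<rho>" w] wz \<delta>(2) by (auto elim!: eventually_mono intro!: w(2))
  then have "superjet (u \<beta>) w (a + L (w - z)) L"
    using eventually_nhds_shift[of "\<lambda>y. u \<beta> y - Q y \<le> u \<beta> w - Q w" w]
    by (intro superjet_touch[OF jet2_superjet[OF jQ]]) simp
  moreover have "w \<in> U" using w(1) \<rho>(3) by blast
  ultimately have "F \<beta> (snd (a + L (w - z))) (space_trace L) \<le> 0"
    using sub[OF \<beta>0] unfolding subsol_def by blast
  moreover have "F \<beta> (snd (a + L (w - z))) (space_trace L) > 0"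
  proof (rule e(2))
    have "\<bar>snd (L (w - z))\<bar> \<le> norm (L (w - z))" by (metis norm_snd_le prod.collapse real_norm_def)
    also have "\<dots> \<le> norm (w - z) * K" by (rule K)
    also have "\<dots> < \<delta> * K" using wz K by (intro mult_strict_right_mono) (auto simp: dist_norm norm_minus_commute)
    finally show "\<bar>snd (a + L (w - z)) - snd a\<bar> < e" using \<delta>(3) by simp
    show "\<bar>space_trace L - space_trace A\<bar> < e" using trL \<eta>(2) e(1) by simp
  qed (use \<beta> in auto)
  ultimately show False by simp
qed

section \<open>Solutions of the limit problem\<close>

lemma subsol_translate:
  assumes "subsol F U v" "\<And>z. z \<in> W \<Longrightarrow> z + k \<in> U"
  shows "subsol F W (\<lambda>y. v (y + k))"
proof -
  have "superjet (\<lambda>y. v (y + k)) z a A \<longleftrightarrow> superjet v (z + k) a A" for z a A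
    by (simp add: superjet_def add.assoc add.commute[of _ k])
  then show ?thesis using assms unfolding subsol_def by blast
qed

section \<open>Convergence of the operators\<close>

lemma continuous_F_two_speed: "continuous_on UNIV (F_two_speed bm bp p)"
  unfolding F_two_speed_def by (intro continuous_intros)

lemma continuous_F_limit: "continuous_on UNIV (F_limit b p)"
  unfolding F_limit_def by (intro continuous_intros)

text \<open>Two mechanisms are at work. For \<open>p0 \<le> 0\<close> positivity of the limit
  operator means \<open>l0 < b * p0\<close>, an open condition; for \<open>p0 > 0\<close> it may be
  due to the time slope alone, and there \<open>\<beta> * p\<close> outgrows any bounded
  \<open>l\<close>.\<close>

lemma two_speed_limit_positive:
  assumes b: "b > 0" and pos: "F_limit b p0 l0 > 0"
  shows "\<exists>e>0. \<exists>B. \<forall>\<beta>\<ge>B. \<forall>p l. \<bar>p - p0\<bar> < e \<longrightarrow> \<bar>l - l0\<bar> < e \<longrightarrow> F_two_speed b \<beta> p l > 0"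
proof (cases "p0 \<le> 0")
  case True
  then have "b * p0 \<le> 0" using b by (simp add: mult_le_0_iff)
  then have l0: "l0 < b * p0" using pos by (auto simp: F_limit_def min_def split: if_splits)
  define e where "e = (b * p0 - l0) / (b + 1)"
  have "e * (b + 1) = b * p0 - l0" using b by (simp add: e_def)
  then have e: "b * e + e = b * p0 - l0" "e > 0" using l0 b by (simp add: algebra_simps) (unfold e_def, intro divide_pos_pos, insert l0 b, linarith+)
  have "F_two_speed b \<beta> p l > 0" if "\<beta> \<ge> b + 1" "\<bar>p - p0\<bar> < e" "\<bar>l - l0\<bar> < e" for \<beta> p l
  proof -
    have "b * (p0 - e) < b * p" using that b by (intro mult_strict_left_mono) auto
    then have "b * p - l > 0" using that(3) e(1) by (simp add: right_diff_distrib)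
    then show ?thesis using F_two_speed_max[of b \<beta> p l] that(1) b by simp
  qed
  then show ?thesis using e(2) by blast
next
  case False
  define e where "e = min (p0 / 2) 1"
  \<comment> \<open>With \<open>p \<ge> p0 / 2\<close> this gives
    \<open>\<beta> * p \<ge> \<bar>l0\<bar> + 2\<close>, while
    \<open>l < \<bar>l0\<bar> + 1\<close>.\<close>
  define B where "B = max (b + 1) (2 * (\<bar>l0\<bar> + 2) / p0)"
  have e: "e > 0" "e \<le> p0 / 2" "e \<le> 1" using False by (auto simp: e_def)
  have "F_two_speed b \<beta> p l > 0" if "\<beta> \<ge> B" "\<bar>p - p0\<bar> < e" "\<bar>l - l0\<bar> < e" for \<beta> p l
  proof -
    have "\<bar>l0\<bar> + 2 = (2 * (\<bar>l0\<bar> + 2) / p0) * (p0 / 2)" using False by simp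
    also have "\<dots> \<le> \<beta> * p"
      using that e False b by (intro mult_mono) (auto simp: B_def)
    finally have "\<beta> * p - l > 0" using that(3) e(3) by linarith
    then show ?thesis using F_two_speed_max[of b \<beta> p l] that(1) b by (simp add: B_def)
  qed
  then show ?thesis using e(1) by blast
qed

text \<open>Positivity forces \<open>p0 > 0\<close>, and near such a slope the reflected operator is
  \<open>b * p - l\<close>, whatever \<beta> is.\<close>

lemma two_speed_limit_negative:
  assumes b: "b > 0" and pos: "negF (F_limit b) p0 l0 > 0"
  shows "\<exists>e>0. \<exists>B. \<forall>\<beta>\<ge>B. \<forall>p l. \<bar>p - p0\<bar> < e \<longrightarrow> \<bar>l - l0\<bar> < e \<longrightarrow> negF (F_two_speed b \<beta>) p l > 0"
proof -
  have "b * p0 > max l0 0" using pos by (auto simp: negF_def F_limit_def min_def max_def split: if_splits)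
  then have p0: "p0 > 0" "l0 < b * p0" using b by (auto simp: zero_less_mult_iff)
  define e where "e = min p0 ((b * p0 - l0) / (b + 1))"
  have e: "e > 0" "e \<le> p0" using p0 b by (auto simp: e_def)
  have "e * (b + 1) \<le> (b * p0 - l0) / (b + 1) * (b + 1)" using b by (intro mult_right_mono) (auto simp: e_def)
  also have "\<dots> = b * p0 - l0" using b by simp
  finally have e2: "b * e + e \<le> b * p0 - l0" by (simp add: algebra_simps)
  have "negF (F_two_speed b \<beta>) p l > 0" if "\<beta> \<ge> b + 1" "\<bar>p - p0\<bar> < e" "\<bar>l - l0\<bar> < e" for \<beta> p l
  proof -
    have p: "p > 0" using that(2) e(2) by linarith
    have "b * (p0 - e) < b * p" using that b by (intro mult_strict_left_mono) auto
    then have "b * p - l > 0" using that(3) e2 by (simp add: right_diff_distrib)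
    then show ?thesis using p by (simp add: negF_def F_two_speed_def b_coeff_def)
  qed
  then show ?thesis using e(1) by blast
qed

lemma F_limit_positive_open:
  assumes b: "b > 0" and pos: "F_limit b p0 l0 > 0"
  shows "\<exists>e>0. \<forall>p l. \<bar>p - p0\<bar> < e \<longrightarrow> \<bar>l - l0\<bar> < e \<longrightarrow> F_limit b p l > 0"
proof -
  define e where "e = F_limit b p0 l0 / (b + 1)"
  have "e * (b + 1) = F_limit b p0 l0" using b by (simp add: e_def)
  then have e: "b * e + e = F_limit b p0 l0" "e > 0" using pos b by (simp add: algebra_simps) (unfold e_def, intro divide_pos_pos, insert pos b, linarith+)
  have "F_limit b p l > 0" if "\<bar>p - p0\<bar> < e" "\<bar>l - l0\<bar> < e" for p l
  proof -
    have "b * (p0 - e) < b * p" using that b by (intro mult_strict_left_mono) auto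
    moreover have "min l 0 \<le> min l0 0 + e" using that(2) by (auto simp: min_def)
    ultimately show ?thesis using e(1) by (simp add: F_limit_def right_diff_distrib)
  qed
  then show ?thesis using e(2) by blast
qed

text \<open>Working form of a Dirichlet solution: superjets on both sides, and the data recorded on
  the whole parabolic boundary including its corner.\<close>

definition sub_super ::
    "(real \<Rightarrow> real \<Rightarrow> real) \<Rightarrow> 'a::euclidean_space set \<Rightarrow> ('a \<Rightarrow> real) \<Rightarrow> ('a \<times> real \<Rightarrow> real) \<Rightarrow> bool" where
  "sub_super F \<Omega> u0 w \<longleftrightarrow> continuous_on (closure \<Omega> \<times> {0..}) w \<and>
     subsol F (\<Omega> \<times> {0<..}) w \<and> subsol (negF F) (\<Omega> \<times> {0<..}) (\<lambda>z. - w z) \<and>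
     (\<forall>x\<in>frontier \<Omega>. \<forall>t\<ge>0. w (x, t) = 0) \<and> (\<forall>x\<in>closure \<Omega>. w (x, 0) = u0 x)"

text \<open>The definition prescribes boundary values for \<open>t > 0\<close> and initial values
  inside \<Omega>; continuity carries the zero boundary value down to \<open>t = 0\<close>, where it
  agrees with \<open>u0\<close>.\<close>

lemma dirichlet_sub_super:
  assumes \<Omega>: "open \<Omega>" and u0: "\<forall>x\<in>frontier \<Omega>. u0 x = 0" and F: "\<And>p. continuous_on UNIV (F p)"
    and w: "dirichlet_viscosity_solution F \<Omega> u0 w"
  shows "sub_super F \<Omega> u0 w"
proof -
  have c: "continuous_on (closure \<Omega> \<times> {0..}) w" and pv: "parabolic_viscosity F \<Omega> w"
    and bd: "\<And>x t. x \<in> frontier \<Omega> \<Longrightarrow> t > 0 \<Longrightarrow> w (x, t) = 0" and i: "\<And>x. x \<in> \<Omega> \<Longrightarrow> w (x, 0) = u0 x"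
    using w by (auto simp: dirichlet_viscosity_solution_def)
  have bd0: "w (x, t) = 0" if x: "x \<in> frontier \<Omega>" and t: "t \<ge> 0" for x t
  proof (rule continuous_constant_on_closure[of "{0<..}" "\<lambda>t. w (x, t)"])
    have "x \<in> closure \<Omega>" using x by (simp add: frontier_def)
    then show "continuous_on (closure {0<..}) (\<lambda>t. w (x, t))"
      by (intro continuous_on_compose2[OF c]) (auto intro!: continuous_intros)
    show "t \<in> closure {0<..}" using t by simp
  qed (use bd x in auto)
  have "w (x, 0) = u0 x" if "x \<in> closure \<Omega>" for x
    using that i bd0 u0 \<Omega> by (cases "x \<in> \<Omega>") (auto simp: frontier_def interior_open)
  then show ?thesis
    unfolding sub_super_def
    using c bd0 parabolic_viscosity_subsol[OF \<Omega> pv F] parabolic_viscosity_supersol[OF \<Omega> pv F] by blast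
qed

lemma sub_super_uminus:
  "sub_super F \<Omega> u0 w \<Longrightarrow> sub_super (negF F) \<Omega> (\<lambda>x. - u0 x) (\<lambda>z. - w z)"
  by (auto simp: sub_super_def intro!: continuous_intros)

lemma sub_super_comparison:
  assumes \<Omega>: "open \<Omega>" "bounded \<Omega>" and b: "b > 0"
    and v: "sub_super (F_limit b) \<Omega> u0 v" and w: "sub_super (F_limit b) \<Omega> u0 w" and z: "z \<in> closure \<Omega> \<times> {0..}"
  shows "v z \<le> w z"
proof -
  obtain x t where xt: "z = (x, t)" by (cases z)
  have K: "closure \<Omega> \<times> {0..t + 1} \<subseteq> closure \<Omega> \<times> {0..}" by auto
  have vc: "continuous_on (closure \<Omega> \<times> {0..t + 1}) v" and wc: "continuous_on (closure \<Omega> \<times> {0..t + 1}) w"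
    using v w K by (auto simp: sub_super_def intro: continuous_on_subset)
  have "compact (closure \<Omega> \<times> {0..t + 1})" using \<Omega> by (intro compact_Times) (auto simp: compact_closure)
  then have "bounded (v ` (closure \<Omega> \<times> {0..t + 1}))" by (intro compact_imp_bounded compact_continuous_image vc)
  then obtain M where M: "\<And>z. z \<in> closure \<Omega> \<times> {0..t + 1} \<Longrightarrow> \<bar>v z\<bar> \<le> M" unfolding bounded_iff by auto
  have "v (x, t) \<le> w (x, t)"
  proof (rule comparison[OF \<Omega> b, where T = "t + 1"])
    show "upper_semicontinuous_on (closure \<Omega> \<times> {0..t + 1}) v" by (rule continuous_imp_usc[OF vc])
    show "upper_semicontinuous_on (closure \<Omega> \<times> {0..t + 1}) (\<lambda>z. - w z)"
      by (intro continuous_imp_usc continuous_intros wc)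
    show "subsol (F_limit b) (\<Omega> \<times> {0<..<t + 1}) v"
      using v by (auto simp: sub_super_def intro: subsol_subset)
    show "subsol (negF (F_limit b)) (\<Omega> \<times> {0<..<t + 1}) (\<lambda>z. - w z)"
      using w by (auto simp: sub_super_def intro: subsol_subset)
  qed (use M v w z xt in \<open>auto simp: sub_super_def\<close>)
  then show ?thesis by (simp add: xt)
qed

lemma sub_super_le_barrier:
  assumes \<Omega>: "open \<Omega>" "bounded \<Omega>" and F: "growth b F" and w: "sub_super F \<Omega> u0 w"
    and S: "classical_super b \<Omega> S" "\<forall>x\<in>closure \<Omega>. u0 x \<le> S (x, 0)" "\<forall>x\<in>frontier \<Omega>. \<forall>t\<ge>0. 0 \<le> S (x, t)"
    and z: "z \<in> closure \<Omega> \<times> {0..}"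
  shows "w z \<le> S z"
  using w S by (intro subsol_le_barrier[OF \<Omega> F _ _ S(1) _ _ z]) (auto simp: sub_super_def)

lemma sub_super_le_const:
  fixes \<Omega> :: "'a::euclidean_space set"
  assumes \<Omega>: "open \<Omega>" "bounded \<Omega>" and F: "growth b F" and w: "sub_super F \<Omega> u0 w"
    and M: "M \<ge> 0" "\<And>x. x \<in> closure \<Omega> \<Longrightarrow> u0 x \<le> M" and z: "z \<in> closure \<Omega> \<times> {0..}"
  shows "w z \<le> M"
proof (rule sub_super_le_barrier[OF \<Omega> F w _ _ _ z, of "\<lambda>_. M"])
  have "\<exists>a A. jet2 (\<lambda>_. M) z a A \<and> 0 \<le> snd a \<and> space_trace A \<le> b * snd a" for z :: "'a \<times> real"
    by (rule exI[of _ 0], rule exI[of _ "\<lambda>_. 0"]) (simp add: jet2_const space_trace_def)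
  then show "classical_super b \<Omega> (\<lambda>_. M)"
    unfolding classical_super_def by auto
qed (use M in auto)

lemma sub_super_nonincreasing:
  fixes w :: "'a::euclidean_space \<times> real \<Rightarrow> real"
  assumes \<Omega>: "open \<Omega>" "bounded \<Omega>" and b: "b > 0" and w: "sub_super (F_limit b) \<Omega> u0 w"
    and bd: "\<And>z. z \<in> closure \<Omega> \<times> {0..} \<Longrightarrow> \<bar>w z\<bar> \<le> M"
    and x: "x \<in> closure \<Omega>" and st: "0 \<le> s" "s \<le> t"
  shows "w (x, t) \<le> w (x, s)"
proof (cases "x \<in> \<Omega>")
  case False
  then have "x \<in> frontier \<Omega>" using x \<Omega> by (simp add: frontier_def interior_open)
  then show ?thesis using w st by (simp add: sub_super_def)
next
  case True
  have wc: "continuous_on (closure \<Omega> \<times> {0..}) w" using w by (simp add: sub_super_def)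
  have dec: "w (x, t) \<le> w (x, s)" if "0 < s" "s \<le> t" for s
  proof (rule subsol_nonincreasing[OF \<Omega>(1), of 0 "t + 1"])
    show "continuous_on (\<Omega> \<times> {0<..<t + 1}) w"
      by (rule continuous_on_subset[OF wc]) (use closure_subset[of \<Omega>] in auto)
    show "subsol (\<lambda>p l. p) (\<Omega> \<times> {0<..<t + 1}) w"
      using w F_limit_le_iff[OF b] by (auto simp: sub_super_def subsol_def)
    show "\<bar>w z\<bar> \<le> M" if "z \<in> \<Omega> \<times> {0<..<t + 1}" for z
      using that closure_subset[of \<Omega>] by (intro bd) auto
  qed (use that True in auto)
  show ?thesis
  proof (cases "s = 0 \<and> t > 0")
    case False
    then show ?thesis using dec st by (cases "s = 0") auto
  next
    case st0: True
    \<comment> \<open>The initial time is not an interior one and is reached by continuity.\<close>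
    have "continuous_on {0..} (\<lambda>s. w (x, s))"
      using x by (intro continuous_on_compose2[OF wc]) (auto intro!: continuous_intros)
    then have "((\<lambda>s. w (x, s)) \<longlongrightarrow> w (x, 0)) (at 0 within {0..})" unfolding continuous_on_def by simp
    then have lim: "((\<lambda>s. w (x, s)) \<longlongrightarrow> w (x, 0)) (at_right 0)" by (rule tendsto_within_subset) auto
    have "w (x, t) \<le> w (x, 0)"
    proof (rule tendsto_lowerbound[OF lim])
      show "\<forall>\<^sub>F s in at_right 0. w (x, t) \<le> w (x, s)"
        unfolding eventually_at_right_field using st0 dec by (intro exI[of _ t]) auto
    qed simp
    then show ?thesis using st0 by simp
  qed
qed

section \<open>Long-time behaviour\<close>

text \<open>Restricted to the time axis, the superjet belongs to a constant, so its time slope is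
  zero; restricted to space, it is a superjet of \<open>v\<close>.\<close>

lemma superjet_stationary:
  fixes v :: "'a::euclidean_space \<Rightarrow> real"
  assumes "superjet (\<lambda>z. v (fst z)) (z :: 'a \<times> real) a A"
  shows "snd a = 0" "superjet v (fst z) (fst a) (\<lambda>\<xi>. fst (A (\<xi>, 0)))"
proof -
  have lin: "linear A" using assms by (rule superjet_linear)
  have "superjet (\<lambda>s :: real. v (fst z)) (snd z) (snd a) (\<lambda>s. snd (A (0, s)))"
    unfolding superjet_def
  proof (intro conjI allI impI)
    show "linear (\<lambda>s. snd (A (0, s)))"
    proof (rule linearI)
      fix x y c :: real
      show "snd (A (0, x + y)) = snd (A (0, x)) + snd (A (0, y))"
        using linear_add[OF lin, of "(0, x)" "(0, y)"] by simp
      show "snd (A (0, c *\<^sub>R x)) = c *\<^sub>R snd (A (0, x))"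
        using linear_cmul[OF lin, of c "(0, x)"] by simp
    qed
    fix \<eta> :: real assume "\<eta> > 0"
    have "filterlim (\<lambda>s. (0 :: 'a, s :: real)) (nhds 0) (nhds 0)"
      by (rule tendsto_eq_intros filterlim_ident refl | simp add: zero_prod_def)+
    from eventually_compose_filterlim[OF superjetD[OF assms \<open>\<eta> > 0\<close>] this]
    show "\<forall>\<^sub>F h in nhds 0. v (fst z) \<le> v (fst z) + snd a \<bullet> h + snd (A (0, h)) \<bullet> h / 2 + \<eta> * (h \<bullet> h)"
      by eventually_elim (simp add: inner_prod_def)
  qed
  from superjet_const_nonneg(1)[OF this] show "snd a = 0" .
  show "superjet v (fst z) (fst a) (\<lambda>\<xi>. fst (A (\<xi>, 0)))"
    unfolding superjet_def
  proof (intro conjI allI impI)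
    show "linear (\<lambda>\<xi>. fst (A (\<xi>, 0)))"
    proof (rule linearI)
      fix x y :: 'a and c :: real
      show "fst (A (x + y, 0)) = fst (A (x, 0)) + fst (A (y, 0))"
        using linear_add[OF lin, of "(x, 0)" "(y, 0)"] by simp
      show "fst (A (c *\<^sub>R x, 0)) = c *\<^sub>R fst (A (x, 0))"
        using linear_cmul[OF lin, of c "(x, 0)"] by simp
    qed
    fix \<eta> :: real assume "\<eta> > 0"
    have "filterlim (\<lambda>s :: 'a. (s, 0 :: real)) (nhds 0) (nhds 0)"
      by (rule tendsto_eq_intros filterlim_ident refl | simp add: zero_prod_def)+
    from eventually_compose_filterlim[OF superjetD[OF assms \<open>\<eta> > 0\<close>] this]
    show "\<forall>\<^sub>F h in nhds 0. v (fst z + h) \<le> v (fst z) + fst a \<bullet> h + fst (A (h, 0)) \<bullet> h / 2 + \<eta> * (h \<bullet> h)"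
      by eventually_elim (simp add: inner_prod_def)
  qed
qed

lemma superjet_lift:
  fixes v :: "'a::euclidean_space \<Rightarrow> real"
  assumes "superjet v x a A"
  shows "superjet (\<lambda>z. v (fst z)) (x, t :: real) (a, 0) (\<lambda>h. (A (fst h), 0))"
  unfolding superjet_def
proof (intro conjI allI impI)
  have lin: "linear A" using assms by (rule superjet_linear)
  show "linear (\<lambda>h :: 'a \<times> real. (A (fst h), 0 :: real))"
    by (rule linearI) (simp_all add: linear_add[OF lin] linear_cmul[OF lin])
  fix \<eta> :: real assume "\<eta> > 0"
  have "filterlim fst (nhds 0) (nhds (0 :: 'a \<times> real))"
    by (rule tendsto_eq_intros filterlim_ident refl | simp)+
  from eventually_compose_filterlim[OF superjetD[OF assms \<open>\<eta> > 0\<close>] this]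
  show "\<forall>\<^sub>F h in nhds 0. v (fst ((x, t) + h)) \<le> v (fst (x, t)) + (a, 0) \<bullet> h + (A (fst h), 0) \<bullet> h / 2 + \<eta> * (h \<bullet> h)"
  proof eventually_elim
    case (elim h)
    have "\<eta> * (fst h \<bullet> fst h) \<le> \<eta> * (h \<bullet> h)" using \<open>\<eta> > 0\<close> by (simp add: inner_prod_def)
    with elim show ?case by (simp add: inner_prod_def)
  qed
qed

lemma quadratic_laplacian:
  fixes A :: "'a::euclidean_space \<Rightarrow> 'a" and c :: real and a x :: 'a
  assumes "linear A"
  shows "laplacian (\<lambda>y. c + a \<bullet> (y - x) + (A (y - x) \<bullet> (y - x)) / 2) x = (\<Sum>i\<in>Basis. A i \<bullet> i)"
proof -
  let ?F = "\<lambda>y. a + (1/2) *\<^sub>R (A (y - x) + adjoint A (y - x))"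
  have bl: "bounded_linear A" "bounded_linear (adjoint A)"
    using assms adjoint_linear[OF assms] by (simp_all add: linear_conv_bounded_linear)
  have id: "((\<lambda>y. y - x) has_derivative (\<lambda>h. h)) (at x)"
    by (auto intro!: derivative_eq_intros)
  have F: "(?F has_derivative (\<lambda>h. 0 + (1 / 2) *\<^sub>R (A h + adjoint A h))) (at x)"
    by (intro has_derivative_add has_derivative_const has_derivative_scaleR_right
        bounded_linear.has_derivative[OF bl(1) id] bounded_linear.has_derivative[OF bl(2) id])
  have "adjoint A i \<bullet> i = A i \<bullet> i" for i
    using adjoint_works[OF assms, of i i] by (simp add: inner_commute)
  then show ?thesis
    using line_derivs(2)[OF open_UNIV UNIV_I quadratic_has_derivative[OF assms] F, of c]
    by (simp add: laplacian_def inner_add_left)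
qed

text \<open>The time slope of a stationary function is 0, so the limit inequality amounts to a
  nonnegative trace. This lets the competitors for the projected datum be compared with the
  evolution.\<close>

lemma viscosity_subharmonic_subsol:
  fixes v :: "'a::euclidean_space \<Rightarrow> real"
  assumes \<Omega>: "open \<Omega>" and b: "b > 0" and v: "viscosity_subharmonic \<Omega> v"
  shows "subsol (F_limit b) (\<Omega> \<times> UNIV) (\<lambda>z. v (fst z))"
  unfolding subsol_def
proof (intro ballI allI impI)
  fix z :: "'a \<times> real" and a A assume z: "z \<in> \<Omega> \<times> UNIV" and sj: "superjet (\<lambda>z. v (fst z)) z a A"
  define x where "x = fst z"
  have x: "x \<in> \<Omega>" using z by (auto simp: x_def)
  define A1 where "A1 \<xi> = fst (A (\<xi>, 0))" for \<xi>
  have s: "snd a = 0" "superjet v x (fst a) A1"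
    using superjet_stationary[OF sj] by (simp_all add: x_def A1_def[abs_def])
  have linA: "linear A1" using s(2) by (rule superjet_linear)
  have tr: "space_trace A = (\<Sum>i\<in>Basis. A1 i \<bullet> i)" by (simp add: space_trace_def A1_def inner_prod_def)
  have "0 \<le> space_trace A"
  proof (rule field_le_epsilon)
    fix e :: real assume e: "e > 0"
    define \<eta> where "\<eta> = e / (2 * real DIM('a))"
    have \<eta>: "\<eta> > 0" "2 * \<eta> * DIM('a) = e" using e by (auto simp: \<eta>_def)
    define B where "B h = A1 h + (2 * \<eta>) *\<^sub>R h" for h
    have linB: "linear B" unfolding B_def[abs_def] by (rule linear_perturb[OF linA])
    define q where "q y = v x + fst a \<bullet> (y - x) + (B (y - x) \<bullet> (y - x)) / 2" for y
    have "local_max_on \<Omega> (\<lambda>y. v y - q y) x"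
      unfolding local_max_on_open[OF \<Omega> x]
      using superjet_quadratic_above[OF s(2) \<eta>(1)]
      by eventually_elim (simp add: q_def linear_0[OF linB] B_def)
    moreover have "smooth_on \<Omega> q" unfolding q_def by (rule smooth_on_quadratic[OF linB])
    ultimately have "0 \<le> laplacian q x" using v unfolding viscosity_subharmonic_def by fastforce
    also have "laplacian q x = (\<Sum>i\<in>Basis. B i \<bullet> i)" unfolding q_def by (rule quadratic_laplacian[OF linB])
    also have "\<dots> = space_trace A + e"
      using \<eta>(2) by (simp add: B_def inner_add_left sum.distrib tr mult.commute)
    finally show "0 \<le> space_trace A + e" .
  qed
  then show "F_limit b (snd a) (space_trace A) \<le> 0" using s(1) F_limit_le_iff[OF b, of 0 "space_trace A"] by simp
qed

text \<open>A Lebesgue number argument.\<close>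

lemma uniform_small:
  fixes \<Omega> :: "'a::euclidean_space set"
  assumes C: "compact C" and P: "\<And>p. p \<in> C \<Longrightarrow> \<exists>d>0. \<forall>x. dist x p < d \<longrightarrow> P x"
  shows "\<exists>d>0. \<forall>p\<in>C. \<forall>x. dist x p < d \<longrightarrow> P x"
proof -
  obtain d where d: "\<And>p. p \<in> C \<Longrightarrow> d p > 0" "\<And>p x. p \<in> C \<Longrightarrow> dist x p < d p \<Longrightarrow> P x"
    using P by metis
  have "C \<subseteq> \<Union> ((\<lambda>p. ball p (d p)) ` C)" using d(1) by force
  from Heine_Borel_lemma[OF C this] obtain e where e: "e > 0" "\<And>p. p \<in> C \<Longrightarrow> \<exists>G\<in>(\<lambda>p. ball p (d p)) ` C. ball p e \<subseteq> G"
    by (metis (no_types, lifting) imageE open_ball)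
  have "P x" if p: "p \<in> C" and x: "dist x p < e" for p x
  proof -
    obtain q where q: "q \<in> C" "ball p e \<subseteq> ball q (d q)" using e(2)[OF p] by blast
    have "x \<in> ball p e" using x by (simp add: dist_commute)
    then show ?thesis using q d(2)[of q x] by (auto simp: dist_commute)
  qed
  then show ?thesis using e(1) by blast
qed

text \<open>Monotonicity in time gives a pointwise limit. Equicontinuity in space makes it
  continuous and the convergence uniform, as in Dini's theorem; stability applied to time shifts
  makes it subharmonic, hence a competitor, and comparison makes it the largest one.\<close>

theorem long_time:
  fixes \<Omega> :: "'a::euclidean_space set"
  assumes \<Omega>: "smooth_bounded_domain \<Omega>" and u0: "continuous_on (closure \<Omega>) u0" "\<forall>x\<in>frontier \<Omega>. u0 x = 0"
    and b: "b > 0" and w: "sub_super (F_limit b) \<Omega> u0 w"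
  shows "uniform_limit (closure \<Omega>) (\<lambda>t x. w (x, t)) (projected_datum \<Omega> u0) at_top"
proof -
  have op: "open \<Omega>" and bdd: "bounded \<Omega>" and ne: "\<Omega> \<noteq> {}" using \<Omega> by (auto simp: smooth_bounded_domain_def)
  let ?C = "closure \<Omega>"
  have cpt: "compact ?C" using bdd by (simp add: compact_closure)
  have fr: "frontier \<Omega> \<subseteq> ?C" by (auto simp: frontier_def)
  have wc: "continuous_on (?C \<times> {0..}) w" and wsub: "subsol (F_limit b) (\<Omega> \<times> {0<..}) w"
    and wsup: "subsol (negF (F_limit b)) (\<Omega> \<times> {0<..}) (\<lambda>z. - w z)"
    and w0: "\<And>x t. x \<in> frontier \<Omega> \<Longrightarrow> t \<ge> 0 \<Longrightarrow> w (x, t) = 0" and wi: "\<And>x. x \<in> ?C \<Longrightarrow> w (x, 0) = u0 x"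
    using w by (auto simp: sub_super_def)
  have w': "sub_super (negF (F_limit b)) \<Omega> (\<lambda>x. - u0 x) (\<lambda>z. - w z)" by (rule sub_super_uminus[OF w])
  have "bounded (u0 ` ?C)" by (intro compact_imp_bounded compact_continuous_image u0 cpt)
  then obtain M where M: "M > 0" "\<And>x. x \<in> ?C \<Longrightarrow> \<bar>u0 x\<bar> \<le> M" unfolding bounded_pos by auto
  have bd: "\<bar>w z\<bar> \<le> M" if z: "z \<in> ?C \<times> {0..}" for z
  proof -
    have "w z \<le> M" using M by (intro sub_super_le_const[OF op bdd growth_limit(1)[OF b] w _ _ z]) (auto simp: abs_le_iff)
    moreover have "- w z \<le> M"
      using M by (intro sub_super_le_const[OF op bdd growth_limit(2)[OF b] w' _ _ z]) (auto simp: abs_le_iff)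
    ultimately show ?thesis by simp
  qed
  have dec: "w (x, t) \<le> w (x, s)" if "x \<in> ?C" "0 \<le> s" "s \<le> t" for x s t
    by (rule sub_super_nonincreasing[OF op bdd b w bd that])
  \<comment> \<open>Time-independent barriers for \<open>w\<close> and for \<open>- w\<close> make
    \<open>w\<close> small near the boundary, uniformly in time.\<close>
  have near_frontier: "\<exists>d>0. \<forall>p\<in>frontier \<Omega>. \<forall>x. dist x p < d \<longrightarrow> x \<in> ?C \<longrightarrow> (\<forall>t\<ge>0. \<bar>w (x, t)\<bar> \<le> \<epsilon>)" if \<epsilon>: "\<epsilon> > 0" for \<epsilon>
  proof (rule uniform_small)
    show "compact (frontier \<Omega>)" by (rule compact_frontier_bounded[OF bdd])
    fix p assume p: "p \<in> frontier \<Omega>"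
    have e2: "\<epsilon> / 2 > 0" using \<epsilon> by simp
    have one: "\<exists>d>0. \<forall>x. dist x p < d \<longrightarrow> x \<in> ?C \<longrightarrow> (\<forall>t\<ge>0. y (x, t) \<le> \<epsilon>)"
      if F: "growth b F" and y: "sub_super F \<Omega> f0 y" and f0: "continuous_on ?C f0" "\<forall>x\<in>frontier \<Omega>. f0 x = 0" for F y f0
    proof -
      obtain \<psi> where \<psi>: "classical_super b \<Omega> (\<lambda>z. \<psi> (fst z))" "continuous_on UNIV \<psi>"
        "\<forall>x\<in>?C. f0 x \<le> \<psi> x \<and> 0 \<le> \<psi> x" "\<psi> p \<le> \<epsilon> / 2" using boundary_barrier[OF \<Omega> f0 b p e2] by blast
      obtain d where d: "d > 0" "\<And>x. dist x p < d \<Longrightarrow> dist (\<psi> x) (\<psi> p) < \<epsilon> / 2"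
        using \<psi>(2) e2 unfolding continuous_on_iff by blast
      have "y (x, t) \<le> \<epsilon>" if x: "dist x p < d" "x \<in> ?C" and t: "t \<ge> 0" for x t
      proof -
        have "y (x, t) \<le> \<psi> (fst (x, t))"
          by (rule sub_super_le_barrier[OF op bdd F y \<psi>(1)]) (use \<psi>(3) x t fr in auto)
        then show ?thesis using d(2)[OF x(1)] \<psi>(4) unfolding dist_real_def fst_conv by linarith
      qed
      then show ?thesis using d(1) by blast
    qed
    obtain d1 where d1: "d1 > 0" "\<forall>x. dist x p < d1 \<longrightarrow> x \<in> ?C \<longrightarrow> (\<forall>t\<ge>0. w (x, t) \<le> \<epsilon>)"
      using one[OF growth_limit(1)[OF b] w u0] by blast
    have "continuous_on ?C (\<lambda>x. - u0 x)" "\<forall>x\<in>frontier \<Omega>. - u0 x = 0" using u0 by (auto intro!: continuous_intros)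
    from one[OF growth_limit(2)[OF b] w' this]
    obtain d2 where d2: "d2 > 0" "\<forall>x. dist x p < d2 \<longrightarrow> x \<in> ?C \<longrightarrow> (\<forall>t\<ge>0. - w (x, t) \<le> \<epsilon>)" by blast
    show "\<exists>d>0. \<forall>x. dist x p < d \<longrightarrow> x \<in> ?C \<longrightarrow> (\<forall>t\<ge>0. \<bar>w (x, t)\<bar> \<le> \<epsilon>)"
      using d1 d2 by (intro exI[of _ "min d1 d2"]) (auto simp: abs_le_iff)
  qed
  have equi: "\<exists>d>0. \<forall>x\<in>?C. \<forall>y\<in>?C. dist x y < d \<longrightarrow> (\<forall>t\<ge>0. w (y, t) \<le> w (x, t) + \<epsilon>)" if \<epsilon>: "\<epsilon> > 0" for \<epsilon>
  proof -
    obtain d1 where d1: "d1 > 0"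
      "\<And>p x t. p \<in> frontier \<Omega> \<Longrightarrow> dist x p < d1 \<Longrightarrow> x \<in> ?C \<Longrightarrow> t \<ge> 0 \<Longrightarrow> \<bar>w (x, t)\<bar> \<le> \<epsilon>"
      using near_frontier[OF \<epsilon>] by blast
    have "uniformly_continuous_on ?C u0" by (rule compact_uniformly_continuous[OF u0(1) cpt])
    then obtain d2 where d2: "d2 > 0" "\<And>x y. x \<in> ?C \<Longrightarrow> y \<in> ?C \<Longrightarrow> dist y x < d2 \<Longrightarrow> dist (u0 y) (u0 x) < \<epsilon>"
      using \<epsilon> unfolding uniformly_continuous_on_def by metis
    define d where "d = min d1 d2"
    have fcase: "w (y, t) \<le> w (x, t) + \<epsilon>"
      if "x \<in> ?C" "y \<in> ?C" "dist x y < d" "t \<ge> 0" "x \<in> frontier \<Omega> \<or> y \<in> frontier \<Omega>" for x y t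
      using that(5)
    proof
      assume "x \<in> frontier \<Omega>"
      then show ?thesis using d1(2)[of x y t] w0[of x t] that by (simp add: d_def dist_commute)
    next
      assume "y \<in> frontier \<Omega>"
      then show ?thesis using d1(2)[of y x t] w0[of y t] that by (simp add: d_def)
    qed
    have "w (y, t) \<le> w (x, t) + \<epsilon>" if x: "x \<in> ?C" and y: "y \<in> ?C" and xy: "dist x y < d" and t: "t \<ge> 0" for x y t
    proof (cases "x \<in> frontier \<Omega> \<or> y \<in> frontier \<Omega>")
      case True
      then show ?thesis using fcase that by blast
    next
      case False
      define k where "k = y - x"
      \<comment> \<open>The translate of \<open>w\<close> by \<open>k\<close> is compared with
        \<open>w\<close> where both are defined. At a frontier point of this set, \<open>x'\<close>
        or \<open>x' + k\<close> lies on the frontier of \<Omega>, where \<open>fcase\<close>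
        applies; at the initial time the modulus of continuity of \<open>u0\<close> does.\<close>
      define \<Omega>' where "\<Omega>' = \<Omega> \<inter> (\<lambda>x. x + k) -` \<Omega>"
      have op': "open \<Omega>'" unfolding \<Omega>'_def by (intro open_Int open_vimage op continuous_intros)
      have bdd': "bounded \<Omega>'" using bdd by (rule bounded_subset) (auto simp: \<Omega>'_def)
      have cl1: "closure \<Omega>' \<subseteq> ?C" by (rule closure_mono) (auto simp: \<Omega>'_def)
      have cl2: "x' + k \<in> ?C" if "x' \<in> closure \<Omega>'" for x'
      proof -
        have "closure \<Omega>' \<subseteq> (\<lambda>x. x + k) -` ?C"
          by (rule closure_minimal) (use closure_subset[of \<Omega>] in \<open>auto simp: \<Omega>'_def intro!: closed_vimage continuous_intros\<close>)
        then show ?thesis using that by auto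
      qed
      have dk: "dist x' (x' + k) < d" for x' using xy by (simp add: dist_norm k_def norm_minus_commute)
      have xin: "x \<in> \<Omega>'"
        using False x y op by (auto simp: \<Omega>'_def k_def frontier_def interior_open)
      have "w (x + k, t) \<le> w (x, t) + \<epsilon>"
      proof (rule comparison[OF op' bdd' b, where T = "t + 1" and V = "\<lambda>z. w (z + (k, 0))" and W = "\<lambda>z. w z + \<epsilon>", simplified])
        show "upper_semicontinuous_on (closure \<Omega>' \<times> {0..t + 1}) (\<lambda>z. w (z + (k, 0)))"
          by (intro continuous_imp_usc continuous_on_compose2[OF wc]) (use cl2 in \<open>auto intro!: continuous_intros\<close>)
        have "continuous_on (closure \<Omega>' \<times> {0..t + 1}) w"
          by (rule continuous_on_subset[OF wc]) (use cl1 in auto)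
        then show "upper_semicontinuous_on (closure \<Omega>' \<times> {0..t + 1}) (\<lambda>z. - w z - \<epsilon>)"
          by (intro continuous_imp_usc continuous_intros)
        show "subsol (F_limit b) (\<Omega>' \<times> {0<..<t + 1}) (\<lambda>z. w (z + (k, 0)))"
          by (rule subsol_translate[OF wsub]) (auto simp: \<Omega>'_def)
        have "subsol (negF (F_limit b)) (\<Omega>' \<times> {0<..<t + 1}) (\<lambda>z. - w z + - \<epsilon>)"
          unfolding subsol_shift_const by (rule subsol_subset[OF wsup]) (auto simp: \<Omega>'_def)
        then show "subsol (negF (F_limit b)) (\<Omega>' \<times> {0<..<t + 1}) (\<lambda>z. - w z - \<epsilon>)" by simp
        show "\<bar>w (z + (k, 0))\<bar> \<le> M" if "z \<in> closure \<Omega>' \<times> {0..t + 1}" for z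
          using that cl2 by (intro bd) auto
        show "w (x' + k, 0) \<le> w (x', 0) + \<epsilon>" if x': "x' \<in> closure \<Omega>'" for x'
        proof -
          have "x' \<in> ?C" "x' + k \<in> ?C" using cl1 cl2 x' by auto
          then show ?thesis using d2(2)[of x' "x' + k"] dk[of x'] wi by (simp add: d_def dist_commute dist_real_def)
        qed
        show "w (x' + k, s) \<le> w (x', s) + \<epsilon>" if x': "x' \<in> frontier \<Omega>'" and s: "0 \<le> s" for x' s
        proof -
          have c: "x' \<in> closure \<Omega>'" "x' \<notin> \<Omega>'" using x' op' by (auto simp: frontier_def interior_open)
          have "x' \<in> ?C" "x' + k \<in> ?C" using cl1 cl2 c by auto
          moreover have "x' \<in> frontier \<Omega> \<or> x' + k \<in> frontier \<Omega>"
            using calculation c(2) op by (auto simp: \<Omega>'_def frontier_def interior_open)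
          ultimately show ?thesis using fcase[of x' "x' + k" s] dk s by blast
        qed
        show "x \<in> closure \<Omega>'" using xin closure_subset by blast
      qed (use t in auto)
      then show ?thesis by (simp add: k_def)
    qed
    moreover have "d > 0" using d1 d2 by (simp add: d_def)
    ultimately show ?thesis by blast
  qed
  define ui where "ui x = (INF t\<in>{0..}. w (x, t))" for x
  have bb: "bdd_below ((\<lambda>t. w (x, t)) ` {0..})" if "x \<in> ?C" for x
  proof (rule bdd_belowI2[of _ "- M"])
    fix t :: real assume "t \<in> {0..}"
    then have "\<bar>w (x, t)\<bar> \<le> M" using that by (intro bd) auto
    then show "- M \<le> w (x, t)" by linarith
  qed
  have ui_le: "ui x \<le> w (x, t)" if "x \<in> ?C" "t \<ge> 0" for x t
    unfolding ui_def using that by (intro cINF_lower bb) auto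
  have ui_ge: "c \<le> ui x" if "\<And>t. t \<ge> 0 \<Longrightarrow> c \<le> w (x, t)" for c x
    unfolding ui_def using that by (intro cINF_greatest) auto
  have ui_ex: "\<exists>T\<ge>0. w (x, T) < ui x + e" if "e > 0" for x e
  proof (rule ccontr)
    assume "\<not> ?thesis"
    then have "ui x + e \<le> ui x" by (intro ui_ge) (auto simp: not_less)
    then show False using that by simp
  qed
  have ui_equi: "ui y \<le> ui x + \<epsilon>" if "\<forall>t\<ge>0. w (y, t) \<le> w (x, t) + \<epsilon>" "y \<in> ?C" for x y \<epsilon>
  proof -
    have "ui y - \<epsilon> \<le> ui x"
    proof (rule ui_ge)
      fix t :: real assume "t \<ge> 0"
      then show "ui y - \<epsilon> \<le> w (x, t)" using ui_le[OF that(2), of t] that(1) by (smt (verit))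
    qed
    then show ?thesis by simp
  qed
  \<comment> \<open>A finite net handles all points at once: equicontinuity passes to a net point
    \<open>y\<close>, and monotonicity takes over after the waiting time \<open>T y\<close>.\<close>
  have unif: "\<exists>T\<ge>0. \<forall>t\<ge>T. \<forall>x\<in>?C. w (x, t) < ui x + e" if e: "e > 0" for e
  proof -
    have e3: "e / 3 > 0" using e by simp
    obtain d where d: "d > 0" "\<And>x y t. x \<in> ?C \<Longrightarrow> y \<in> ?C \<Longrightarrow> dist x y < d \<Longrightarrow> t \<ge> 0 \<Longrightarrow> w (y, t) \<le> w (x, t) + e / 3"
      using equi[OF e3] by blast
    obtain T where T: "\<And>x. T x \<ge> 0" "\<And>x. w (x, T x) < ui x + e / 3" using ui_ex[OF e3] by metis
    have "?C \<subseteq> (\<Union>y\<in>?C. ball y d)" using d(1) by force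
    then obtain Y where Y: "Y \<subseteq> ?C" "finite Y" "?C \<subseteq> (\<Union>y\<in>Y. ball y d)"
      using compactE_image[OF cpt, of ?C "\<lambda>y. ball y d"] by auto
    define T0 where "T0 = Max (insert 0 (T ` Y))"
    have T0: "T0 \<ge> 0" "\<And>y. y \<in> Y \<Longrightarrow> T y \<le> T0" using Y(2) by (auto simp: T0_def)
    have "w (x, t) < ui x + e" if t: "t \<ge> T0" and x: "x \<in> ?C" for x t
    proof -
      obtain y where y: "y \<in> Y" "dist y x < d" using Y(3) x by auto
      have yC: "y \<in> ?C" using y Y by blast
      have "w (x, t) \<le> w (y, t) + e / 3" using y yC x t T0(1) by (intro d) auto
      also have "w (y, t) \<le> w (y, T y)" using yC T(1) T0(2)[OF y(1)] t by (intro dec) auto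
      also have "w (y, T y) < ui y + e / 3" by (rule T(2))
      also have "ui y \<le> ui x + e / 3"
        using d(2)[OF x yC] y(2) yC by (intro ui_equi) (auto simp: dist_commute)
      finally show ?thesis by simp
    qed
    then show ?thesis using T0(1) by blast
  qed
  have ui_cont: "continuous_on ?C ui"
    unfolding continuous_on_iff
  proof (intro ballI allI impI)
    fix x and e :: real assume x: "x \<in> ?C" and e: "e > 0"
    then have e2: "e / 2 > 0" by simp
    obtain d where d: "d > 0" "\<And>x y t. x \<in> ?C \<Longrightarrow> y \<in> ?C \<Longrightarrow> dist x y < d \<Longrightarrow> t \<ge> 0 \<Longrightarrow> w (y, t) \<le> w (x, t) + e / 2"
      using equi[OF e2] by blast
    show "\<exists>d>0. \<forall>x'\<in>?C. dist x' x < d \<longrightarrow> dist (ui x') (ui x) < e"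
    proof (intro exI[of _ d] conjI ballI impI d(1))
      fix x' assume x': "x' \<in> ?C" "dist x' x < d"
      have "ui x' \<le> ui x + e / 2" using d(2)[OF x x'(1)] x' by (intro ui_equi) (auto simp: dist_commute)
      moreover have "ui x \<le> ui x' + e / 2" using d(2)[OF x'(1) x] x' x by (intro ui_equi) auto
      ultimately show "dist (ui x') (ui x) < e" using e unfolding dist_real_def by linarith
    qed
  qed
  have ui_u0: "ui x \<le> u0 x" if "x \<in> ?C" for x using ui_le[OF that, of 0] wi[OF that] by simp
  have ui_fr: "ui x \<le> 0" if "x \<in> frontier \<Omega>" for x using ui_le[of x 0] w0[OF that, of 0] that fr by auto
  have ui_sub: "subsol (F_limit b) (\<Omega> \<times> {0<..}) (\<lambda>z. ui (fst z))"
  proof -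
    let ?D = "?C \<times> {0::real..}"
    \<comment> \<open>Time shifts of \<open>w\<close>, which are again subsolutions. The index runs
      over all reals, hence \<open>max n 0\<close>.\<close>
    define v where "v n z = w (z + (0, max n 0))" for n z
    have vbd: "\<bar>v n z\<bar> \<le> M" if "n > 0" "z \<in> ?D" for n z
      unfolding v_def using that by (intro bd) auto
    have hs: "subsol (F_limit b) (\<Omega> \<times> {0<..}) (relaxed_limsup ?D v)"
    proof (rule relaxed_limsup_subsol[where ?B0.0 = 0 and M = M and F = "\<lambda>_. F_limit b"])
      show "\<bar>v n z\<bar> \<le> M" if "n > 0" "z \<in> ?D" for n z by (rule vbd[OF that])
      show "open (\<Omega> \<times> {0::real<..})" using op by (intro open_Times) auto
      show "\<Omega> \<times> {0<..} \<subseteq> ?D" using closure_subset[of \<Omega>] by auto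
      show "continuous_on (\<Omega> \<times> {0<..}) (v n)" if "n > 0" for n
        unfolding v_def by (intro continuous_on_compose2[OF wc])
          (use closure_subset[of \<Omega>] in \<open>auto intro!: continuous_intros\<close>)
      show "subsol (F_limit b) (\<Omega> \<times> {0<..}) (v n)" if "n > 0" for n
        unfolding v_def by (rule subsol_translate[OF wsub]) (use that in auto)
      show "\<exists>e>0. \<exists>B. \<forall>\<beta>\<ge>B. \<forall>p l. \<bar>p - p0\<bar> < e \<longrightarrow> \<bar>l - l0\<bar> < e \<longrightarrow> 0 < F_limit b p l"
        if "0 < F_limit b p0 l0" for p0 l0 using F_limit_positive_open[OF b that] by blast
    qed
    \<comment> \<open>By \<open>unif\<close> and the continuity of \<open>ui\<close>, the relaxed
      limit of the time shifts is \<open>ui\<close> itself, so what stability says about the former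
      holds for the latter.\<close>
    have eq: "relaxed_limsup ?D v z = ui (fst z)" if z: "z \<in> ?D" for z
    proof (rule antisym)
      have xC: "fst z \<in> ?C" using z by auto
      show "relaxed_limsup ?D v z \<le> ui (fst z)"
      proof (rule field_le_epsilon)
        fix e :: real assume e: "e > 0"
        then have e2: "e / 2 > 0" by simp
        obtain T where T: "T \<ge> 0" "\<And>t x. t \<ge> T \<Longrightarrow> x \<in> ?C \<Longrightarrow> w (x, t) < ui x + e / 2" using unif[OF e2] by blast
        obtain d where d: "d > 0" "\<And>x. x \<in> ?C \<Longrightarrow> dist x (fst z) < d \<Longrightarrow> dist (ui x) (ui (fst z)) < e / 2"
          using ui_cont xC e2 unfolding continuous_on_iff by metis
        show "relaxed_limsup ?D v z \<le> ui (fst z) + e"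
        proof (rule relaxed_limsup_leI[where ?B0.0 = 0 and M = M and B = T and \<delta> = d])
          fix n y assume y: "n \<ge> T" "y \<in> ?D" "dist y z < d"
          have yC: "fst y \<in> ?C" using y(2) by auto
          have "dist (fst y) (fst z) < d" using dist_fst_le[of y z] y(3) by linarith
          from d(2)[OF yC this] have "ui (fst y) \<le> ui (fst z) + e / 2" unfolding dist_real_def by linarith
          moreover have "v n y < ui (fst y) + e / 2"
            using T(2)[of "snd y + max n 0" "fst y"] y yC by (cases y) (auto simp: v_def)
          ultimately show "v n y \<le> ui (fst z) + e" by linarith
        qed (use vbd z d(1) in auto)
      qed
      show "ui (fst z) \<le> relaxed_limsup ?D v z"
      proof (rule ccontr)
        assume "\<not> ?thesis"
        then have "relaxed_limsup ?D v z < ui (fst z)" by simp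
        have "\<exists>B. \<exists>\<delta>>0. \<forall>\<beta>\<ge>B. \<forall>y\<in>?D. dist y z < \<delta> \<longrightarrow> v \<beta> y < ui (fst z)"
          by (rule relaxed_limsup_lessD[where ?B0.0 = 0 and M = M]) (use vbd \<open>relaxed_limsup ?D v z < ui (fst z)\<close> in auto)
        then obtain B \<delta> where "\<delta> > 0" "\<forall>\<beta>\<ge>B. \<forall>y\<in>?D. dist y z < \<delta> \<longrightarrow> v \<beta> y < ui (fst z)" by blast
        then have "v B z < ui (fst z)" using z by auto
        moreover have "ui (fst z) \<le> v B z"
          using ui_le[OF xC, of "snd z + max B 0"] z by (cases z) (auto simp: v_def)
        ultimately show False by simp
      qed
    qed
    have opD: "open (\<Omega> \<times> {0::real<..})" using op by (intro open_Times) auto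
    show ?thesis
      unfolding subsol_def
    proof (intro ballI allI impI)
      fix z a A assume z: "z \<in> \<Omega> \<times> {0::real<..}" and sj: "superjet (\<lambda>z. ui (fst z)) z a A"
      have e: "\<forall>\<^sub>F y in nhds z. relaxed_limsup ?D v y = ui (fst y)"
        using eventually_nhds_in_open[OF opD z]
        by eventually_elim (use closure_subset[of \<Omega>] in \<open>auto intro!: eq\<close>)
      have "relaxed_limsup ?D v z = ui (fst z)" using z closure_subset[of \<Omega>] by (auto intro!: eq)
      then have "\<forall>\<^sub>F h in nhds 0. relaxed_limsup ?D v (z + h) - ui (fst (z + h)) \<le> relaxed_limsup ?D v z - ui (fst z)"
        using e eventually_nhds_shift[of "\<lambda>y. relaxed_limsup ?D v y = ui (fst y)" z] by (auto elim: eventually_mono)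
      from superjet_touch[OF sj this] hs z show "F_limit b (snd a) (space_trace A) \<le> 0"
        unfolding subsol_def by blast
    qed
  qed
  have ui_class: "viscosity_subharmonic \<Omega> ui"
    unfolding viscosity_subharmonic_def
  proof (intro conjI allI impI)
    show "bounded (ui ` ?C)" by (intro compact_imp_bounded compact_continuous_image ui_cont cpt)
    show "upper_semicontinuous_on ?C ui" by (rule continuous_imp_usc[OF ui_cont])
    fix \<phi> x assume \<phi>: "smooth_on \<Omega> \<phi>" and max: "local_max_on \<Omega> (\<lambda>y. ui y - \<phi> y) x"
    then have x: "x \<in> \<Omega>" by (simp add: local_max_on_def)
    obtain G A where G: "\<And>y. y \<in> \<Omega> \<Longrightarrow> (\<phi> has_derivative (\<lambda>h. G y \<bullet> h)) (at y)"
      "(G has_derivative A) (at x)" "jet2 \<phi> x (G x) A" using smooth_on_jet2[OF op x \<phi>] by blast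
    have "superjet ui x (G x) A"
      by (rule superjet_touch[OF jet2_superjet[OF G(3)] max[unfolded local_max_on_open[OF op x]]])
    from superjet_lift[OF this, of 1] ui_sub x
    have "F_limit b (snd (G x, 0)) (space_trace (\<lambda>h. (A (fst h), 0))) \<le> 0"
      unfolding subsol_def by (metis (no_types, lifting) SigmaI greaterThan_iff zero_less_one)
    then have "0 \<le> space_trace (\<lambda>h :: 'a \<times> real. (A (fst h), 0 :: real))" using F_limit_le_iff[OF b] by simp
    also have "\<dots> = laplacian \<phi> x"
      using line_derivs(2)[OF op x G(1,2)] by (simp add: space_trace_def laplacian_def)
    finally show "- laplacian \<phi> x \<le> 0" by simp
  qed
  \<comment> \<open>\<open>ui\<close> is itself admissible, so the supremum is a maximum.\<close>
  have proj: "projected_datum \<Omega> u0 x = ui x" if x: "x \<in> ?C" for x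
    unfolding projected_datum_def
  proof (rule cSup_eq_maximum)
    show "ui x \<in> {v x | v. (\<forall>y\<in>?C. v y \<le> u0 y) \<and> viscosity_subharmonic \<Omega> v \<and> (\<forall>y\<in>frontier \<Omega>. v y \<le> 0)}"
      using ui_u0 ui_class ui_fr by blast
    fix c assume "c \<in> {v x | v. (\<forall>y\<in>?C. v y \<le> u0 y) \<and> viscosity_subharmonic \<Omega> v \<and> (\<forall>y\<in>frontier \<Omega>. v y \<le> 0)}"
    then obtain v where v: "c = v x" "\<And>y. y \<in> ?C \<Longrightarrow> v y \<le> u0 y" "viscosity_subharmonic \<Omega> v" "\<And>y. y \<in> frontier \<Omega> \<Longrightarrow> v y \<le> 0"
      by blast
    have "bounded (v ` ?C)" and vusc: "upper_semicontinuous_on ?C v" using v(3) by (auto simp: viscosity_subharmonic_def)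
    then obtain M' where M': "\<And>y. y \<in> ?C \<Longrightarrow> \<bar>v y\<bar> \<le> M'" unfolding bounded_iff by auto
    show "c \<le> ui x"
    proof (rule ui_ge)
      fix t :: real assume t: "t \<ge> 0"
      have "(\<lambda>z. v (fst z)) (x, t) \<le> w (x, t)"
      proof (rule comparison[OF op bdd b, where T = "t + 1"])
        show "upper_semicontinuous_on (?C \<times> {0..t + 1}) (\<lambda>z. v (fst z))"
          by (rule usc_compose[OF vusc]) (auto intro!: continuous_intros)
        have "continuous_on (?C \<times> {0..t + 1}) w" by (rule continuous_on_subset[OF wc]) auto
        then show "upper_semicontinuous_on (?C \<times> {0..t + 1}) (\<lambda>z. - w z)"
          by (intro continuous_imp_usc continuous_intros)
        show "subsol (F_limit b) (\<Omega> \<times> {0<..<t + 1}) (\<lambda>z. v (fst z))"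
          by (rule subsol_subset[OF viscosity_subharmonic_subsol[OF op b v(3)]]) auto
        show "subsol (negF (F_limit b)) (\<Omega> \<times> {0<..<t + 1}) (\<lambda>z. - w z)"
          by (rule subsol_subset[OF wsup]) auto
      qed (use M' v wi w0 x t in auto)
      then show "c \<le> w (x, t)" by (simp add: v(1))
    qed
  qed
  show ?thesis
    unfolding uniform_limit_iff
  proof (intro allI impI)
    fix e :: real assume e: "e > 0"
    obtain T where T: "T \<ge> 0" "\<And>t x. t \<ge> T \<Longrightarrow> x \<in> ?C \<Longrightarrow> w (x, t) < ui x + e" using unif[OF e] by blast
    have "dist (w (x, t)) (projected_datum \<Omega> u0 x) < e" if "t \<ge> T" "x \<in> ?C" for x t
      using T(2)[OF that] ui_le[OF that(2), of t] T(1) that proj[OF that(2)] by (simp add: dist_real_def)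
    then show "\<forall>\<^sub>F t in at_top. \<forall>x\<in>?C. dist (w (x, t)) (projected_datum \<Omega> u0 x) < e"
      unfolding eventually_at_top_linorder by blast
  qed
qed

section \<open>The limit of the solutions\<close>

lemma relaxed_limsup_le_barrier:
  fixes u :: "real \<Rightarrow> 'b::metric_space \<Rightarrow> real"
  assumes bd: "\<And>\<beta> y. \<beta> > B0 \<Longrightarrow> y \<in> D \<Longrightarrow> \<bar>u \<beta> y\<bar> \<le> M" and z: "z \<in> D"
    and S: "continuous_on UNIV S" "\<And>\<beta> y. \<beta> > B0 \<Longrightarrow> y \<in> D \<Longrightarrow> u \<beta> y \<le> S y"
  shows "relaxed_limsup D u z \<le> S z"
proof (rule field_le_epsilon)
  fix e :: real assume "e > 0"
  then obtain d where d: "d > 0" "\<And>y. dist y z < d \<Longrightarrow> dist (S y) (S z) < e"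
    using S(1) unfolding continuous_on_iff by blast
  show "relaxed_limsup D u z \<le> S z + e"
  proof (rule relaxed_limsup_leI[where ?B0.0 = B0 and M = M and B = "B0 + 1" and \<delta> = d])
    fix \<beta> y assume y: "\<beta> \<ge> B0 + 1" "y \<in> D" "dist y z < d"
    then have "u \<beta> y \<le> S y" by (intro S(2)) auto
    then show "u \<beta> y \<le> S z + e" using d(2)[OF y(3)] unfolding dist_real_def by linarith
  qed (use bd z d in auto)
qed

text \<open>The lower relaxed limit lies below the upper one, since both can be tested at
  \<open>z\<close> itself with one large index.\<close>

lemma relaxed_limsup_ge_relaxed:
  fixes u :: "real \<Rightarrow> 'b::metric_space \<Rightarrow> real"
  assumes bd: "\<And>\<beta> y. \<beta> > B0 \<Longrightarrow> y \<in> D \<Longrightarrow> \<bar>u \<beta> y\<bar> \<le> M" and z: "z \<in> D"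
  shows "- relaxed_limsup D (\<lambda>\<beta> y. - u \<beta> y) z \<le> relaxed_limsup D u z"
proof (rule field_le_epsilon)
  fix e :: real assume e: "e > 0"
  have "\<exists>B. \<exists>\<delta>>0. \<forall>\<beta>\<ge>B. \<forall>y\<in>D. dist y z < \<delta> \<longrightarrow> u \<beta> y < relaxed_limsup D u z + e / 2"
    by (rule relaxed_limsup_lessD[where ?B0.0 = B0 and M = M]) (use bd e in auto)
  then obtain B1 d1 where 1: "d1 > 0" "\<forall>\<beta>\<ge>B1. \<forall>y\<in>D. dist y z < d1 \<longrightarrow> u \<beta> y < relaxed_limsup D u z + e / 2" by blast
  have "\<exists>B. \<exists>\<delta>>0. \<forall>\<beta>\<ge>B. \<forall>y\<in>D. dist y z < \<delta> \<longrightarrow> - u \<beta> y < relaxed_limsup D (\<lambda>\<beta> y. - u \<beta> y) z + e / 2"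
    by (rule relaxed_limsup_lessD[where ?B0.0 = B0 and M = M]) (use bd e in auto)
  then obtain B2 d2 where 2: "d2 > 0"
    "\<forall>\<beta>\<ge>B2. \<forall>y\<in>D. dist y z < d2 \<longrightarrow> - u \<beta> y < relaxed_limsup D (\<lambda>\<beta> y. - u \<beta> y) z + e / 2" by blast
  have "u (max B1 B2) z < relaxed_limsup D u z + e / 2" using 1 z by simp
  moreover have "- u (max B1 B2) z < relaxed_limsup D (\<lambda>\<beta> y. - u \<beta> y) z + e / 2" using 2 z by simp
  ultimately show "- relaxed_limsup D (\<lambda>\<beta> y. - u \<beta> y) z \<le> relaxed_limsup D u z + e" by linarith
qed

lemma usc_usc_continuous:
  assumes "upper_semicontinuous_on S f" "upper_semicontinuous_on S (\<lambda>x. - f x)"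
  shows "continuous_on S f"
  unfolding continuous_on_def
proof (intro ballI order_tendstoI)
  fix x a assume x: "x \<in> S"
  show "\<forall>\<^sub>F y in at x within S. f y < a" if "f x < a"
    using assms(1) x that unfolding upper_semicontinuous_on_def by blast
  show "\<forall>\<^sub>F y in at x within S. a < f y" if "a < f x"
  proof -
    have "\<forall>\<^sub>F y in at x within S. - f y < - a"
      using assms(2)[unfolded upper_semicontinuous_on_def, rule_format, OF x, of "- a"] that by simp
    then show ?thesis by simp
  qed
qed

text \<open>Comparison gives \<open>V \<le> - W\<close> and the reverse inequality is automatic, so
  the two relaxed limits coincide. The common function is semicontinuous from both sides, hence
  continuous, and it inherits both viscosity inequalities.\<close>

theorem two_speed_limit:
  fixes \<Omega> :: "'a::euclidean_space set"
  assumes \<Omega>: "smooth_bounded_domain \<Omega>" and u0: "continuous_on (closure \<Omega>) u0" "\<forall>x\<in>frontier \<Omega>. u0 x = 0"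
    and b: "b > 0" and u: "\<And>\<beta>. \<beta> > b \<Longrightarrow> sub_super (F_two_speed b \<beta>) \<Omega> u0 (u \<beta>)"
  shows "\<exists>w. sub_super (F_limit b) \<Omega> u0 w \<and>
    (\<forall>K. compact K \<longrightarrow> K \<subseteq> closure \<Omega> \<times> {0..} \<longrightarrow> uniform_limit K u w at_top)"
proof -
  have op: "open \<Omega>" and bdd: "bounded \<Omega>" using \<Omega> by (auto simp: smooth_bounded_domain_def)
  let ?C = "closure \<Omega>"
  define D where "D = ?C \<times> {0::real..}"
  have cpt: "compact ?C" using bdd by (simp add: compact_closure)
  have fr: "frontier \<Omega> \<subseteq> ?C" by (auto simp: frontier_def)
  have u': "sub_super (negF (F_two_speed b \<beta>)) \<Omega> (\<lambda>x. - u0 x) (\<lambda>z. - u \<beta> z)" if "\<beta> > b" for \<beta>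
    by (rule sub_super_uminus[OF u[OF that]])
  have u0': "continuous_on ?C (\<lambda>x. - u0 x)" "\<forall>x\<in>frontier \<Omega>. - u0 x = 0" using u0 by (auto intro!: continuous_intros)
  note gr = growth_two_speed[OF _ b]
  have "bounded (u0 ` ?C)" by (intro compact_imp_bounded compact_continuous_image u0 cpt)
  then obtain M where M: "M > 0" "\<And>x. x \<in> ?C \<Longrightarrow> \<bar>u0 x\<bar> \<le> M" unfolding bounded_pos by auto
  have bd: "\<bar>u \<beta> z\<bar> \<le> M" if \<beta>: "\<beta> > b" and z: "z \<in> D" for \<beta> z
  proof -
    have "u \<beta> z \<le> M"
      using M by (intro sub_super_le_const[OF op bdd gr(1)[OF \<beta>] u[OF \<beta>] _ _ z[unfolded D_def]]) (auto simp: abs_le_iff)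
    moreover have "- u \<beta> z \<le> M"
      using M by (intro sub_super_le_const[OF op bdd gr(2)[OF \<beta>] u'[OF \<beta>] _ _ z[unfolded D_def]]) (auto simp: abs_le_iff)
    ultimately show ?thesis by simp
  qed
  have bd': "\<bar>- u \<beta> z\<bar> \<le> M" if "\<beta> > b" "z \<in> D" for \<beta> z using bd[OF that] by simp
  define V where "V = relaxed_limsup D u"
  define W where "W = relaxed_limsup D (\<lambda>\<beta> z. - u \<beta> z)"
  have OD: "open (\<Omega> \<times> {0::real<..})" "\<Omega> \<times> {0<..} \<subseteq> D"
    using op closure_subset[of \<Omega>] by (auto simp: D_def intro!: open_Times)
  have uc: "continuous_on (\<Omega> \<times> {0<..}) (u \<beta>)" if "\<beta> > b" for \<beta>
    using u[OF that] OD(2) by (auto simp: sub_super_def D_def intro: continuous_on_subset)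
  have Vsub: "subsol (F_limit b) (\<Omega> \<times> {0<..}) V"
    unfolding V_def
  proof (rule relaxed_limsup_subsol[where ?B0.0 = b and M = M and F = "F_two_speed b"])
    show "subsol (F_two_speed b \<beta>) (\<Omega> \<times> {0<..}) (u \<beta>)" if "\<beta> > b" for \<beta>
      using u[OF that] by (simp add: sub_super_def)
    show "\<exists>e>0. \<exists>B. \<forall>\<beta>\<ge>B. \<forall>p l. \<bar>p - p0\<bar> < e \<longrightarrow> \<bar>l - l0\<bar> < e \<longrightarrow> 0 < F_two_speed b \<beta> p l"
      if "0 < F_limit b p0 l0" for p0 l0 by (rule two_speed_limit_positive[OF b that])
  qed (use bd OD uc in auto)
  have Wsub: "subsol (negF (F_limit b)) (\<Omega> \<times> {0<..}) W"
    unfolding W_def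
  proof (rule relaxed_limsup_subsol[where ?B0.0 = b and M = M and F = "\<lambda>\<beta>. negF (F_two_speed b \<beta>)"])
    show "subsol (negF (F_two_speed b \<beta>)) (\<Omega> \<times> {0<..}) (\<lambda>z. - u \<beta> z)" if "\<beta> > b" for \<beta>
      using u[OF that] by (simp add: sub_super_def)
    show "\<exists>e>0. \<exists>B. \<forall>\<beta>\<ge>B. \<forall>p l. \<bar>p - p0\<bar> < e \<longrightarrow> \<bar>l - l0\<bar> < e \<longrightarrow> 0 < negF (F_two_speed b \<beta>) p l"
      if "0 < negF (F_limit b) p0 l0" for p0 l0 by (rule two_speed_limit_negative[OF b that])
    show "continuous_on (\<Omega> \<times> {0<..}) (\<lambda>z. - u \<beta> z)" if "\<beta> > b" for \<beta>
      by (intro continuous_intros uc that)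
  qed (use bd' OD in auto)
  \<comment> \<open>Stated for a general family so that it serves both \<open>u\<close> and
    \<open>- u\<close>. The barrier does not depend on \<beta> and therefore bounds the relaxed
    limit.\<close>
  have initial: "relaxed_limsup D y (x, 0) \<le> f0 x"
    if F: "\<And>\<beta>. \<beta> > b \<Longrightarrow> growth b (F \<beta>)" and y: "\<And>\<beta>. \<beta> > b \<Longrightarrow> sub_super (F \<beta>) \<Omega> f0 (y \<beta>)"
      and f0: "continuous_on ?C f0" "\<forall>x\<in>frontier \<Omega>. f0 x = 0"
      and yb: "\<And>\<beta> z. \<beta> > b \<Longrightarrow> z \<in> D \<Longrightarrow> \<bar>y \<beta> z\<bar> \<le> M" and x: "x \<in> ?C" for F y f0 x
  proof (rule field_le_epsilon)
    fix e :: real assume "e > 0"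
    then obtain S where S: "classical_super b \<Omega> S" "\<forall>x\<in>?C. f0 x \<le> S (x, 0)" "\<forall>x\<in>frontier \<Omega>. \<forall>t\<ge>0. 0 \<le> S (x, t)"
      "S (x, 0) \<le> f0 x + e" using initial_barrier[OF bdd f0 b x] by blast
    have "relaxed_limsup D y (x, 0) \<le> S (x, 0)"
    proof (rule relaxed_limsup_le_barrier[where ?B0.0 = b and M = M])
      show "continuous_on UNIV S" using S(1) by (simp add: classical_super_def)
      show "y \<beta> z \<le> S z" if "\<beta> > b" "z \<in> D" for \<beta> z
        using that(2) unfolding D_def by (rule sub_super_le_barrier[OF op bdd F[OF that(1)] y[OF that(1)] S(1,2,3)])
    qed (use yb x in \<open>auto simp: D_def\<close>)
    then show "relaxed_limsup D y (x, 0) \<le> f0 x + e" using S(4) by simp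
  qed
  have lateral: "relaxed_limsup D y (x, t) \<le> 0"
    if F: "\<And>\<beta>. \<beta> > b \<Longrightarrow> growth b (F \<beta>)" and y: "\<And>\<beta>. \<beta> > b \<Longrightarrow> sub_super (F \<beta>) \<Omega> f0 (y \<beta>)"
      and f0: "continuous_on ?C f0" "\<forall>x\<in>frontier \<Omega>. f0 x = 0"
      and yb: "\<And>\<beta> z. \<beta> > b \<Longrightarrow> z \<in> D \<Longrightarrow> \<bar>y \<beta> z\<bar> \<le> M" and x: "x \<in> frontier \<Omega>" and t: "t \<ge> 0" for F y f0 x t
  proof (rule field_le_epsilon)
    fix e :: real assume "e > 0"
    then obtain \<psi> where \<psi>: "classical_super b \<Omega> (\<lambda>z. \<psi> (fst z))" "continuous_on UNIV \<psi>"
      "\<forall>x\<in>?C. f0 x \<le> \<psi> x \<and> 0 \<le> \<psi> x" "\<psi> x \<le> e" using boundary_barrier[OF \<Omega> f0 b x] by blast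
    have "relaxed_limsup D y (x, t) \<le> \<psi> (fst (x, t))"
    proof (rule relaxed_limsup_le_barrier[where ?B0.0 = b and M = M and S = "\<lambda>z :: 'a \<times> real. \<psi> (fst z)"])
      show "continuous_on UNIV (\<lambda>z :: 'a \<times> real. \<psi> (fst z))" using \<psi>(1) by (simp add: classical_super_def)
      show "y \<beta> z \<le> \<psi> (fst z)" if "\<beta> > b" "z \<in> D" for \<beta> z
        by (rule sub_super_le_barrier[OF op bdd F[OF that(1)] y[OF that(1)] \<psi>(1)])
          (use \<psi>(3) that(2) fr in \<open>auto simp: D_def\<close>)
    qed (use yb x t fr in \<open>auto simp: D_def\<close>)
    then show "relaxed_limsup D y (x, t) \<le> 0 + e" using \<psi>(4) by simp
  qed
  have V0: "V (x, 0) \<le> u0 x" if "x \<in> ?C" for x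
    unfolding V_def by (rule initial[OF gr(1) u u0 bd that])
  have W0: "W (x, 0) \<le> - u0 x" if "x \<in> ?C" for x
    unfolding W_def by (rule initial[OF gr(2) u' u0' bd' that])
  have Vl: "V (x, t) \<le> 0" if "x \<in> frontier \<Omega>" "t \<ge> 0" for x t
    unfolding V_def by (rule lateral[OF gr(1) u u0 bd that])
  have Wl: "W (x, t) \<le> 0" if "x \<in> frontier \<Omega>" "t \<ge> 0" for x t
    unfolding W_def by (rule lateral[OF gr(2) u' u0' bd' that])
  have Vusc: "upper_semicontinuous_on D V" unfolding V_def by (rule relaxed_limsup_usc[where ?B0.0 = b and M = M]) (use bd in auto)
  have Wusc: "upper_semicontinuous_on D W" unfolding W_def by (rule relaxed_limsup_usc[where ?B0.0 = b and M = M]) (use bd' in auto)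
  have le: "V z \<le> - W z" if z: "z \<in> D" for z
  proof -
    obtain x t where xt: "z = (x, t)" by (cases z)
    have s: "?C \<times> {0..t + 1} \<subseteq> D" by (auto simp: D_def)
    have "V (x, t) \<le> - W (x, t)"
    proof (rule comparison[OF op bdd b, where T = "t + 1"])
      show "upper_semicontinuous_on (?C \<times> {0..t + 1}) V" by (rule usc_subset[OF Vusc s])
      show "upper_semicontinuous_on (?C \<times> {0..t + 1}) (\<lambda>z. - (- W z))" using usc_subset[OF Wusc s] by simp
      show "\<bar>V z\<bar> \<le> M" if "z \<in> ?C \<times> {0..t + 1}" for z
        unfolding V_def by (rule relaxed_limsup_bounds[where ?B0.0 = b]) (use bd s that in auto)
      show "subsol (F_limit b) (\<Omega> \<times> {0<..<t + 1}) V" by (rule subsol_subset[OF Vsub]) auto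
      have "subsol (negF (F_limit b)) (\<Omega> \<times> {0<..<t + 1}) W" by (rule subsol_subset[OF Wsub]) auto
      then show "subsol (negF (F_limit b)) (\<Omega> \<times> {0<..<t + 1}) (\<lambda>z. - (- W z))" by simp
      show "V (x, 0) \<le> - W (x, 0)" if "x \<in> ?C" for x using V0[OF that] W0[OF that] by simp
      show "V (x, s) \<le> - W (x, s)" if "x \<in> frontier \<Omega>" "0 \<le> s" for x s using Vl[OF that] Wl[OF that] by simp
    qed (use z xt D_def in auto)
    then show ?thesis by (simp add: xt)
  qed
  have WV: "W z = - V z" if "z \<in> D" for z
  proof -
    have "- W z \<le> V z" unfolding V_def W_def by (rule relaxed_limsup_ge_relaxed[where ?B0.0 = b and M = M]) (use bd that in auto)
    then show ?thesis using le[OF that] by simp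
  qed
  have "upper_semicontinuous_on D (\<lambda>z. - V z)"
    unfolding upper_semicontinuous_on_def
  proof (intro ballI allI impI)
    fix z a assume z: "z \<in> D" and a: "- V z < a"
    have "\<forall>\<^sub>F y in at z within D. W y < a" using Wusc z a WV[OF z] unfolding upper_semicontinuous_on_def by simp
    moreover have "\<forall>\<^sub>F y in at z within D. y \<in> D" by (simp add: eventually_at_filter)
    ultimately show "\<forall>\<^sub>F y in at z within D. - V y < a" by eventually_elim (simp add: WV)
  qed
  then have Vc: "continuous_on D V" by (rule usc_usc_continuous[OF Vusc])
  have Vneg: "subsol (negF (F_limit b)) (\<Omega> \<times> {0<..}) (\<lambda>z. - V z)"
    unfolding subsol_def
  proof (intro ballI allI impI)
    fix z a A assume z: "z \<in> \<Omega> \<times> {0<..}" and sj: "superjet (\<lambda>z. - V z) z a A"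
    have e: "\<forall>\<^sub>F y in nhds z. W y = - V y"
      using eventually_nhds_in_open[OF OD(1) z] by eventually_elim (use OD(2) WV in blast)
    have "W z = - V z" using z OD(2) WV by blast
    then have "\<forall>\<^sub>F h in nhds 0. W (z + h) - - V (z + h) \<le> W z - - V z"
      using e eventually_nhds_shift[of "\<lambda>y. W y = - V y" z] by (auto elim: eventually_mono)
    from superjet_touch[OF sj this] Wsub z show "negF (F_limit b) (snd a) (space_trace A) \<le> 0"
      unfolding subsol_def by blast
  qed
  have "sub_super (F_limit b) \<Omega> u0 V"
    unfolding sub_super_def
  proof (intro conjI ballI allI impI)
    show "continuous_on (?C \<times> {0..}) V" using Vc by (simp add: D_def)
    show "V (x, t) = 0" if "x \<in> frontier \<Omega>" "0 \<le> t" for x t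
    proof -
      have "(x, t) \<in> D" using that fr by (auto simp: D_def)
      then show ?thesis using Vl[OF that] Wl[OF that] WV by force
    qed
    show "V (x, 0) = u0 x" if "x \<in> ?C" for x
    proof -
      have "(x, 0) \<in> D" using that by (auto simp: D_def)
      then show ?thesis using V0[OF that] W0[OF that] WV by force
    qed
  qed (rule Vsub Vneg)+
  \<comment> \<open>The relaxed limits lie strictly below \<open>V + e\<close> and
    \<open>- V + e\<close>; uniformity on compact sets turns this into a two-sided estimate for
    \<open>u \<beta>\<close>.\<close>
  moreover have "uniform_limit K u V at_top" if K: "compact K" "K \<subseteq> ?C \<times> {0..}" for K
    unfolding uniform_limit_iff
  proof (intro allI impI)
    fix e :: real assume e: "e > 0"
    have KD: "K \<subseteq> D" using K by (simp add: D_def)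
    have KV: "continuous_on K V" by (rule continuous_on_subset[OF Vc KD])
    have "\<exists>B. \<forall>\<beta>\<ge>B. \<forall>y\<in>K. u \<beta> y < V y + e"
    proof (rule relaxed_limsup_uniform[where ?B0.0 = b and M = M and D = D])
      show "continuous_on K (\<lambda>y. V y + e)" by (intro continuous_intros KV)
    qed (use bd K KD e V_def in auto)
    then obtain B1 where B1: "\<And>\<beta> y. \<beta> \<ge> B1 \<Longrightarrow> y \<in> K \<Longrightarrow> u \<beta> y < V y + e" by blast
    have "\<exists>B. \<forall>\<beta>\<ge>B. \<forall>y\<in>K. - u \<beta> y < - V y + e"
    proof (rule relaxed_limsup_uniform[where ?B0.0 = b and M = M and D = D])
      show "continuous_on K (\<lambda>y. - V y + e)" by (intro continuous_intros KV)
      show "relaxed_limsup D (\<lambda>\<beta> y. - u \<beta> y) y < - V y + e" if "y \<in> K" for y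
        using WV[of y] that KD e by (auto simp: W_def)
    qed (use bd K KD in auto)
    then obtain B2 where B2: "\<And>\<beta> y. \<beta> \<ge> B2 \<Longrightarrow> y \<in> K \<Longrightarrow> - u \<beta> y < - V y + e" by blast
    have "dist (u \<beta> y) (V y) < e" if "\<beta> \<ge> max B1 B2" "y \<in> K" for \<beta> y
    proof -
      have "u \<beta> y < V y + e" "- u \<beta> y < - V y + e" using that B1[of \<beta> y] B2[of \<beta> y] by simp_all
      then show ?thesis unfolding dist_real_def by linarith
    qed
    then show "\<forall>\<^sub>F \<beta> in at_top. \<forall>y\<in>K. dist (u \<beta> y) (V y) < e"
      unfolding eventually_at_top_linorder by blast
  qed
  ultimately show ?thesis by blast
qed

theorem theorem1p3:
  fixes \<Omega> :: "(real ^ 'n) set"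
    and u\<^sub>0 :: "real ^ 'n \<Rightarrow> real"
    and bm :: real
    and u :: "real \<Rightarrow> (real ^ 'n) \<times> real \<Rightarrow> real"
  assumes "smooth_bounded_domain \<Omega>"
    and "continuous_on (closure \<Omega>) u\<^sub>0"
    and "\<forall>x\<in>frontier \<Omega>. u\<^sub>0 x = 0"
    and "bm > 0"
    and "\<And>bp. bp > bm \<Longrightarrow> dirichlet_viscosity_solution (F_two_speed bm bp) \<Omega> u\<^sub>0 (u bp)"
  shows "\<exists>ubar.
    dirichlet_viscosity_solution (F_limit bm) \<Omega> u\<^sub>0 ubar \<and>
    (\<forall>w. dirichlet_viscosity_solution (F_limit bm) \<Omega> u\<^sub>0 w \<longrightarrow>
         (\<forall>z \<in> closure \<Omega> \<times> {0..}. w z = ubar z)) \<and>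
    (\<forall>K. compact K \<and> K \<subseteq> closure \<Omega> \<times> {0<..} \<longrightarrow> uniform_limit K u ubar at_top) \<and>
    uniform_limit (closure \<Omega>) (\<lambda>t x. ubar (x, t)) (projected_datum \<Omega> u\<^sub>0) at_top"
proof -
  have op: "open \<Omega>" and bdd: "bounded \<Omega>" using assms(1) by (auto simp: smooth_bounded_domain_def)
  have "sub_super (F_two_speed bm bp) \<Omega> u\<^sub>0 (u bp)" if "bp > bm" for bp
    by (rule dirichlet_sub_super[OF op assms(3) continuous_F_two_speed assms(5)[OF that]])
  from two_speed_limit[OF assms(1-4), of u] this
  obtain w where w: "sub_super (F_limit bm) \<Omega> u\<^sub>0 w"
    "\<And>K. compact K \<Longrightarrow> K \<subseteq> closure \<Omega> \<times> {0..} \<Longrightarrow> uniform_limit K u w at_top" by blast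
  have "dirichlet_viscosity_solution (F_limit bm) \<Omega> u\<^sub>0 w"
    unfolding dirichlet_viscosity_solution_def
    using w(1) parabolic_viscosityI[OF op, of "F_limit bm" w] closure_subset[of \<Omega>]
    by (auto simp: sub_super_def)
  moreover have "w' z = w z" if "dirichlet_viscosity_solution (F_limit bm) \<Omega> u\<^sub>0 w'" "z \<in> closure \<Omega> \<times> {0..}" for w' z
  proof -
    have w': "sub_super (F_limit bm) \<Omega> u\<^sub>0 w'"
      by (rule dirichlet_sub_super[OF op assms(3) continuous_F_limit that(1)])
    show ?thesis
      using sub_super_comparison[OF op bdd assms(4) w(1) w' that(2)]
        sub_super_comparison[OF op bdd assms(4) w' w(1) that(2)] by simp
  qed
  \<comment> \<open>\<open>two_speed_limit\<close> gives uniform convergence up to the initial time;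
    here it is applied to compact sets in positive time.\<close>
  moreover have "uniform_limit K u w at_top" if "compact K" "K \<subseteq> closure \<Omega> \<times> {0<..}" for K
    using that by (intro w(2)) auto
  moreover have "uniform_limit (closure \<Omega>) (\<lambda>t x. w (x, t)) (projected_datum \<Omega> u\<^sub>0) at_top"
    by (rule long_time[OF assms(1-4) w(1)])
  ultimately show ?thesis by blast
qed

end
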